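(* Let $\{D(t):t\ge 0\}$ be a growing family of bounded domains in $\mathbb{C}$ with smooth analytic boundaries such that $$\frac{d}{dt}\,\mathrm{area}(D(t))\Big|_{t=t_0}=0$$ at some time $t_0$. Then no elliptic growth of Schrödinger type can drive the dynamics; that is, there are no potential $u$ and singularity $w$ for which $\{D(t)\}$ is an elliptic growth process via the operator $\Delta-u$ with singularity $w$.
   Context: Elliptic growth of Schrödinger type with operator $\Delta-u$ and singularity $w$: $u\ge 0$ is a smooth real function on an open set containing the closures of all the domains, $w\in\bigcap_t D(t)$, and the outward normal velocity $v_n$ of $\partial D(t)$ satisfies $v_n=\partial_n g_w$ on $\partial D(t)$ for every $t$. Here $g_w$ is the Green function of $\Delta-u$ on $D(t)$, with $(\Delta-u)g_w=\delta_w$ in $D(t)$ and $g_w=0$ on $\partial D(t)$, and $\partial_n$ is the outward normal derivative. "Growing" means nested increasing in $t$. *)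

theory Defs
  imports "HOL-Analysis.Analysis" "HOL-Complex_Analysis.Complex_Analysis"
begin

section \<open>Smooth functions, the Laplacian, test functions\<close>

definition pdiff :: "'a::euclidean_space \<Rightarrow> ('a \<Rightarrow> real) \<Rightarrow> 'a \<Rightarrow> real" where
  "pdiff b f = (\<lambda>z. frechet_derivative f (at z) b)"

primrec Ck_on :: "nat \<Rightarrow> 'a::euclidean_space set \<Rightarrow> ('a \<Rightarrow> real) \<Rightarrow> bool" where
  "Ck_on 0 S f \<longleftrightarrow> continuous_on S f"
| "Ck_on (Suc k) S f \<longleftrightarrow> f differentiable_on S \<and> (\<forall>b\<in>Basis. Ck_on k S (pdiff b f))"

text \<open>\<open>Ck_on\<close> and \<open>smooth_on\<close> are meant for open sets \<open>S\<close> only.\<close>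

definition smooth_on :: "'a::euclidean_space set \<Rightarrow> ('a \<Rightarrow> real) \<Rightarrow> bool" where
  "smooth_on S f \<longleftrightarrow> (\<forall>k. Ck_on k S f)"

definition laplacian :: "('a::euclidean_space \<Rightarrow> real) \<Rightarrow> 'a \<Rightarrow> real" where
  "laplacian f z = (\<Sum>b\<in>Basis. pdiff b (pdiff b f) z)"

definition test_function :: "'a::euclidean_space set \<Rightarrow> ('a \<Rightarrow> real) \<Rightarrow> bool" where
  "test_function D \<phi> \<longleftrightarrow> smooth_on UNIV \<phi> \<and>
     compact (closure {z. \<phi> z \<noteq> 0}) \<and> closure {z. \<phi> z \<noteq> 0} \<subseteq> D"

section \<open>Domains with analytic boundary\<close>

definition bounded_domain :: "complex set \<Rightarrow> bool" where
  "bounded_domain D \<longleftrightarrow> open D \<and> connected D \<and> D \<noteq> {} \<and> bounded D"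

text \<open>Near each boundary point the boundary is a regular real-analytic arc with \<open>D\<close> on exactly
  one side of it: complexifying a regular real-analytic parametrisation of the arc and inverting
  gives the conformal map \<open>f\<close>, which straightens the arc to the real axis and sends \<open>D\<close> to the
  upper half plane.\<close>

definition analytic_boundary :: "complex set \<Rightarrow> bool" where
  "analytic_boundary D \<longleftrightarrow> (\<forall>z\<in>frontier D. \<exists>U f. open U \<and> z \<in> U \<and> f holomorphic_on U \<and>
     inj_on f U \<and> (\<forall>p\<in>U. p \<in> D \<longleftrightarrow> Im (f p) > 0))"

text \<open>\<open>\<nu>\<close> is a unit vector orthogonal to the tangent line of \<open>frontier D\<close> at \<open>z\<close> and pointing
  out of \<open>D\<close>.\<close>

definition outward_unit_normal :: "complex set \<Rightarrow> complex \<Rightarrow> complex \<Rightarrow> bool" where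
  "outward_unit_normal D z \<nu> \<longleftrightarrow> norm \<nu> = 1 \<and>
     ((\<lambda>p. ((p - z) \<bullet> \<nu>) / norm (p - z)) \<longlongrightarrow> 0) (at z within frontier D) \<and>
     (\<forall>\<^sub>F s in at_right 0. z - s *\<^sub>R \<nu> \<in> D \<and> z + s *\<^sub>R \<nu> \<notin> closure D)"

text \<open>The derivative is one-sided, from inside the domain: \<open>g\<close> only matters on \<open>closure D\<close>.\<close>

definition has_outward_normal_derivative ::
  "(complex \<Rightarrow> real) \<Rightarrow> complex set \<Rightarrow> complex \<Rightarrow> real \<Rightarrow> bool" where
  "has_outward_normal_derivative g D z v \<longleftrightarrow> (\<forall>\<nu>. outward_unit_normal D z \<nu> \<longrightarrow>
     ((\<lambda>s. g (z + s *\<^sub>R \<nu>)) has_real_derivative v) (at_left 0))"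

section \<open>Normal velocity\<close>

text \<open>Signed distance to the boundary, negative inside \<open>D\<close>.\<close>

definition signed_dist :: "complex set \<Rightarrow> complex \<Rightarrow> real" where
  "signed_dist D z = infdist z D - infdist z (- D)"

text \<open>The outward normal velocity \<open>v\<close> of the boundary at \<open>z \<in> frontier (D t)\<close>: at time \<open>s\<close> the
  boundary has moved past \<open>z\<close> by the (signed) distance \<open>v * (s - t)\<close>, up to \<open>o(s - t)\<close>. If the
  boundary has a \<open>C\<^sup>1\<close> parametrisation \<open>\<gamma>(\<theta>, t)\<close>, regular in \<open>\<theta>\<close>, then \<open>v\<close> is the outward
  normal component of \<open>\<partial>\<gamma>/\<partial>t\<close>. At \<open>t = 0\<close> the derivative is one-sided.\<close>

definition has_normal_velocity ::
  "(real \<Rightarrow> complex set) \<Rightarrow> real \<Rightarrow> complex \<Rightarrow> real \<Rightarrow> bool" where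
  "has_normal_velocity D t z v \<longleftrightarrow>
     ((\<lambda>s. signed_dist (D s) z) has_real_derivative - v) (at t within {0..})"

section \<open>Green function and elliptic growth\<close>

text \<open>\<open>(\<Delta> - u) g = \<delta>\<^sub>w\<close> in \<open>D\<close> in the sense of distributions, with \<open>g\<close> continuous up to the
  boundary away from the pole and vanishing there. With this sign convention \<open>g\<close> behaves like
  \<open>ln \<bar>z - w\<bar> / (2 * pi)\<close> at \<open>w\<close>. The value of \<open>g\<close> at \<open>w\<close> itself is irrelevant.\<close>

definition green_function ::
  "complex set \<Rightarrow> (complex \<Rightarrow> real) \<Rightarrow> complex \<Rightarrow> (complex \<Rightarrow> real) \<Rightarrow> bool" where
  "green_function D u w g \<longleftrightarrow>
     continuous_on (closure D - {w}) g \<and> (\<forall>z\<in>frontier D. g z = 0) \<and>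
     set_integrable lborel D g \<and>
     (\<forall>\<phi>. test_function D \<phi> \<longrightarrow>
        (LINT z:D|lborel. g z * (laplacian \<phi> z - u z * \<phi> z)) = \<phi> w)"

text \<open>Elliptic growth of Schroedinger type with potential \<open>u\<close> and singularity \<open>w\<close>.\<close>

definition elliptic_growth ::
  "(real \<Rightarrow> complex set) \<Rightarrow> (complex \<Rightarrow> real) \<Rightarrow> complex \<Rightarrow> bool" where
  "elliptic_growth D u w \<longleftrightarrow>
     (\<exists>\<Omega>. open \<Omega> \<and> (\<forall>t\<ge>0. closure (D t) \<subseteq> \<Omega>) \<and> smooth_on \<Omega> u \<and> (\<forall>z\<in>\<Omega>. 0 \<le> u z)) \<and>
     (\<forall>t\<ge>0. w \<in> D t) \<and>
     (\<forall>t\<ge>0. \<exists>g. green_function (D t) u w g \<and>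
        (\<forall>z\<in>frontier (D t). \<exists>v. has_normal_velocity D t z v \<and>
                                 has_outward_normal_derivative g (D t) z v))"

end

theory Submission
  imports Defs
begin

text \<open>
  The area changes at the rate at which the boundary moves, so it suffices that the boundary moves
  outwards with positive speed on a whole arc.

  The normal velocity at time \<open>t0\<close> is the outward normal derivative of the Green function \<open>g\<close> of
  \<open>\<Delta> - u\<close>, which is positive by Hopf's lemma once \<open>g < 0\<close> in \<open>D(t0)\<close>. As \<open>g\<close> solves the equation
  only in the sense of distributions, it is accessible only by testing. Rescalings of one radial test
  function, whose Laplacian is the difference of a radial weight at two consecutive dyadic scales,
  yield a telescoping mean value formula. It shows that \<open>g\<close> tends to \<open>-\<infinity>\<close> at the pole and that
  \<open>g\<close> compares with explicit polynomial barriers, which gives the maximum principles.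

  The velocity is defined only pointwise. By Baire's theorem there are an arc of the boundary and
  some \<open>k\<close> such that for every small \<open>h > 0\<close> the domain \<open>D(t0 + h)\<close> contains the disc of radius
  \<open>h / k\<close> about each point of the arc. The number of disjoint discs of comparable radius along the
  arc and outside \<open>D(t0)\<close> is of order \<open>1 / h\<close>, hence the area grows at least linearly in \<open>h\<close>.
\<close>

section \<open>Smooth functions of a real variable\<close>

text \<open>With the given sign convention \<open>g\<close> behaves like a positive multiple of ln
  |z - w|, so it should be negative inside and vanish on the boundary. The classical maximum
  principles differentiate \<open>g\<close> twice off \<open>w\<close>; here only integrability,
  continuity off \<open>w\<close> and the tested equation are given. So a comparison function F and
  \<open>g\<close> are averaged with the same kernel: a strict inequality between the Laplacian of F
  and \<open>u g\<close> makes the averages of F - g monotone in the scale, which replaces the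
  second derivative test at a minimum. Dyadic scales suffice, since the averages over shrinking
  discs converge to the value at the centre. At the pole every scale large compared to |p - w|
  contributes the same amount \<open>profile 0\<close>: this is the logarithm in discrete form. The
  boundary speed is positive at each point, but neither a common lower bound nor a common time
  interval is available, so the area cannot be differentiated as a boundary integral of the speed. A
  piece of the boundary with uniform control is enough, because the domains are nested and no area
  is lost elsewhere.\<close>

definition smooth_real :: "(real \<Rightarrow> real) \<Rightarrow> bool" where
  "smooth_real f \<longleftrightarrow>
     (\<exists>F. F (0::nat) = f \<and> (\<forall>n x. (F n has_real_derivative F (Suc n) x) (at x)))"

text \<open>Iterating a choice of derivative inside a class closed under differentiation yields the
  required sequence. Smoothness of products, quotients and the flat function thus reduces to naming
  such a class.\<close>

lemma smooth_real_coinduct: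
  assumes "f \<in> C"
    and step: "\<And>h. h \<in> C \<Longrightarrow> \<exists>h'\<in>C. \<forall>x. (h has_real_derivative h' x) (at x)"
  shows "smooth_real f"
proof -
  obtain d where d: "\<And>h. h \<in> C \<Longrightarrow> d h \<in> C \<and> (\<forall>x. (h has_real_derivative d h x) (at x))"
    using step by metis
  have "(d ^^ n) f \<in> C" for n
    by (induction n) (use assms(1) d in auto)
  then show ?thesis
    unfolding smooth_real_def
    by (intro exI[of _ "\<lambda>n. (d ^^ n) f"]) (simp add: d)
qed

lemma smooth_real_deriv:
  assumes "smooth_real f"
  obtains f' where "smooth_real f'" "\<And>x. (f has_real_derivative f' x) (at x)"
proof -
  obtain F where F: "F (0::nat) = f" "\<And>n x. (F n has_real_derivative F (Suc n) x) (at x)"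
    using assms unfolding smooth_real_def by blast
  show ?thesis
  proof
    show "smooth_real (F 1)"
      unfolding smooth_real_def by (intro exI[of _ "\<lambda>n. F (Suc n)"]) (simp add: F)
    show "(f has_real_derivative F 1 x) (at x)" for x
      using F(2)[of 0 x] F(1) by simp
  qed
qed

lemma smooth_real_primitive:
  assumes "smooth_real f" "\<And>x. (g has_real_derivative f x) (at x)"
  shows "smooth_real g"
proof -
  obtain F where F: "F (0::nat) = f" "\<And>n x. (F n has_real_derivative F (Suc n) x) (at x)"
    using assms unfolding smooth_real_def by blast
  show ?thesis
    unfolding smooth_real_def
    by (intro exI[of _ "\<lambda>n. case n of 0 \<Rightarrow> g | Suc m \<Rightarrow> F m"])
      (auto simp: F assms split: nat.split)
qed

lemma smooth_real_continuous:
  assumes "smooth_real f" shows "continuous_on S f"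
  by (meson assms smooth_real_deriv DERIV_isCont continuous_at_imp_continuous_on)

lemma smooth_real_const: "smooth_real (\<lambda>x. c)"
  by (rule smooth_real_coinduct[of _ "range (\<lambda>c x. c)"]) (auto intro: DERIV_const)

lemma smooth_real_ident: "smooth_real (\<lambda>s. s)"
  by (rule smooth_real_primitive[OF smooth_real_const[of 1]]) (auto intro!: derivative_eq_intros)

text \<open>The derivative of a product is a sum of products, so products alone do not form a class
  closed under differentiation. The generated algebra does; the chain rule factor \<open>a\<close>
  is a constant function and hence a generator too.\<close>

inductive smooth_real_alg :: "(real \<Rightarrow> real) \<Rightarrow> bool" where
  base: "smooth_real f \<Longrightarrow> smooth_real_alg (\<lambda>x. f (a * x + b))"
| add: "smooth_real_alg f \<Longrightarrow> smooth_real_alg g \<Longrightarrow> smooth_real_alg (\<lambda>x. f x + g x)"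
| mult: "smooth_real_alg f \<Longrightarrow> smooth_real_alg g \<Longrightarrow> smooth_real_alg (\<lambda>x. f x * g x)"

lemma smooth_real_alg_deriv:
  "smooth_real_alg f \<Longrightarrow> \<exists>f'. smooth_real_alg f' \<and> (\<forall>x. (f has_real_derivative f' x) (at x))"
proof (induction rule: smooth_real_alg.induct)
  case (base f a b)
  obtain f' where f': "smooth_real f'" "\<And>x. (f has_real_derivative f' x) (at x)"
    using smooth_real_deriv[OF base] by blast
  have "smooth_real_alg (\<lambda>x. f' (a * x + b) * a)"
    by (intro smooth_real_alg.mult smooth_real_alg.base[OF f'(1)]
        smooth_real_alg.base[OF smooth_real_const[of a]])
  moreover have "((\<lambda>x. f (a * x + b)) has_real_derivative f' (a * x + b) * a) (at x)" for x
    by (rule DERIV_chain2[OF f'(2)]) (auto intro!: derivative_eq_intros)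
  ultimately show ?case by blast
next
  case (add f g)
  then obtain f' g' where
    "smooth_real_alg f'" "\<forall>x. (f has_real_derivative f' x) (at x)"
    "smooth_real_alg g'" "\<forall>x. (g has_real_derivative g' x) (at x)" by blast
  then show ?case
    by (intro exI[of _ "\<lambda>x. f' x + g' x"] conjI allI DERIV_add smooth_real_alg.add) auto
next
  case (mult f g)
  then obtain f' g' where
    "smooth_real_alg f'" "\<forall>x. (f has_real_derivative f' x) (at x)"
    "smooth_real_alg g'" "\<forall>x. (g has_real_derivative g' x) (at x)" by blast
  with mult.hyps show ?case
    by (intro exI[of _ "\<lambda>x. f' x * g x + f x * g' x"] conjI allI smooth_real_alg.add
        smooth_real_alg.mult) (auto intro!: derivative_eq_intros)
qed

lemma smooth_real_alg_imp: "smooth_real_alg f \<Longrightarrow> smooth_real f"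
  by (rule smooth_real_coinduct[of _ "Collect smooth_real_alg"]) (auto intro: smooth_real_alg_deriv)

lemma smooth_real_affine: "smooth_real f \<Longrightarrow> smooth_real (\<lambda>x. f (a * x + b))"
  by (rule smooth_real_alg_imp[OF smooth_real_alg.base])

lemma smooth_real_in_alg:
  assumes "smooth_real f" shows "smooth_real_alg f"
proof -
  have "(\<lambda>x. f (1 * x + 0)) = f" by simp
  with smooth_real_alg.base[OF assms, of 1 0] show ?thesis by simp
qed

lemma smooth_real_add: "smooth_real f \<Longrightarrow> smooth_real g \<Longrightarrow> smooth_real (\<lambda>x. f x + g x)"
  by (rule smooth_real_alg_imp[OF smooth_real_alg.add[OF smooth_real_in_alg smooth_real_in_alg]])

lemma smooth_real_mult: "smooth_real f \<Longrightarrow> smooth_real g \<Longrightarrow> smooth_real (\<lambda>x. f x * g x)"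
  by (rule smooth_real_alg_imp[OF smooth_real_alg.mult[OF smooth_real_in_alg smooth_real_in_alg]])

lemma smooth_real_diff:
  assumes "smooth_real f" "smooth_real g"
  shows "smooth_real (\<lambda>x. f x - g x)"
  using smooth_real_add[OF assms(1) smooth_real_mult[OF smooth_real_const[of "-1"] assms(2)]]
  by simp

lemma DERIV_zero_left:
  fixes f :: "real \<Rightarrow> real"
  assumes "\<And>x. x < \<delta> \<Longrightarrow> f x = 0" "x < \<delta>"
  shows "(f has_real_derivative 0) (at x)"
proof (rule has_field_derivative_transform_within_open[of "\<lambda>_. 0" 0 x "{..<\<delta>}"])
qed (use assms in auto)

text \<open>The numerator vanishes left of a positive \<delta>, so the quotient is 0 around 0 and
  has no singularity. Quotients by arbitrary powers \<open>x ^ n\<close> are closed under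
  differentiation, because the new numerator \<open>k' x * x - n * k x\<close> again vanishes left
  of \<delta>.\<close>

lemma smooth_real_divide:
  assumes "smooth_real f" "\<delta> > 0" "\<And>x. x < \<delta> \<Longrightarrow> f x = 0"
  shows "smooth_real (\<lambda>x. f x / x)"
proof -
  define C where "C = {\<lambda>x. h x / x ^ n |h n. smooth_real h \<and> (\<forall>x<\<delta>. h x = 0)}"
  have "\<exists>h'\<in>C. \<forall>x. (h has_real_derivative h' x) (at x)" if hC: "h \<in> C" for h
  proof -
    obtain k n where h: "h = (\<lambda>x. k x / x ^ n)" and k: "smooth_real k" "\<And>x. x < \<delta> \<Longrightarrow> k x = 0"
      using hC unfolding C_def by blast
    obtain k' where k': "smooth_real k'" "\<And>x. (k has_real_derivative k' x) (at x)"
      using smooth_real_deriv[OF k(1)] by blast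
    have k'0: "k' x = 0" if "x < \<delta>" for x
      using DERIV_unique[OF k'(2) DERIV_zero_left[OF k(2) that]] by simp
    define l where "l = (\<lambda>x. k' x * x - real n * k x)"
    have l: "smooth_real l"
      unfolding l_def
      by (intro smooth_real_diff smooth_real_mult k' smooth_real_ident k smooth_real_const)
    have "(h has_real_derivative l x / x ^ Suc n) (at x)" for x
    proof (cases "x < \<delta>")
      case True
      then have "l x = 0" by (simp add: l_def k k'0)
      moreover have "(h has_real_derivative 0) (at x)"
        by (rule DERIV_zero_left[OF _ True]) (simp add: h k)
      ultimately show ?thesis by simp
    next
      case False
      then have x: "x > 0" using assms(2) by linarith
      show ?thesis unfolding h l_def
        apply (rule derivative_eq_intros k' refl)+
        using x apply simp
        using x by (cases n) (auto simp: field_simps)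
    qed
    moreover have "(\<lambda>x. l x / x ^ Suc n) \<in> C"
      unfolding C_def mem_Collect_eq
      by (intro exI[of _ l] exI[of _ "Suc n"]) (use l in \<open>auto simp: l_def k k'0\<close>)
    ultimately show ?thesis by (intro bexI[of _ "\<lambda>x. l x / x ^ Suc n"]) auto
  qed
  moreover have "(\<lambda>x. f x / x) \<in> C"
    unfolding C_def mem_Collect_eq
    by (intro exI[of _ f] exI[of _ 1]) (use assms in auto)
  ultimately show ?thesis by (intro smooth_real_coinduct[of _ C]) auto
qed

subsection \<open>A flat function\<close>

definition flat :: "real \<Rightarrow> real" where
  "flat x = (if x > 0 then exp (- (1 / x)) else 0)"

lemma poly_exp_neg_tendsto_0:
  fixes P :: "real poly"
  shows "((\<lambda>y. poly P y * exp (- y)) \<longlongrightarrow> 0) at_top"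
proof -
  have "((\<lambda>y::real. \<Sum>i\<le>degree P. coeff P i * (y ^ i / exp y)) \<longlongrightarrow> (\<Sum>i\<le>degree P. coeff P i * 0)) at_top"
    by (intro tendsto_sum tendsto_mult tendsto_const tendsto_power_div_exp_0)
  then show ?thesis
    by (simp add: poly_altdef sum_distrib_right exp_minus divide_inverse mult.assoc)
qed

lemma smooth_real_flat: "smooth_real flat"
proof -
  define C where "C = range (\<lambda>P x. if x > 0 then poly P (1/x) * exp (- (1/x)) else 0 :: real)"
  have "\<exists>h'\<in>C. \<forall>x. (h has_real_derivative h' x) (at x)" if hC: "h \<in> C" for h
  proof -
    obtain P where h: "h = (\<lambda>x. if x > 0 then poly P (1/x) * exp (- (1/x)) else 0)"
      using hC unfolding C_def by blast
    \<comment> \<open>The derivative of P(1/x) exp(-1/x) is (1/x^2) (P - P')(1/x) exp(-1/x);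
      \<open>[:0,0,1:]\<close> is the square of the variable.\<close>
    define Q where "Q = [:0,0,1:] * (P - pderiv P)"
    define h' :: "real \<Rightarrow> real" where "h' = (\<lambda>x. if x > 0 then poly Q (1/x) * exp (- (1/x)) else 0)"
    have "(h has_real_derivative h' x) (at x)" for x
    proof -
      consider "x > 0" | "x < 0" | "x = 0" by linarith
      then show ?thesis
      proof cases
        case 1
        have "((\<lambda>x. poly P (1/x) * exp (- (1/x))) has_real_derivative h' x) (at x)"
          using 1 unfolding h'_def Q_def
          by (auto intro!: derivative_eq_intros DERIV_chain2[OF poly_DERIV]
              simp: field_simps power2_eq_square)
        then show ?thesis
          by (rule has_field_derivative_transform_within_open[of _ _ _ "{0<..}"])
            (use 1 in \<open>auto simp: h\<close>)
      next
        case 2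
        have "(h has_real_derivative 0) (at x)"
          by (rule DERIV_zero_left[OF _ 2]) (simp add: h)
        then show ?thesis using 2 by (simp add: h'_def)
      next
        case 3
        \<comment> \<open>In the variable 1/y the difference quotient at 0 is a polynomial times a
          decaying exponential.\<close>
        have "((\<lambda>y. h y / y) \<longlongrightarrow> 0) (at_right 0)"
        proof -
          have "((\<lambda>x. poly ([:0,1:] * P) (inverse x) * exp (- inverse x)) \<longlongrightarrow> 0) (at_right 0)"
            by (rule filterlim_compose[OF poly_exp_neg_tendsto_0 filterlim_inverse_at_top_right])
          then show ?thesis
            by (rule Lim_transform_eventually)
              (auto simp: eventually_at_filter h field_simps intro!: always_eventually)
        qed
        moreover have "((\<lambda>y. h y / y) \<longlongrightarrow> 0) (at_left 0)"
          by (rule Lim_transform_eventually[OF tendsto_const])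
            (auto simp: eventually_at_filter h intro!: always_eventually)
        ultimately have "((\<lambda>y. h y / y) \<longlongrightarrow> 0) (at 0)"
          by (simp add: filterlim_split_at)
        then show ?thesis
          using 3 by (simp add: has_field_derivative_iff h h'_def)
      qed
    qed
    moreover have "h' \<in> C" unfolding C_def h'_def by blast
    ultimately show ?thesis by blast
  qed
  moreover have "flat \<in> C"
    unfolding C_def by (rule image_eqI[of _ _ 1]) (auto simp: flat_def)
  ultimately show ?thesis by (intro smooth_real_coinduct[of _ C]) auto
qed

lemma flat_nonneg: "flat x \<ge> 0" and flat_pos: "x > 0 \<Longrightarrow> flat x > 0"
  and flat_zero: "x \<le> 0 \<Longrightarrow> flat x = 0"
  by (auto simp: flat_def)

subsection \<open>The radial kernel\<close>

text \<open>The argument will be |z - p|^2 / r^2, so the support is the annulus r/2 \<le> |z - p|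
  \<le> r, and the supports for r and r/2 are adjacent. Vanishing near 0 keeps the primitives and
  the division by s in \<open>slope\<close> smooth.\<close>

definition bump :: "real \<Rightarrow> real" where
  "bump s = flat (s - 1/4) * flat (1 - s)"

lemma smooth_real_bump: "smooth_real bump"
  using smooth_real_mult[OF smooth_real_affine[OF smooth_real_flat, of 1 "-1/4"]
      smooth_real_affine[OF smooth_real_flat, of "-1" 1]]
  unfolding bump_def by (simp add: algebra_simps)

lemma bump_nonneg: "bump s \<ge> 0"
  by (simp add: bump_def flat_nonneg)

lemma bump_pos: "1/4 < s \<Longrightarrow> s < 1 \<Longrightarrow> bump s > 0"
  by (simp add: bump_def flat_pos)

lemma bump_left: "s \<le> 1/4 \<Longrightarrow> bump s = 0"
  by (simp add: bump_def flat_zero)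

lemma bump_right: "s \<ge> 1 \<Longrightarrow> bump s = 0"
  by (simp add: bump_def flat_zero)

lemma flat_le_1: "flat x \<le> 1"
  by (simp add: flat_def)

lemma bump_le_1: "bump s \<le> 1"
  unfolding bump_def by (intro mult_le_one flat_nonneg flat_le_1)

text \<open>For negative s the interval \<open>{0..s}\<close> is empty and the integral is 0. It is
  a primitive there only because \<open>f\<close> vanishes as well.\<close>

lemma integral_vanishing_left:
  fixes f :: "real \<Rightarrow> real"
  assumes cont: "continuous_on UNIV f" and "\<delta> > 0" and zero: "\<And>x. x < \<delta> \<Longrightarrow> f x = 0"
  shows "((\<lambda>s. integral {0..s} f) has_real_derivative f s) (at s)"
proof (cases "s < \<delta>")
  case True
  have "integral {0..s} f = 0" if "s < \<delta>" for s
  proof -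
    have "integral {0..s} f = integral {0..s} (\<lambda>_. 0)"
      by (rule integral_cong) (use that zero in auto)
    then show ?thesis by simp
  qed
  from DERIV_zero_left[OF this True] show ?thesis using zero[OF True] by simp
next
  case False
  with \<open>\<delta> > 0\<close> have s: "s > 0" by simp
  have "((\<lambda>s. integral {0..s} f) has_real_derivative f s) (at s within {0..s+1})"
    by (rule integral_has_real_derivative) (use s in \<open>auto intro: continuous_on_subset[OF cont]\<close>)
  moreover have "at s within {0..s+1} = at s"
    by (rule at_within_Icc_at) (use s in auto)
  ultimately show ?thesis by (simp only:)
qed

definition bump_mass :: "real \<Rightarrow> real" where
  "bump_mass s = integral {0..s} bump"

lemma bump_mass_deriv: "(bump_mass has_real_derivative bump s) (at s)"
proof -
  have "((\<lambda>s. integral {0..s} bump) has_real_derivative bump s) (at s)"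
  proof (rule integral_vanishing_left)
    show "continuous_on UNIV bump" by (rule smooth_real_continuous[OF smooth_real_bump])
    show "(0::real) < 1/4" by simp
    show "bump x = 0" if "x < 1/4" for x using that by (simp add: bump_left)
  qed
  then show ?thesis unfolding bump_mass_def[abs_def] .
qed

lemma smooth_real_bump_mass: "smooth_real bump_mass"
  by (rule smooth_real_primitive[OF smooth_real_bump bump_mass_deriv])

lemma bump_mass_mono: "s \<le> t \<Longrightarrow> bump_mass s \<le> bump_mass t"
proof (erule DERIV_nonneg_imp_nondecreasing)
  show "\<exists>y. (bump_mass has_real_derivative y) (at x) \<and> 0 \<le> y" for x
    by (intro exI[of _ "bump x"] conjI bump_mass_deriv bump_nonneg)
qed

lemma bump_mass_left:
  assumes "s \<le> 1/4" shows "bump_mass s = 0"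
proof -
  have "integral {0..s} bump = integral {0..s} (\<lambda>_. 0)"
    by (rule integral_cong) (use assms bump_left in auto)
  then show ?thesis by (simp add: bump_mass_def)
qed

lemma DERIV_zero_right:
  fixes f f' :: "real \<Rightarrow> real"
  assumes f: "\<And>x. (f has_real_derivative f' x) (at x)" and "\<And>x. x \<ge> c \<Longrightarrow> f' x = 0" and "s \<ge> c"
  shows "f s = f c"
proof (cases "s = c")
  case False
  with \<open>s \<ge> c\<close> have "c < s" by simp
  from MVT2[OF this f] obtain z where "c < z" "f s - f c = (s - c) * f' z" by auto
  with assms(2)[of z] show ?thesis by simp
qed simp

lemma bump_mass_right: "s \<ge> 1 \<Longrightarrow> bump_mass s = bump_mass 1"
  by (rule DERIV_zero_right[OF bump_mass_deriv bump_right])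

text \<open>\<open>profile\<close> solves \<open>4 (s profile'(s))' = bump s - 4 bump (4 s)\<close>, so that the Laplacian of
  \<open>profile (\<bar>z\<bar>\<^sup>2)\<close> in the plane is the difference of a radial weight and its rescaling by \<open>1/2\<close>.\<close>

definition slope :: "real \<Rightarrow> real" where
  "slope s = (bump_mass (4 * s) - bump_mass s) / (4 * s)"

definition profile :: "real \<Rightarrow> real" where
  "profile s = integral {0..1} slope - integral {0..s} slope"

lemma slope_left: "s \<le> 1/16 \<Longrightarrow> slope s = 0"
  by (simp add: slope_def bump_mass_left)

lemma slope_right: "s \<ge> 1 \<Longrightarrow> slope s = 0"
  using bump_mass_right[of s] bump_mass_right[of "4 * s"] by (simp add: slope_def)

lemma slope_nonneg: "slope s \<ge> 0"
proof (cases "s \<le> 1/16")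
  case False
  then show ?thesis by (auto simp: slope_def intro!: divide_nonneg_pos bump_mass_mono)
qed (simp add: slope_left)

lemma smooth_real_slope: "smooth_real slope"
proof -
  have "smooth_real (\<lambda>s. (1/4) * (bump_mass (4 * s + 0) - bump_mass s))" (is "smooth_real ?f")
    by (intro smooth_real_diff smooth_real_mult smooth_real_const
        smooth_real_affine smooth_real_bump_mass)
  then have "smooth_real (\<lambda>s. ?f s / s)"
    by (rule smooth_real_divide[of _ "1/16"]) (auto simp: bump_mass_left)
  moreover have "(\<lambda>s. ?f s / s) = slope"
    by (auto simp: slope_def fun_eq_iff)
  ultimately show ?thesis by simp
qed

lemma profile_deriv: "(profile has_real_derivative - slope s) (at s)"
proof -
  have "((\<lambda>s. integral {0..s} slope) has_real_derivative slope s) (at s)"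
  proof (rule integral_vanishing_left)
    show "continuous_on UNIV slope" by (rule smooth_real_continuous[OF smooth_real_slope])
    show "(0::real) < 1/16" by simp
    show "slope x = 0" if "x < 1/16" for x using that by (simp add: slope_left)
  qed
  then have "((\<lambda>s. integral {0..1} slope - integral {0..s} slope) has_real_derivative 0 - slope s) (at s)"
    by (intro DERIV_diff DERIV_const)
  then show ?thesis unfolding profile_def[abs_def] by simp
qed

lemma smooth_real_profile: "smooth_real profile"
proof (rule smooth_real_primitive[OF _ profile_deriv])
  show "smooth_real (\<lambda>s. - slope s)"
    using smooth_real_diff[OF smooth_real_const[of 0] smooth_real_slope] by simp
qed

lemma profile_antimono: "s \<le> t \<Longrightarrow> profile t \<le> profile s"
proof (erule DERIV_nonpos_imp_nonincreasing)
  show "\<exists>y. (profile has_real_derivative y) (at x) \<and> y \<le> 0" for x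
    by (intro exI[of _ "- slope x"] conjI profile_deriv) (simp add: slope_nonneg)
qed

lemma profile_right: "s \<ge> 1 \<Longrightarrow> profile s = 0"
  using DERIV_zero_right[OF profile_deriv, of 1 s] by (simp add: slope_right profile_def)

lemma profile_nonneg: "profile s \<ge> 0"
  using profile_antimono[of s "max s 1"] by (simp add: profile_right)

lemma profile_left:
  assumes "s \<le> 1/16" shows "profile s = profile 0"
proof -
  have "integral {0..s} slope = integral {0..s} (\<lambda>_. 0)"
    by (rule integral_cong) (use assms slope_left in auto)
  then show ?thesis by (simp add: profile_def)
qed

lemma profile_le: "profile s \<le> profile 0"
  using profile_left[of s] profile_antimono[of 0 s] by fastforce

text \<open>For 1/4 < s < 1 the mass up to 4 s is already full while the mass up to s is not, so
  \<open>profile\<close> strictly decreases there. This positive value is what the delta at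
  \<open>w\<close> contributes per dyadic scale.\<close>

lemma profile_0_pos: "profile 0 > 0"
proof -
  have sl: "slope s > 0" if s: "1/4 < s" "s < 1" for s
  proof -
    obtain z where "s < z" "z < 1" "bump_mass 1 - bump_mass s = (1 - s) * bump z"
      using MVT2[OF s(2) bump_mass_deriv] by auto
    moreover from this have "bump z > 0" using s by (intro bump_pos) auto
    ultimately have "bump_mass s < bump_mass 1" using s by (smt (verit) mult_pos_pos)
    with s bump_mass_right[of "4 * s"] show ?thesis by (simp add: slope_def)
  qed
  obtain z where z: "1/4 < z" "z < 1" "profile 1 - profile (1/4) = (1 - 1/4) * (- slope z)"
    using MVT2[OF _ profile_deriv, of "1/4" 1] by auto
  then have "profile 1 < profile (1/4)" using sl[OF z(1,2)] by simp
  then show ?thesis using profile_le[of "1/4"] by (simp add: profile_right)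
qed

text \<open>The identity \<open>4 * s * slope s = bump_mass (4 * s) - bump_mass s\<close> holds for
  every real s, including 0. Differentiating both sides and using uniqueness of derivatives avoids
  differentiating the quotient.\<close>

lemma slope_deriv:
  obtains slope' where "\<And>s. (slope has_real_derivative slope' s) (at s)"
    "\<And>s. - 4 * (slope s + s * slope' s) = bump s - 4 * bump (4 * s)"
proof -
  obtain d where d: "\<And>s. (slope has_real_derivative d s) (at s)"
    using smooth_real_deriv[OF smooth_real_slope] by blast
  have eq: "4 * s * slope s = bump_mass (4 * s) - bump_mass s" for s
    by (simp add: slope_def bump_mass_left)
  have "4 * (slope s + s * d s) = 4 * bump (4 * s) - bump s" for s
  proof (rule DERIV_unique)
    have "((\<lambda>s. 4 * s * slope s) has_real_derivative 4 * (slope s + s * d s)) (at s)"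
      by (rule derivative_eq_intros d refl)+ (simp add: algebra_simps)
    then show "((\<lambda>s. bump_mass (4 * s) - bump_mass s) has_real_derivative 4 * (slope s + s * d s)) (at s)"
      by (simp only: eq)
    show "((\<lambda>s. bump_mass (4 * s) - bump_mass s) has_real_derivative 4 * bump (4 * s) - bump s) (at s)"
      by (rule derivative_eq_intros DERIV_chain2[OF bump_mass_deriv] bump_mass_deriv refl)+ simp
  qed
  with d show ?thesis by (intro that[of d]) (auto simp: algebra_simps)
qed

section \<open>An algebra of smooth functions and integration by parts\<close>

text \<open>All test and comparison functions below are built from these constructors. The class is
  closed under partial derivatives, which yields \<open>smooth_on\<close> by induction on the
  order.\<close>

inductive smooth_alg :: "('a::euclidean_space \<Rightarrow> real) \<Rightarrow> bool" where
  const: "smooth_alg (\<lambda>z. c)"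
| inner: "smooth_alg (\<lambda>z. z \<bullet> b)"
| add: "smooth_alg f \<Longrightarrow> smooth_alg g \<Longrightarrow> smooth_alg (\<lambda>z. f z + g z)"
| mult: "smooth_alg f \<Longrightarrow> smooth_alg g \<Longrightarrow> smooth_alg (\<lambda>z. f z * g z)"
| comp: "smooth_real F \<Longrightarrow> smooth_alg f \<Longrightarrow> smooth_alg (\<lambda>z. F (f z))"

lemma smooth_alg_has_derivative:
  "smooth_alg f \<Longrightarrow> \<exists>f'. (\<forall>z. (f has_derivative f' z) (at z)) \<and> (\<forall>b. smooth_alg (\<lambda>z. f' z b))"
proof (induction rule: smooth_alg.induct)
  case (const c)
  show ?case
    by (intro exI[of _ "\<lambda>z b. 0"] conjI allI has_derivative_const smooth_alg.const)
next
  case (inner b)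
  show ?case
    by (intro exI[of _ "\<lambda>z h. h \<bullet> b"] conjI allI smooth_alg.const has_derivative_inner_left
        has_derivative_ident)
next
  case (add f g)
  then obtain f' g' where
    f': "\<And>z. (f has_derivative f' z) (at z)" "\<And>b. smooth_alg (\<lambda>z. f' z b)" and
    g': "\<And>z. (g has_derivative g' z) (at z)" "\<And>b. smooth_alg (\<lambda>z. g' z b)" by blast
  show ?case
    by (intro exI[of _ "\<lambda>z h. f' z h + g' z h"] conjI allI has_derivative_add f' g'
        smooth_alg.add)
next
  case (mult f g)
  then obtain f' g' where
    f': "\<And>z. (f has_derivative f' z) (at z)" "\<And>b. smooth_alg (\<lambda>z. f' z b)" and
    g': "\<And>z. (g has_derivative g' z) (at z)" "\<And>b. smooth_alg (\<lambda>z. g' z b)" by blast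
  show ?case
    by (intro exI[of _ "\<lambda>z h. f z * g' z h + f' z h * g z"] conjI allI has_derivative_mult f' g'
        smooth_alg.add smooth_alg.mult mult.hyps)
next
  case (comp F f)
  obtain f' where f': "\<And>z. (f has_derivative f' z) (at z)" "\<And>b. smooth_alg (\<lambda>z. f' z b)"
    using comp.IH by blast
  obtain F' where F': "smooth_real F'" "\<And>x. (F has_real_derivative F' x) (at x)"
    using smooth_real_deriv[OF comp.hyps(1)] by blast
  have "((\<lambda>z. F (f z)) has_derivative (\<lambda>h. F' (f z) * f' z h)) (at z)" for z
    using has_derivative_compose[OF f'(1)[of z] F'(2)[of "f z", unfolded has_field_derivative_def]]
    by simp
  moreover have "smooth_alg (\<lambda>z. F' (f z) * f' z b)" for b
    by (rule smooth_alg.mult[OF smooth_alg.comp[OF F'(1) comp.hyps(2)] f'(2)])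
  ultimately show ?case by (intro exI[of _ "\<lambda>z h. F' (f z) * f' z h"]) simp
qed

lemma pdiff_eq: "(f has_derivative f') (at z) \<Longrightarrow> pdiff b f z = f' b"
  unfolding pdiff_def using frechet_derivative_at by metis

lemma smooth_alg_differentiable: "smooth_alg f \<Longrightarrow> f differentiable (at z)"
  using smooth_alg_has_derivative unfolding differentiable_def by blast

lemma smooth_alg_pdiff: assumes "smooth_alg f" shows "smooth_alg (pdiff b f)"
proof -
  obtain f' where f': "\<And>z. (f has_derivative f' z) (at z)" "\<And>b. smooth_alg (\<lambda>z. f' z b)"
    using smooth_alg_has_derivative[OF assms] by blast
  have "pdiff b f = (\<lambda>z. f' z b)"
    using pdiff_eq[OF f'(1)] by (intro ext)
  then show ?thesis using f'(2) by simp
qed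

lemma smooth_alg_continuous: "smooth_alg f \<Longrightarrow> continuous_on S f"
  by (intro continuous_at_imp_continuous_on ballI differentiable_imp_continuous_within
      smooth_alg_differentiable)

lemma smooth_alg_borel: "smooth_alg f \<Longrightarrow> f \<in> borel_measurable borel"
  by (rule borel_measurable_continuous_onI[OF smooth_alg_continuous])

lemma smooth_alg_Ck_on: "smooth_alg f \<Longrightarrow> Ck_on k S f"
proof (induction k arbitrary: f)
  case (Suc k)
  then show ?case
    by (auto intro!: smooth_alg_pdiff differentiable_at_imp_differentiable_on
        smooth_alg_differentiable)
qed (simp add: smooth_alg_continuous)

lemma smooth_alg_smooth_on: "smooth_alg f \<Longrightarrow> smooth_on S f"
  by (simp add: smooth_on_def smooth_alg_Ck_on)

lemma smooth_alg_diff: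
  assumes "smooth_alg f" "smooth_alg g" shows "smooth_alg (\<lambda>z. f z - g z)"
  using smooth_alg.add[OF assms(1) smooth_alg.mult[OF smooth_alg.const[of "-1"] assms(2)]] by simp

lemma smooth_alg_sum:
  "finite I \<Longrightarrow> (\<And>i. i \<in> I \<Longrightarrow> smooth_alg (f i)) \<Longrightarrow> smooth_alg (\<lambda>z. \<Sum>i\<in>I. f i z)"
  by (induction I rule: finite_induct) (auto intro: smooth_alg.const smooth_alg.add)

lemma smooth_alg_norm_diff_squared:
  fixes p :: "'a::euclidean_space"
  shows "smooth_alg (\<lambda>z. (norm (z - p))\<^sup>2)"
proof -
  have "smooth_alg (\<lambda>z. \<Sum>b\<in>Basis. (z \<bullet> b - p \<bullet> b) * (z \<bullet> b - p \<bullet> b))"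
    by (intro smooth_alg_sum finite_Basis smooth_alg.mult smooth_alg_diff smooth_alg.inner
        smooth_alg.const)
  moreover have "(\<lambda>z. (norm (z - p))\<^sup>2) = (\<lambda>z. \<Sum>b\<in>Basis. (z \<bullet> b - p \<bullet> b) * (z \<bullet> b - p \<bullet> b))"
    by (intro ext, unfold power2_norm_eq_inner, subst euclidean_inner) (simp add: inner_diff_left)
  ultimately show ?thesis by simp
qed

lemma pdiff_zero_outside:
  assumes "closed S" "\<And>z. z \<notin> S \<Longrightarrow> f z = 0" "z \<notin> S"
  shows "pdiff b f z = 0"
proof -
  have "(f has_derivative (\<lambda>_. 0)) (at z)"
    by (rule has_derivative_transform_within_open[OF has_derivative_const[of 0], of "- S"])
      (use assms in auto)
  from pdiff_eq[OF this] show ?thesis .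
qed

section \<open>Integrals of compactly supported functions and Green's identity\<close>

lemma integrable_continuous_compact_support:
  fixes f :: "'a::euclidean_space \<Rightarrow> real"
  assumes "continuous_on UNIV f" "\<And>z. z \<notin> cball p r \<Longrightarrow> f z = 0"
  shows "integrable lborel f"
proof -
  have "integrable lborel (\<lambda>z. indicator (cball p r) z *\<^sub>R f z)"
    by (rule borel_integrable_compact) (auto intro: continuous_on_subset[OF assms(1)])
  also have "(\<lambda>z. indicator (cball p r) z *\<^sub>R f z) = f"
    using assms(2) by (auto simp: indicator_def fun_eq_iff)
  finally show ?thesis .
qed

text \<open>Translation invariance of Lebesgue measure makes every difference quotient in direction
  \<open>b\<close> integrate to 0, and dominated convergence passes to the derivative. No iterated
  integrals occur.\<close>

lemma integral_pdiff_eq_0: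
  fixes f :: "'a::euclidean_space \<Rightarrow> real"
  assumes f: "smooth_alg f" and supp: "\<And>z. z \<notin> cball p r \<Longrightarrow> f z = 0" and b: "b \<in> Basis"
  shows "integral\<^sup>L lborel (pdiff b f) = 0"
proof -
  define f' where "f' = pdiff b f"
  have f'_cont: "continuous_on S f'" for S
    unfolding f'_def by (intro smooth_alg_continuous smooth_alg_pdiff f)
  have supp': "z \<notin> cball p r \<Longrightarrow> f' z = 0" for z
    unfolding f'_def by (rule pdiff_zero_outside[OF closed_cball supp])
  have "bounded (f' ` cball p r)"
    by (intro compact_imp_bounded compact_continuous_image f'_cont compact_cball)
  then obtain L where "\<forall>x\<in>f' ` cball p r. norm x \<le> L" unfolding bounded_iff by blast
  then have L: "\<bar>f' z\<bar> \<le> \<bar>L\<bar>" for z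
    using supp'[of z] by (cases "z \<in> cball p r") force+
  have line: "((\<lambda>s. f (z + s *\<^sub>R b)) has_real_derivative f' (z + s *\<^sub>R b)) (at s)" for z s
  proof -
    obtain g where g: "\<And>z. (f has_derivative g z) (at z)"
      using smooth_alg_has_derivative[OF f] by blast
    have "((\<lambda>s. f (z + s *\<^sub>R b)) has_derivative (\<lambda>h. g (z + s *\<^sub>R b) (h *\<^sub>R b))) (at s)"
      by (rule has_derivative_compose[OF _ g]) (auto intro!: derivative_eq_intros)
    moreover have "g (z + s *\<^sub>R b) (h *\<^sub>R b) = f' (z + s *\<^sub>R b) * h" for h
      using pdiff_eq[OF g[of "z + s *\<^sub>R b"], of b]
        linear_scale[OF has_derivative_linear[OF g[of "z + s *\<^sub>R b"]]]
      by (simp add: f'_def)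
    ultimately show ?thesis by (simp add: has_field_derivative_def)
  qed
  define h where "h n = inverse (real (Suc n))" for n
  have h: "0 < h n" "h n \<le> 1" for n
    by (auto simp: h_def field_simps)
  define q where "q n z = (f (z + h n *\<^sub>R b) - f z) / h n" for n z
  have f_int: "integrable lborel f"
    by (rule integrable_continuous_compact_support[OF smooth_alg_continuous[OF f] supp])
  have f_meas: "f \<in> borel_measurable borel" by (rule smooth_alg_borel[OF f])
  have shift: "integral\<^sup>L lborel (\<lambda>z. f (c + z)) = integral\<^sup>L lborel f"
    "integrable lborel (\<lambda>z. f (c + z))" for c
  proof -
    have "integral\<^sup>L (distr lborel borel ((+) c)) f = integral\<^sup>L lborel (\<lambda>z. f (c + z))"
      by (rule integral_distr) (use f_meas in auto)
    then show "integral\<^sup>L lborel (\<lambda>z. f (c + z)) = integral\<^sup>L lborel f"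
      by (simp add: lborel_distr_plus)
    have "integrable (distr lborel borel ((+) c)) f \<longleftrightarrow> integrable lborel (\<lambda>z. f (c + z))"
      by (rule integrable_distr_eq) (use f_meas in auto)
    then show "integrable lborel (\<lambda>z. f (c + z))"
      using f_int by (simp add: lborel_distr_plus)
  qed
  have q0: "integral\<^sup>L lborel (q n) = 0" for n
    using shift[of "h n *\<^sub>R b"] f_int by (simp add: q_def[abs_def] add.commute)
  have "(\<lambda>n. integral\<^sup>L lborel (q n)) \<longlonglongrightarrow> integral\<^sup>L lborel f'"
  \<comment> \<open>The shifts have length at most 1, so all difference quotients live on the disc
    enlarged by 1. The mean value theorem bounds them by the supremum of the derivative.\<close>
  proof (rule integral_dominated_convergence[where w = "\<lambda>z. indicator (cball p (r + 1)) z *\<^sub>R \<bar>L\<bar>"])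
    show "f' \<in> borel_measurable lborel"
      using smooth_alg_borel[OF smooth_alg_pdiff[OF f]] by (simp add: f'_def)
    show "q n \<in> borel_measurable lborel" for n
      unfolding q_def using f_meas by simp
    show "integrable lborel (\<lambda>z. indicator (cball p (r + 1)) z *\<^sub>R \<bar>L\<bar>)"
      by (rule borel_integrable_compact) auto
    have "(\<lambda>n. q n z) \<longlonglongrightarrow> f' z" for z
    proof -
      have "((\<lambda>s. (f (z + s *\<^sub>R b) - f z) / s) \<longlongrightarrow> f' z) (at 0)"
        using line[of z 0] by (simp add: has_field_derivative_iff)
      moreover have "filterlim h (at 0) sequentially"
        unfolding filterlim_at using h(1) LIMSEQ_inverse_real_of_nat
        by (auto simp: h_def[abs_def])
      ultimately show ?thesis unfolding q_def by (rule filterlim_compose)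
    qed
    then show "AE z in lborel. (\<lambda>n. q n z) \<longlonglongrightarrow> f' z" by simp
    have "norm (q n z) \<le> indicator (cball p (r + 1)) z *\<^sub>R \<bar>L\<bar>" for n z
    proof (cases "z \<in> cball p (r + 1)")
      case True
      obtain s where "f (z + h n *\<^sub>R b) - f (z + 0 *\<^sub>R b) = (h n - 0) * f' (z + s *\<^sub>R b)"
        using MVT2[OF h(1)[of n] line[of z]] by blast
      then have "q n z = f' (z + s *\<^sub>R b)" using h(1)[of n] by (simp add: q_def)
      then show ?thesis using True L by simp
    next
      case False
      have "z \<notin> cball p r" using False by auto
      moreover have "z + h n *\<^sub>R b \<notin> cball p r"
      proof -
        have "norm (h n *\<^sub>R b) \<le> 1" using h[of n] b by simp
        moreover have "dist p z \<le> dist p (z + h n *\<^sub>R b) + norm (h n *\<^sub>R b)"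
          using dist_triangle[of p z "z + h n *\<^sub>R b"] by (simp add: dist_norm)
        ultimately show ?thesis using False by auto
      qed
      ultimately show ?thesis using supp False by (simp add: q_def)
    qed
    then show "AE z in lborel. norm (q n z) \<le> indicator (cball p (r + 1)) z *\<^sub>R \<bar>L\<bar>" for n by simp
  qed
  then show ?thesis
    unfolding q0 f'_def by (simp add: LIMSEQ_const_iff)
qed

lemma pdiff_mult:
  assumes "smooth_alg f" "smooth_alg g"
  shows "pdiff b (\<lambda>z. f z * g z) z = f z * pdiff b g z + pdiff b f z * g z"
proof -
  obtain f' g' where "(f has_derivative f') (at z)" "(g has_derivative g') (at z)"
    using smooth_alg_has_derivative[OF assms(1)] smooth_alg_has_derivative[OF assms(2)] by blast
  from pdiff_eq[OF this(1)] pdiff_eq[OF this(2)] pdiff_eq[OF has_derivative_mult[OF this]]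
  show ?thesis by simp
qed

lemma pdiff_diff:
  assumes "smooth_alg f" "smooth_alg g"
  shows "pdiff b (\<lambda>z. f z - g z) z = pdiff b f z - pdiff b g z"
proof -
  obtain f' g' where "(f has_derivative f') (at z)" "(g has_derivative g') (at z)"
    using smooth_alg_has_derivative[OF assms(1)] smooth_alg_has_derivative[OF assms(2)] by blast
  from pdiff_eq[OF this(1)] pdiff_eq[OF this(2)] pdiff_eq[OF has_derivative_diff[OF this]]
  show ?thesis by simp
qed

lemma smooth_alg_laplacian: "smooth_alg f \<Longrightarrow> smooth_alg (laplacian f)"
  unfolding laplacian_def[abs_def]
  by (intro smooth_alg_sum finite_Basis smooth_alg_pdiff)

lemma laplacian_zero_outside:
  assumes "closed S" "\<And>z. z \<notin> S \<Longrightarrow> f z = 0" "z \<notin> S"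
  shows "laplacian f z = 0"
proof -
  have "pdiff b (pdiff b f) z = 0" for b
    by (rule pdiff_zero_outside[OF assms(1) pdiff_zero_outside[OF assms(1,2)] assms(3)])
  then show ?thesis by (simp add: laplacian_def)
qed

text \<open>The vector field with components \<open>X b\<close> has divergence f \<Delta>\<phi> -
  \<phi> \<Delta>f, the products of first derivatives cancelling, and it inherits compact support
  from \<phi>.\<close>

lemma laplacian_symmetric:
  fixes f \<phi> :: "'a::euclidean_space \<Rightarrow> real"
  assumes f: "smooth_alg f" and \<phi>: "smooth_alg \<phi>" and supp: "\<And>z. z \<notin> cball p r \<Longrightarrow> \<phi> z = 0"
  shows "(LINT z|lborel. f z * laplacian \<phi> z) = (LINT z|lborel. laplacian f z * \<phi> z)"
proof -
  note intros = smooth_alg_diff smooth_alg.mult smooth_alg_pdiff smooth_alg_laplacian f \<phi>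
  have supp': "z \<notin> cball p r \<Longrightarrow> pdiff b \<phi> z = 0" for z b
    by (rule pdiff_zero_outside[OF closed_cball supp])
  have suppL: "z \<notin> cball p r \<Longrightarrow> laplacian \<phi> z = 0" for z
    by (rule laplacian_zero_outside[OF closed_cball supp])
  define X where "X b z = f z * pdiff b \<phi> z - pdiff b f z * \<phi> z" for b z
  have X: "smooth_alg (X b)" for b unfolding X_def by (intro intros)
  have suppX: "z \<notin> cball p r \<Longrightarrow> X b z = 0" for z b
    using supp supp' by (simp add: X_def)
  have int: "integrable lborel (pdiff b (X b))" for b
    by (rule integrable_continuous_compact_support[OF _ pdiff_zero_outside[OF closed_cball suppX]])
      (intro smooth_alg_continuous smooth_alg_pdiff X)
  have "pdiff b (X b) z = f z * pdiff b (pdiff b \<phi>) z - pdiff b (pdiff b f) z * \<phi> z" for b z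
    unfolding X_def
    by (subst pdiff_diff, intro intros, intro intros, subst pdiff_mult, intro intros, intro intros,
        subst pdiff_mult, intro intros, intro intros) simp
  then have eq: "(\<Sum>b\<in>Basis. pdiff b (X b) z) = f z * laplacian \<phi> z - laplacian f z * \<phi> z" for z
    by (simp add: laplacian_def sum_subtractf sum_distrib_left sum_distrib_right)
  have "(LINT z|lborel. f z * laplacian \<phi> z - laplacian f z * \<phi> z)
      = (\<Sum>b\<in>Basis. integral\<^sup>L lborel (pdiff b (X b)))"
    unfolding eq[symmetric] by (rule Bochner_Integration.integral_sum[OF int])
  also have "\<dots> = 0"
    by (intro sum.neutral ballI integral_pdiff_eq_0[OF X suppX])
  finally have 0: "(LINT z|lborel. f z * laplacian \<phi> z - laplacian f z * \<phi> z) = 0" .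
  have i1: "integrable lborel (\<lambda>z. f z * laplacian \<phi> z)"
    by (rule integrable_continuous_compact_support[of _ p r])
      (auto intro!: smooth_alg_continuous intros simp del: mem_cball simp: suppL)
  have i2: "integrable lborel (\<lambda>z. laplacian f z * \<phi> z)"
    by (rule integrable_continuous_compact_support[of _ p r])
      (auto intro!: smooth_alg_continuous intros simp del: mem_cball simp: supp)
  show ?thesis using 0 i1 i2 by simp
qed

section \<open>The radial test functions\<close>

definition radial_test :: "complex \<Rightarrow> real \<Rightarrow> complex \<Rightarrow> real" where
  "radial_test p r z = profile ((norm (z - p))\<^sup>2 / r\<^sup>2)"

text \<open>The factor 1 / r^2 makes the total mass in the plane independent of
  \<open>r\<close>.\<close>

definition weight :: "complex \<Rightarrow> real \<Rightarrow> complex \<Rightarrow> real" where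
  "weight p r z = bump ((norm (z - p))\<^sup>2 / r\<^sup>2) / r\<^sup>2"

lemma smooth_alg_radial:
  assumes "smooth_real F" shows "smooth_alg (\<lambda>z. F ((norm (z - p))\<^sup>2 / c))"
proof -
  have "smooth_alg (\<lambda>z. F (inverse c * (norm (z - p))\<^sup>2))"
    by (intro smooth_alg.comp[OF assms] smooth_alg.mult smooth_alg.const smooth_alg_norm_diff_squared)
  then show ?thesis by (simp add: divide_inverse mult.commute)
qed

lemma smooth_alg_radial_test: "smooth_alg (radial_test p r)"
  unfolding radial_test_def[abs_def] by (rule smooth_alg_radial[OF smooth_real_profile])

lemma smooth_alg_weight: "smooth_alg (weight p r)"
proof -
  have "smooth_alg (\<lambda>z. inverse (r\<^sup>2) * bump ((norm (z - p))\<^sup>2 / r\<^sup>2))"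
    by (intro smooth_alg.mult smooth_alg.const smooth_alg_radial smooth_real_bump)
  then show ?thesis unfolding weight_def[abs_def] by (simp add: divide_inverse mult.commute)
qed

lemma radial_ge_1: "r > 0 \<Longrightarrow> z \<notin> ball p r \<Longrightarrow> (norm (z - p))\<^sup>2 / r\<^sup>2 \<ge> 1"
  by (simp add: dist_norm norm_minus_commute)

lemma radial_test_outside: "r > 0 \<Longrightarrow> z \<notin> ball p r \<Longrightarrow> radial_test p r z = 0"
  unfolding radial_test_def by (rule profile_right[OF radial_ge_1])

lemma weight_outside: "r > 0 \<Longrightarrow> z \<notin> ball p r \<Longrightarrow> weight p r z = 0"
  unfolding weight_def by (simp add: bump_right[OF radial_ge_1])

lemma radial_test_nonneg: "radial_test p r z \<ge> 0"
  and radial_test_le: "radial_test p r z \<le> profile 0"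
  by (simp_all add: radial_test_def profile_nonneg profile_le)

lemma radial_test_inside:
  assumes "r > 0" "dist p z \<le> r / 4" shows "radial_test p r z = profile 0"
proof -
  have "(norm (z - p))\<^sup>2 \<le> (r / 4)\<^sup>2"
    using assms by (intro power_mono) (auto simp: dist_norm norm_minus_commute)
  then have "(norm (z - p))\<^sup>2 / r\<^sup>2 \<le> 1/16"
    using assms(1) by (simp add: field_simps)
  then show ?thesis unfolding radial_test_def by (rule profile_left)
qed

lemma weight_nonneg: "weight p r z \<ge> 0"
  by (simp add: weight_def bump_nonneg)

lemma weight_le: "weight p r z \<le> 1 / r\<^sup>2"
  unfolding weight_def by (intro divide_right_mono bump_le_1) simp

lemma test_function_radial_test:
  assumes "r > 0" "cball p r \<subseteq> D"
  shows "test_function D (radial_test p r)"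
proof -
  have "{z. radial_test p r z \<noteq> 0} \<subseteq> cball p r"
    using radial_test_outside[OF assms(1)] ball_subset_cball by blast
  then have sub: "closure {z. radial_test p r z \<noteq> 0} \<subseteq> cball p r"
    by (rule closure_minimal) simp
  then have "compact (closure {z. radial_test p r z \<noteq> 0})"
    using compact_closure bounded_subset[OF bounded_cball] closure_subset by (metis order.trans)
  with sub assms(2) show ?thesis
    unfolding test_function_def
    by (auto intro: smooth_alg_smooth_on smooth_alg_radial_test)
qed

lemma laplacian_radial:
  assumes F: "\<And>s. (F has_real_derivative F' s) (at s)" "\<And>s. (F' has_real_derivative F'' s) (at s)"
    and c: "c \<noteq> 0"
  shows "laplacian (\<lambda>z::complex. F ((norm (z - p))\<^sup>2 / c)) z
    = 4 / c * (F' ((norm (z - p))\<^sup>2 / c) + (norm (z - p))\<^sup>2 / c * F'' ((norm (z - p))\<^sup>2 / c))"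
proof -
  define t where "t z = (norm (z - p))\<^sup>2 / c" for z
  have t_eq: "t z = ((z - p) \<bullet> (z - p)) / c" for z
    by (simp add: t_def power2_norm_eq_inner)
  have t': "(t has_derivative (\<lambda>h. 2 * ((z - p) \<bullet> h) / c)) (at z)" for z
  proof -
    have "((\<lambda>z. (z - p) \<bullet> (z - p)) has_derivative (\<lambda>h. 2 * ((z - p) \<bullet> h))) (at z)"
      by (auto intro!: derivative_eq_intros simp: inner_commute)
    from has_derivative_mult_right[OF this, of "inverse c"] show ?thesis
      by (simp add: t_eq[abs_def] divide_inverse mult.commute)
  qed
  have comp: "((\<lambda>z. H (t z)) has_derivative (\<lambda>h. H' * (2 * ((z - p) \<bullet> h) / c))) (at z)"
    if "(H has_real_derivative H') (at (t z))" for H H' z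
    using has_derivative_compose[OF t' that[unfolded has_field_derivative_def]] by simp
  have 1: "pdiff b (\<lambda>z. F (t z)) = (\<lambda>z. F' (t z) * (2 / c * ((z - p) \<bullet> b)))" for b
    using pdiff_eq[OF comp[OF F(1)], of b] by (intro ext) simp
  have 2: "pdiff b (pdiff b (\<lambda>z. F (t z))) z
      = 2 / c * F' (t z) + 4 * F'' (t z) / c\<^sup>2 * ((z - p) \<bullet> b)\<^sup>2" if "b \<in> Basis" for b
  proof -
    have "((\<lambda>z. 2 / c * ((z - p) \<bullet> b)) has_derivative (\<lambda>h. 2 / c * (h \<bullet> b))) (at z)"
      by (rule has_derivative_mult_right) (auto intro!: derivative_eq_intros)
    from pdiff_eq[OF has_derivative_mult[OF comp[OF F(2)] this], of b] show ?thesis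
      unfolding 1 using that c by (simp add: field_simps power2_eq_square)
  qed
  have "laplacian (\<lambda>z. F (t z)) z
      = (\<Sum>b\<in>(Basis :: complex set). 2 / c * F' (t z)) + (\<Sum>b\<in>Basis. 4 * F'' (t z) / c\<^sup>2 * ((z - p) \<bullet> b)\<^sup>2)"
    unfolding laplacian_def by (simp add: 2 sum.distrib)
  also have "(\<Sum>b\<in>Basis. 4 * F'' (t z) / c\<^sup>2 * ((z - p) \<bullet> b)\<^sup>2)
      = 4 * F'' (t z) / c\<^sup>2 * (norm (z - p))\<^sup>2"
    unfolding power2_norm_eq_inner unfolding euclidean_inner[of "z - p" "z - p"]
    by (simp only: sum_distrib_left power2_eq_square)
  also have "\<dots> = 4 * F'' (t z) * t z / c"
    using c by (simp add: t_def field_simps power2_eq_square)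
  finally have "laplacian (\<lambda>z. F (t z)) z = 4 / c * (F' (t z) + t z * F'' (t z))"
    by (simp add: add_divide_distrib algebra_simps)
  then show ?thesis by (simp add: t_def)
qed

text \<open>Halving \<open>r\<close> multiplies both the radial variable and the prefactor by 4, so
  the term \<open>4 * bump (4 * s)\<close> in the equation for \<open>slope\<close> is the kernel at
  radius r / 2. Testing with \<open>radial_test\<close> therefore gives the difference of two
  consecutive averages.\<close>

lemma laplacian_radial_test:
  assumes r: "r > 0"
  shows "laplacian (radial_test p r) z = weight p r z - weight p (r / 2) z"
proof -
  obtain slope' where slope': "\<And>s. (slope has_real_derivative slope' s) (at s)"
    and eq: "\<And>s. - 4 * (slope s + s * slope' s) = bump s - 4 * bump (4 * s)"
    using slope_deriv by blast
  define t where "t = (norm (z - p))\<^sup>2 / r\<^sup>2"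
  have "laplacian (radial_test p r) z = 4 / r\<^sup>2 * (- slope t + t * - slope' t)"
    unfolding radial_test_def[abs_def] t_def
    by (rule laplacian_radial[OF profile_deriv]) (use r in \<open>auto intro: DERIV_minus slope'\<close>)
  also have "\<dots> = (- 4 * (slope t + t * slope' t)) / r\<^sup>2"
    by (simp add: diff_divide_distrib algebra_simps)
  also have "\<dots> = weight p r z - weight p (r / 2) z"
    unfolding eq using r
    by (simp add: weight_def t_def diff_divide_distrib power_divide mult.commute)
  finally show ?thesis .
qed

section \<open>Radial averages\<close>

lemma integrable_mult_bounded:
  fixes f h :: "'a \<Rightarrow> real"
  assumes f: "integrable M f" and h: "h \<in> borel_measurable M" "\<And>x. \<bar>h x\<bar> \<le> C"
  shows "integrable M (\<lambda>x. f x * h x)"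
proof (rule Bochner_Integration.integrable_bound)
  show "integrable M (\<lambda>x. f x * C)" using f by simp
  show "(\<lambda>x. f x * h x) \<in> borel_measurable M" using f h(1) by measurable
  have "norm (f x * h x) \<le> norm (f x * C)" for x
    using h(2)[of x] by (auto simp: abs_mult intro!: mult_left_mono)
  then show "AE x in M. norm (f x * h x) \<le> norm (f x * C)" by simp
qed

lemma radial_test_borel [measurable]: "radial_test p r \<in> borel_measurable borel"
  by (rule smooth_alg_borel[OF smooth_alg_radial_test])

lemma weight_borel [measurable]: "weight p r \<in> borel_measurable borel"
  by (rule smooth_alg_borel[OF smooth_alg_weight])

lemma integrable_radial_test:
  assumes "r > 0" shows "integrable lborel (radial_test p r)"
  by (rule integrable_continuous_compact_support[of _ p r])
    (use radial_test_outside[OF assms] in \<open>auto intro!: smooth_alg_continuous smooth_alg_radial_test\<close>)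

lemma integrable_weight:
  assumes "r > 0" shows "integrable lborel (weight p r)"
  by (rule integrable_continuous_compact_support[of _ p r])
    (use weight_outside[OF assms] in \<open>auto intro!: smooth_alg_continuous smooth_alg_weight\<close>)

lemma measure_ball_complex: "r \<ge> 0 \<Longrightarrow> measure lborel (ball (p::complex) r) = pi * r\<^sup>2"
  using content_ball[of r p] unit_ball_vol_numeral(1)[of Num.One] by simp

definition kernel_mass :: real where "kernel_mass = integral\<^sup>L lborel (weight 0 1)"

lemma integral_weight:
  assumes "r > 0" shows "integral\<^sup>L lborel (weight p r) = kernel_mass"
proof -
  have "integral\<^sup>L lborel (weight p r)
      = integral\<^sup>L (density (distr lborel borel (\<lambda>x. p + r *\<^sub>R x)) (\<lambda>_. ennreal (\<bar>r\<bar> ^ DIM(complex)))) (weight p r)"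
    using lborel_affine[of r p] assms by simp
  also have "\<dots> = (LINT z|distr lborel borel (\<lambda>x. p + r *\<^sub>R x). \<bar>r\<bar> ^ DIM(complex) *\<^sub>R weight p r z)"
    by (rule integral_density) auto
  also have "\<dots> = (LINT z|lborel. \<bar>r\<bar> ^ DIM(complex) *\<^sub>R weight p r (p + r *\<^sub>R z))"
    by (rule integral_distr) auto
  also have "(\<lambda>z. \<bar>r\<bar> ^ DIM(complex) *\<^sub>R weight p r (p + r *\<^sub>R z)) = weight 0 1"
    using assms by (intro ext) (simp add: weight_def power_mult_distrib norm_mult)
  finally show ?thesis unfolding kernel_mass_def .
qed

lemma integral_ge_ball:
  fixes f :: "complex \<Rightarrow> real"
  assumes "integrable lborel f" "\<And>z. f z \<ge> 0" "\<And>z. z \<in> ball p r \<Longrightarrow> f z \<ge> c" "r > 0" "c \<ge> 0"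
  shows "integral\<^sup>L lborel f \<ge> c * (pi * r\<^sup>2)"
proof -
  have i: "integrable lborel (\<lambda>z. c * indicator (ball p r) z)"
    using emeasure_bounded_finite[OF bounded_ball, of p r]
    by (intro integrable_mult_right integrable_real_indicator) auto
  have "c * (pi * r\<^sup>2) = (LINT z|lborel. c * indicator (ball p r) z)"
    using measure_ball_complex[of r p] assms(4) by simp
  also have "\<dots> \<le> integral\<^sup>L lborel f"
    by (rule integral_mono[OF i assms(1)]) (use assms in \<open>auto simp: indicator_def\<close>)
  finally show ?thesis .
qed

lemma kernel_mass_pos: "kernel_mass > 0"
proof -
  have flat_mono: "flat x \<le> flat y" if "0 < x" "x \<le> y" for x y
    using that by (auto simp: flat_def frac_le)
  \<comment> \<open>On the disc about 3/4 of radius 1/16 the value |z|^2 lies between 3/8 and 7/8,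
    at distance at least 1/8 from both ends of the support of \<open>bump\<close>.\<close>
  define c where "c = flat (1/8) * flat (1/8)"
  have c: "c > 0" by (simp add: c_def flat_pos)
  have "c \<le> weight 0 1 z" if z: "z \<in> ball (3/4) (1/16)" for z
  proof -
    have d: "norm (3/4 - z) < 1/16" using z by (simp add: dist_norm)
    have "norm z \<le> 3/4 + 1/16" "norm z \<ge> 3/4 - 1/16"
      using d norm_triangle_ineq2[of z "3/4"] norm_triangle_ineq2[of "3/4" z] 
      by (simp_all add: norm_minus_commute)
    then have "(norm z)\<^sup>2 \<le> (13/16)\<^sup>2" "(norm z)\<^sup>2 \<ge> (11/16)\<^sup>2" by (intro power_mono; simp)+
    then have "3/8 \<le> (norm z)\<^sup>2" "(norm z)\<^sup>2 \<le> 7/8" by (simp_all add: power2_eq_square)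
    then show ?thesis unfolding weight_def bump_def c_def
      by (auto intro!: mult_mono flat_mono flat_nonneg)
  qed
  then have "kernel_mass \<ge> c * (pi * (1/16)\<^sup>2)"
    unfolding kernel_mass_def
    by (intro integral_ge_ball[of _ "3/4"] integrable_weight weight_nonneg) (use c in auto)
  moreover have "c * (pi * (1/16)\<^sup>2) > 0" using c by simp
  ultimately show ?thesis by linarith
qed

text \<open>This mean is not normalised: on a constant it returns the constant times
  \<open>kernel_mass\<close>.\<close>

definition avg :: "(complex \<Rightarrow> real) \<Rightarrow> complex \<Rightarrow> real \<Rightarrow> real" where
  "avg H p r = (LINT z|lborel. H z * weight p r z)"

lemma avg_close:
  assumes r: "r > 0" and H: "H \<in> borel_measurable borel"
    and close: "\<And>z. z \<in> ball p r \<Longrightarrow> \<bar>H z - c\<bar> \<le> e"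
  shows "\<bar>avg H p r - c * kernel_mass\<bar> \<le> e * kernel_mass"
proof -
  have bd: "\<bar>(H z - c) * weight p r z\<bar> \<le> e * weight p r z" for z
    using close[of z] weight_outside[OF r, of z p] weight_nonneg[of p r z]
    by (cases "z \<in> ball p r") (auto simp: abs_mult intro: mult_right_mono)
  have int: "integrable lborel (\<lambda>z. (H z - c) * weight p r z)"
  proof (rule Bochner_Integration.integrable_bound)
    show "integrable lborel (\<lambda>z. e * weight p r z)" using integrable_weight[OF r] by simp
    show "(\<lambda>z. (H z - c) * weight p r z) \<in> borel_measurable lborel" using H by simp
    show "AE z in lborel. norm ((H z - c) * weight p r z) \<le> norm (e * weight p r z)"
      using bd by (intro AE_I2) (metis abs_ge_self order_trans real_norm_def)
  qed
  have "avg H p r = (LINT z|lborel. (H z - c) * weight p r z + c * weight p r z)"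
    unfolding avg_def by (simp add: algebra_simps)
  also have "\<dots> = (LINT z|lborel. (H z - c) * weight p r z) + c * kernel_mass"
    using int integrable_weight[OF r] integral_weight[OF r] by simp
  finally have "\<bar>avg H p r - c * kernel_mass\<bar> = \<bar>LINT z|lborel. (H z - c) * weight p r z\<bar>" by simp
  also have "\<dots> \<le> (LINT z|lborel. e * weight p r z)"
    using int integrable_weight[OF r] bd by (intro integral_abs_bound_integral) auto
  also have "\<dots> = e * kernel_mass" using integral_weight[OF r] by simp
  finally show ?thesis .
qed

lemma avg_tendsto:
  assumes r: "r > 0" and H: "H \<in> borel_measurable borel" and cont: "isCont H p"
  shows "(\<lambda>n. avg H p (r / 2 ^ n)) \<longlonglongrightarrow> H p * kernel_mass"
proof (rule LIMSEQ_I)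
  fix e :: real assume "e > 0"
  define e' where "e' = e / (2 * kernel_mass)"
  have e': "e' > 0" using \<open>e > 0\<close> kernel_mass_pos by (simp add: e'_def)
  obtain d where d: "d > 0" "\<And>z. dist z p < d \<Longrightarrow> dist (H z) (H p) < e'"
    using cont e' unfolding continuous_at_eps_delta by blast
  have "(\<lambda>n. r / 2 ^ n) \<longlonglongrightarrow> 0"
    using LIMSEQ_divide_realpow_zero[of 2 r] by simp
  then obtain N where N: "\<And>n. n \<ge> N \<Longrightarrow> norm (r / 2 ^ n - 0) < d"
    using LIMSEQ_D d(1) by blast
  have "norm (avg H p (r / 2 ^ n) - H p * kernel_mass) < e" if n: "n \<ge> N" for n
  proof -
    have "\<bar>H z - H p\<bar> \<le> e'" if "z \<in> ball p (r / 2 ^ n)" for z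
      using d(2)[of z] N[OF n] that r by (simp add: dist_real_def dist_commute)
    then have "\<bar>avg H p (r / 2 ^ n) - H p * kernel_mass\<bar> \<le> e' * kernel_mass"
      by (intro avg_close H) (use r in auto)
    also have "\<dots> < e" using \<open>e > 0\<close> kernel_mass_pos by (simp add: e'_def)
    finally show ?thesis by simp
  qed
  then show "\<exists>N. \<forall>n\<ge>N. norm (avg H p (r / 2 ^ n) - H p * kernel_mass) < e" by blast
qed

lemma integrable_smooth_mult_weight:
  assumes "smooth_alg F" "r > 0" shows "integrable lborel (\<lambda>z. F z * weight p r z)"
  by (rule integrable_continuous_compact_support[of _ p r])
    (use weight_outside[OF assms(2)] assms in
      \<open>auto intro!: smooth_alg_continuous smooth_alg.mult smooth_alg_weight\<close>)

lemma integrable_smooth_mult_test: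
  assumes "smooth_alg F" "r > 0" shows "integrable lborel (\<lambda>z. F z * radial_test p r z)"
  by (rule integrable_continuous_compact_support[of _ p r])
    (use radial_test_outside[OF assms(2)] assms in
      \<open>auto intro!: smooth_alg_continuous smooth_alg.mult smooth_alg_radial_test\<close>)

text \<open>This is the smooth counterpart of the tested equation for \<open>g\<close>, by Green's
  identity; subtracting the two gives the change of the average of F - g from one scale to the
  next.\<close>

lemma avg_smooth_step:
  assumes F: "smooth_alg F" and r: "r > 0"
  shows "avg F p r - avg F p (r / 2) = (LINT z|lborel. laplacian F z * radial_test p r z)"
proof -
  have "(LINT z|lborel. laplacian F z * radial_test p r z)
      = (LINT z|lborel. F z * laplacian (radial_test p r) z)"
    by (rule laplacian_symmetric[symmetric, of _ _ p r])
      (use F radial_test_outside[OF r] in \<open>auto intro: smooth_alg_radial_test\<close>)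
  also have "\<dots> = (LINT z|lborel. F z * weight p r z - F z * weight p (r / 2) z)"
    unfolding laplacian_radial_test[OF r] by (simp add: right_diff_distrib)
  also have "\<dots> = avg F p r - avg F p (r / 2)"
    unfolding avg_def
    by (rule Bochner_Integration.integral_diff) (use r F in \<open>auto intro: integrable_smooth_mult_weight\<close>)
  finally show ?thesis by simp
qed

section \<open>The Green function\<close>

locale green =
  fixes D :: "complex set" and u :: "complex \<Rightarrow> real" and w :: complex and g :: "complex \<Rightarrow> real"
    and M :: real
  assumes dom: "bounded_domain D" and w: "w \<in> D"
    and u_cont: "continuous_on D u" and u_nonneg: "\<And>z. z \<in> D \<Longrightarrow> 0 \<le> u z"
    and u_le: "\<And>z. z \<in> D \<Longrightarrow> u z \<le> M"
    and gf: "green_function D u w g"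
begin

lemma open_D: "open D" and connected_D: "connected D" and bounded_D: "bounded D"
  using dom by (auto simp: bounded_domain_def)

lemma M_nonneg: "M \<ge> 0"
  using u_nonneg[OF w] u_le[OF w] by linarith

text \<open>Extension by 0 lets all integrals run over the whole plane, although nothing is known
  about \<open>g\<close> and \<open>u\<close> far outside \<open>D\<close>.\<close>

definition G :: "complex \<Rightarrow> real" where "G z = indicator D z * g z"

definition U :: "complex \<Rightarrow> real" where "U z = indicator D z * u z"

lemma G_eq: "z \<in> D \<Longrightarrow> G z = g z" and U_eq: "z \<in> D \<Longrightarrow> U z = u z"
  by (simp_all add: G_def U_def)

lemma G_integrable: "integrable lborel G"
  using gf by (simp add: green_function_def set_integrable_def G_def[abs_def])

lemma G_borel [measurable]: "G \<in> borel_measurable borel"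
  using borel_measurable_integrable[OF G_integrable] by simp

lemma U_borel [measurable]: "U \<in> borel_measurable borel"
  using borel_measurable_continuous_on_indicator[OF _ u_cont] open_D by (simp add: U_def[abs_def])

lemma U_nonneg: "0 \<le> U z" and U_le: "U z \<le> M"
  using u_nonneg u_le M_nonneg by (auto simp: U_def indicator_def)

lemma g_cont: "continuous_on (closure D - {w}) g"
  using gf by (simp add: green_function_def)

lemma g_frontier: "z \<in> frontier D \<Longrightarrow> g z = 0"
  using gf by (simp add: green_function_def)

lemma G_isCont:
  assumes "p \<in> D" "p \<noteq> w" shows "isCont G p"
proof -
  have "continuous_on (D - {w}) G"
    by (rule continuous_on_eq[OF continuous_on_subset[OF g_cont]])
      (use closure_subset in \<open>auto simp: G_eq\<close>)
  moreover have "open (D - {w})" using open_D by auto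
  ultimately show ?thesis using assms by (simp add: continuous_on_eq_continuous_at)
qed

section \<open>The equation tested at dyadic scales\<close>

definition pot :: "complex \<Rightarrow> real \<Rightarrow> real" where
  "pot p r = (LINT z|lborel. G z * (U z * radial_test p r z))"

lemma integrable_pot: "integrable lborel (\<lambda>z. G z * (U z * radial_test p r z))"
proof (rule integrable_mult_bounded[OF G_integrable])
  show "\<bar>U z * radial_test p r z\<bar> \<le> M * profile 0" for z
    using U_nonneg[of z] U_le[of z] radial_test_nonneg[of p r z] radial_test_le[of p r z] M_nonneg
    by (simp add: abs_mult mult_mono)
qed simp

lemma integrable_avg: "integrable lborel (\<lambda>z. G z * weight p r z)"
  by (rule integrable_mult_bounded[OF G_integrable, of _ "1 / r\<^sup>2"])
    (use weight_le[of p r] weight_nonneg[of p r] in auto)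

text \<open>This is the distributional equation tested with \<open>radial_test\<close>:
  \<open>pot\<close> is the share of the potential and the last term that of the delta at
  \<open>w\<close>.\<close>

lemma avg_step:
  assumes r: "r > 0" and sub: "cball p r \<subseteq> D"
  shows "avg G p r - avg G p (r / 2) = pot p r + radial_test p r w"
proof -
  let ?\<phi> = "radial_test p r"
  have "(LINT z:D|lborel. g z * (laplacian ?\<phi> z - u z * ?\<phi> z)) = ?\<phi> w"
    using gf test_function_radial_test[OF r sub] unfolding green_function_def by blast
  also have "(LINT z:D|lborel. g z * (laplacian ?\<phi> z - u z * ?\<phi> z))
      = (LINT z|lborel. G z * weight p r z - G z * weight p (r / 2) z - G z * (U z * ?\<phi> z))"
    unfolding set_lebesgue_integral_def laplacian_radial_test[OF r]
    by (rule Bochner_Integration.integral_cong) (auto simp: G_def U_def indicator_def algebra_simps)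
  also have "\<dots> = avg G p r - avg G p (r / 2) - pot p r"
    unfolding avg_def pot_def using integrable_avg integrable_pot by simp
  finally show ?thesis by simp
qed

lemma avg_telescope:
  assumes r: "r > 0" and sub: "cball p r \<subseteq> D"
  shows "avg G p r - avg G p (r / 2 ^ n)
    = (\<Sum>j<n. pot p (r / 2 ^ j) + radial_test p (r / 2 ^ j) w)"
proof (induction n)
  case (Suc n)
  have "r / 2 ^ n \<le> r" using r by (simp add: field_simps)
  then have "cball p (r / 2 ^ n) \<subseteq> D" using sub subset_cball[of "r / 2 ^ n" r p] by blast
  then have "avg G p (r / 2 ^ n) - avg G p (r / 2 ^ n / 2)
      = pot p (r / 2 ^ n) + radial_test p (r / 2 ^ n) w"
    by (intro avg_step) (use r in simp)
  then show ?case using Suc by (simp add: mult.commute)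
qed simp

text \<open>A function \<open>F - g\<close> with \<open>\<Delta>F < u g = \<Delta>g\<close> is strictly superharmonic in the weak sense, so it
  has no interior local minimum.\<close>

lemma no_local_min:
  assumes F: "smooth_alg F" and r: "r > 0" and sub: "cball p r \<subseteq> D - {w}" and m: "m > 0"
    and min: "\<And>z. z \<in> cball p r \<Longrightarrow> F p - g p \<le> F z - g z"
    and lap: "\<And>z. z \<in> cball p r \<Longrightarrow> laplacian F z + m \<le> u z * g z"
  shows False
proof -
  \<comment> \<open>The averages of F - g increase as the disc shrinks, strictly in the first step,
    towards the value at \<open>p\<close> times \<open>kernel_mass\<close>. Minimality at
    \<open>p\<close> puts the first average at or above this limit, a contradiction.\<close>
  define a where "a n = avg (\<lambda>z. F z - G z) p (r / 2 ^ n)" for n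
  have "p \<in> cball p r" using r by simp
  then have pD: "p \<in> D" "p \<noteq> w" using sub by blast+
  have rn: "r / 2 ^ n > 0" "r / 2 ^ n \<le> r" for n using r by (auto simp: field_simps)
  have subn: "cball p (r / 2 ^ n) \<subseteq> cball p r" for n
    using subset_cball[OF rn(2)] .
  have avg_diff: "avg (\<lambda>z. F z - G z) p s = avg F p s - avg G p s" if "s > 0" for s
    unfolding avg_def
    using integrable_avg integrable_smooth_mult_weight[OF F that] by (simp add: left_diff_distrib)
  have step: "a n - a (Suc n)
      = (LINT z|lborel. laplacian F z * radial_test p (r / 2 ^ n) z
            - G z * (U z * radial_test p (r / 2 ^ n) z))" for n
  proof -
    have "radial_test p (r / 2 ^ n) w = 0"
      by (rule radial_test_outside[OF rn(1)]) (use sub subn[of n] ball_subset_cball in blast)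
    then have "avg G p (r / 2 ^ n) - avg G p (r / 2 ^ n / 2) = pot p (r / 2 ^ n)"
      using avg_step[OF rn(1)[of n], of p] sub subn[of n] by auto
    moreover have "r / 2 ^ Suc n = r / 2 ^ n / 2" by simp
    ultimately have "a n - a (Suc n)
        = (LINT z|lborel. laplacian F z * radial_test p (r / 2 ^ n) z) - pot p (r / 2 ^ n)"
      using avg_smooth_step[OF F rn(1)[of n], of p] avg_diff[OF rn(1)[of n]]
        avg_diff[OF rn(1)[of "Suc n"]] unfolding a_def by (simp add: mult.commute)
    also have "\<dots> = (LINT z|lborel. laplacian F z * radial_test p (r / 2 ^ n) z
            - G z * (U z * radial_test p (r / 2 ^ n) z))"
      unfolding pot_def
      by (rule Bochner_Integration.integral_diff[symmetric])
        (intro integrable_smooth_mult_test smooth_alg_laplacian F rn integrable_pot)+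
    finally show ?thesis .
  qed
  have le: "laplacian F z * radial_test p (r / 2 ^ n) z - G z * (U z * radial_test p (r / 2 ^ n) z)
      \<le> - m * radial_test p (r / 2 ^ n) z" for z n
  proof (cases "z \<in> ball p (r / 2 ^ n)")
    case True
    then have z: "z \<in> cball p r" using subn[of n] ball_subset_cball by blast
    then have "(laplacian F z + m) * radial_test p (r / 2 ^ n) z
        \<le> (u z * g z) * radial_test p (r / 2 ^ n) z"
      by (intro mult_right_mono lap radial_test_nonneg)
    then show ?thesis using z sub by (auto simp: G_eq U_eq algebra_simps)
  next
    case False
    then show ?thesis using radial_test_outside[OF rn(1)] by simp
  qed
  have dec: "a n - a (Suc n) \<le> - m * integral\<^sup>L lborel (radial_test p (r / 2 ^ n))" for n
  proof -
    have "a n - a (Suc n) \<le> (LINT z|lborel. - m * radial_test p (r / 2 ^ n) z)"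
      unfolding step
      by (rule integral_mono[OF _ _ le])
        (intro Bochner_Integration.integrable_diff integrable_smooth_mult_test smooth_alg_laplacian
          F rn integrable_pot integrable_mult_right integrable_radial_test)+
    then show ?thesis by simp
  qed
  have test_nonneg: "integral\<^sup>L lborel (radial_test p s) \<ge> 0" for s
    by (rule Bochner_Integration.integral_nonneg) (rule radial_test_nonneg)
  have "a n \<le> a (Suc n)" for n
    using dec[of n] mult_nonneg_nonneg[OF _ test_nonneg[of "r / 2 ^ n"], of m] m by simp
  then have mono: "incseq a" by (rule incseq_SucI)
  have lim: "a \<longlonglongrightarrow> (F p - g p) * kernel_mass"
  proof -
    have "isCont F p"
      using smooth_alg_continuous[OF F, of UNIV] by (simp add: continuous_on_eq_continuous_at)
    then have "isCont (\<lambda>z. F z - G z) p" by (intro continuous_intros G_isCont pD)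
    from avg_tendsto[OF r _ this] show ?thesis
      unfolding a_def using smooth_alg_borel[OF F] pD by (simp add: G_eq)
  qed
  have "a 1 \<le> (F p - g p) * kernel_mass"
    by (rule incseq_le[OF mono lim])
  moreover have "a 0 < a 1"
  proof -
    have "integral\<^sup>L lborel (radial_test p r) \<ge> profile 0 * (pi * (r / 4)\<^sup>2)"
      by (rule integral_ge_ball[of _ p])
        (use r profile_0_pos radial_test_inside[OF r] in
          \<open>auto intro!: integrable_radial_test radial_test_nonneg\<close>)
    moreover have "profile 0 * (pi * (r / 4)\<^sup>2) > 0" using r profile_0_pos by simp
    ultimately have "integral\<^sup>L lborel (radial_test p r) > 0" by linarith
    then have "m * integral\<^sup>L lborel (radial_test p r) > 0" using m by simp
    then show ?thesis using dec[of 0] by simp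
  qed
  moreover have "(F p - g p) * kernel_mass \<le> a 0"
  proof -
    have "(F p - g p) * kernel_mass = (LINT z|lborel. (F p - g p) * weight p r z)"
      using integral_weight[OF r] by simp
    also have "\<dots> \<le> (LINT z|lborel. (F z - G z) * weight p r z)"
    proof (rule integral_mono)
      show "integrable lborel (\<lambda>z. (F p - g p) * weight p r z)"
        using integrable_weight[OF r] by simp
      show "integrable lborel (\<lambda>z. (F z - G z) * weight p r z)"
        using integrable_avg integrable_smooth_mult_weight[OF F r] by (simp add: left_diff_distrib)
      show "(F p - g p) * weight p r z \<le> (F z - G z) * weight p r z" for z
      proof (cases "z \<in> ball p r")
        case True
        then have "z \<in> cball p r" by simp
        then show ?thesis using min[of z] sub weight_nonneg[of p r z]
          by (intro mult_right_mono) (auto simp: G_eq)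
      qed (simp add: weight_outside[OF r])
    qed
    also have "\<dots> = a 0" by (simp add: a_def avg_def)
    finally show ?thesis .
  qed
  ultimately show False by linarith
qed

end

context green begin

subsection \<open>Behaviour at the pole\<close>

definition N :: real where "N = (LINT z|lborel. \<bar>G z\<bar>)"

lemma N_nonneg: "N \<ge> 0" unfolding N_def by (rule Bochner_Integration.integral_nonneg) simp

lemma avg_le:
  assumes "r > 0" shows "\<bar>avg G p r\<bar> \<le> N / r\<^sup>2"
proof -
  have "\<bar>avg G p r\<bar> \<le> (LINT z|lborel. \<bar>G z\<bar> * (1 / r\<^sup>2))"
    unfolding avg_def
  proof (rule integral_abs_bound_integral)
    show "integrable lborel (\<lambda>z. \<bar>G z\<bar> * (1 / r\<^sup>2))"
      using G_integrable by (intro integrable_mult_left integrable_abs)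
    show "\<bar>G z * weight p r z\<bar> \<le> \<bar>G z\<bar> * (1 / r\<^sup>2)" for z
      using weight_le[of p r z] weight_nonneg[of p r z]
      by (simp only: abs_mult) (intro mult_left_mono, auto)
  qed (rule integrable_avg)
  then show ?thesis by (simp add: N_def)
qed

lemma pot_le:
  assumes r: "r > 0" and S: "S \<ge> 0" and bd: "\<And>z. z \<in> ball p r \<Longrightarrow> \<bar>G z\<bar> \<le> S"
  shows "\<bar>pot p r\<bar> \<le> M * profile 0 * pi * r\<^sup>2 * S"
proof -
  define K where "K = S * (M * profile 0)"
  have K: "K \<ge> 0" using S M_nonneg profile_0_pos by (simp add: K_def)
  have "\<bar>pot p r\<bar> \<le> (LINT z|lborel. K * indicator (ball p r) z)"
    unfolding pot_def
  proof (rule integral_abs_bound_integral[OF integrable_pot])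
    show "integrable lborel (\<lambda>z. K * indicator (ball p r) z)"
      using emeasure_bounded_finite[OF bounded_ball, of p r]
      by (intro integrable_mult_right integrable_real_indicator) auto
    show "\<bar>G z * (U z * radial_test p r z)\<bar> \<le> K * indicator (ball p r) z" for z
    proof (cases "z \<in> ball p r")
      case True
      have "U z * radial_test p r z \<le> M * profile 0"
        using U_nonneg[of z] U_le[of z] radial_test_nonneg[of p r z] radial_test_le[of p r z] M_nonneg
        by (intro mult_mono) auto
      then have "\<bar>G z\<bar> * (U z * radial_test p r z) \<le> S * (M * profile 0)"
        by (rule mult_mono[OF bd[OF True] _ S]) (simp add: U_nonneg radial_test_nonneg)
      then show ?thesis
        using True U_nonneg[of z] radial_test_nonneg[of p r z] by (simp add: abs_mult K_def)
    next
      case False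
      then show ?thesis by (simp add: radial_test_outside[OF r])
    qed
  qed
  also have "\<dots> = K * (pi * r\<^sup>2)" using measure_ball_complex[of r p] r by simp
  finally show ?thesis by (simp add: K_def mult_ac)
qed

text \<open>The factor 2 bounds the geometric series of ratio 1/4 over the dyadic scales.\<close>

definition C1 :: real where "C1 = 2 * (M * profile 0 * pi)"

lemma C1_nonneg: "C1 \<ge> 0"
  using M_nonneg profile_0_pos by (simp add: C1_def)

text \<open>With |g| \<le> S on the disc, the potential term at scale r / 2^j is of order r^2 S /
  4^j, so the telescoping sum is controlled by its first term. Off the pole the delta does not
  contribute.\<close>

lemma mean_value_estimate:
  assumes r: "r > 0" and sub: "cball p r \<subseteq> D - {w}" and bd: "\<And>z. z \<in> cball p r \<Longrightarrow> \<bar>g z\<bar> \<le> S"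
  shows "\<bar>avg G p r - g p * kernel_mass\<bar> \<le> C1 * r\<^sup>2 * S"
proof -
  have p: "p \<in> cball p r" using r by simp
  then have pD: "p \<in> D" "p \<noteq> w" using sub by blast+
  have S: "S \<ge> 0" using bd[OF p] by linarith
  define A where "A = M * profile 0 * pi * S"
  have A: "A \<ge> 0" using M_nonneg profile_0_pos S by (simp add: A_def)
  have rn: "r / 2 ^ n > 0" "r / 2 ^ n \<le> r" for n using r by (auto simp: field_simps)
  have subn: "cball p (r / 2 ^ n) \<subseteq> cball p r" for n
    using subset_cball[OF rn(2)] .
  have term_le: "\<bar>pot p (r / 2 ^ j) + radial_test p (r / 2 ^ j) w\<bar> \<le> A * r\<^sup>2 * (1/4) ^ j" for j
  proof -
    have "radial_test p (r / 2 ^ j) w = 0"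
      by (rule radial_test_outside[OF rn(1)]) (use sub subn[of j] ball_subset_cball in blast)
    moreover have "\<bar>pot p (r / 2 ^ j)\<bar> \<le> M * profile 0 * pi * (r / 2 ^ j)\<^sup>2 * S"
    proof (rule pot_le[OF rn(1) S])
      fix z assume "z \<in> ball p (r / 2 ^ j)"
      then have "z \<in> cball p r" using subn[of j] ball_subset_cball by blast
      then show "\<bar>G z\<bar> \<le> S" using bd sub by (auto simp: G_eq)
    qed
    moreover have "(r / 2 ^ j)\<^sup>2 = r\<^sup>2 * (1/4) ^ j"
    proof -
      have "(4::real) ^ j = (2 ^ j)\<^sup>2" by (simp add: power2_eq_square flip: power_mult_distrib)
      then show ?thesis by (simp add: power_divide)
    qed
    ultimately show ?thesis by (simp add: A_def mult_ac)
  qed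
  have est: "\<bar>avg G p r - avg G p (r / 2 ^ n)\<bar> \<le> C1 * r\<^sup>2 * S" for n
  proof -
    have "avg G p r - avg G p (r / 2 ^ n) = (\<Sum>j<n. pot p (r / 2 ^ j) + radial_test p (r / 2 ^ j) w)"
      by (rule avg_telescope[OF r]) (use sub in blast)
    also have "\<bar>\<dots>\<bar> \<le> (\<Sum>j<n. A * r\<^sup>2 * (1/4) ^ j)"
      by (rule order_trans[OF sum_abs]) (intro sum_mono term_le)
    also have "\<dots> = A * r\<^sup>2 * (\<Sum>j<n. (1/4) ^ j)" by (simp add: sum_distrib_left)
    also have "\<dots> \<le> A * r\<^sup>2 * 2"
    proof (rule mult_left_mono)
      have "(\<Sum>j<n. (1/4::real) ^ j) = (1 - (1/4) ^ n) / (1 - 1/4)"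
        by (subst sum_gp_strict) simp
      also have "\<dots> \<le> 1 / (1 - 1/4)" by (intro divide_right_mono) auto
      also have "\<dots> \<le> 2" by simp
      finally show "(\<Sum>j<n. (1/4::real) ^ j) \<le> 2" .
    qed (use A in simp)
    finally show ?thesis by (simp add: A_def C1_def mult_ac)
  qed
  have "(\<lambda>n. \<bar>avg G p r - avg G p (r / 2 ^ n)\<bar>) \<longlonglongrightarrow> \<bar>avg G p r - G p * kernel_mass\<bar>"
    by (intro tendsto_intros avg_tendsto[OF r G_borel G_isCont[OF pD]])
  then show ?thesis
    using est pD by (intro LIMSEQ_le_const2[of _ _ "C1 * r\<^sup>2 * S"]) (auto simp: G_eq)
qed

text \<open>Maximising \<open>\<bar>g z\<bar>\<close> times the squared distance to the boundary of the disc makes \<open>g\<close>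
  comparable, near the maximum point, with its value there, so that the error term of the mean value
  estimate can be absorbed.\<close>

lemma growth_bound:
  obtains r0 C2 where "r0 > 0" "C2 \<ge> 0"
    "\<And>p r. 0 < r \<Longrightarrow> r \<le> r0 \<Longrightarrow> cball p r \<subseteq> D - {w} \<Longrightarrow> \<bar>g p\<bar> * r\<^sup>2 \<le> C2"
proof
  \<comment> \<open>Chosen so that \<open>C1 * r0\<^sup>2\<close> is at most half of
    \<open>kernel_mass\<close>; the error term then takes at most half of the main term.\<close>
  define r0 where "r0 = sqrt (kernel_mass / (2 * (C1 + 1)))"
  \<comment> \<open>After absorption |g q| \<open>kernel_mass\<close> / 2 is at most the bound N /
    (d / 2)^2 for an average at radius d / 2.\<close>
  define C2 where "C2 = 8 * N / kernel_mass"
  show "r0 > 0" using kernel_mass_pos C1_nonneg by (simp add: r0_def)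
  show "C2 \<ge> 0" using kernel_mass_pos N_nonneg by (simp add: C2_def)
  have r0: "C1 * r0\<^sup>2 \<le> kernel_mass / 2"
  proof -
    have "r0\<^sup>2 = kernel_mass / (2 * (C1 + 1))"
      unfolding r0_def using kernel_mass_pos C1_nonneg by (intro real_sqrt_pow2) simp
    then have "C1 * r0\<^sup>2 = (C1 / (C1 + 1)) * (kernel_mass / 2)" by simp
    also have "\<dots> \<le> 1 * (kernel_mass / 2)"
      using kernel_mass_pos C1_nonneg by (intro mult_right_mono) auto
    finally show ?thesis by simp
  qed
  fix p r assume r: "0 < r" "r \<le> r0" and sub: "cball p r \<subseteq> D - {w}"
  define f where "f z = \<bar>g z\<bar> * (r - dist p z)\<^sup>2" for z
  have "D \<subseteq> closure D" by (rule closure_subset)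
  then have gc: "continuous_on (cball p r) g"
    using continuous_on_subset[OF g_cont] sub by blast
  have "continuous_on (cball p r) f"
    unfolding f_def by (intro continuous_intros gc)
  then obtain q where q: "q \<in> cball p r" "\<And>z. z \<in> cball p r \<Longrightarrow> f z \<le> f q"
    using continuous_attains_sup[OF compact_cball] r(1) by (metis centre_in_cball empty_iff less_imp_le)
  define d where "d = r - dist p q"
  have d: "0 \<le> d" "d \<le> r" using q(1) by (auto simp: d_def)
  have "f q \<le> C2"
  proof (cases "d = 0")
    case True
    then show ?thesis using \<open>C2 \<ge> 0\<close> by (simp add: f_def d_def[symmetric])
  next
    case False
    with d have d0: "d > 0" by simp
    have near: "z \<in> cball p r" "d / 2 \<le> r - dist p z" if "z \<in> cball q (d / 2)" for z
      using that dist_triangle[of p z q] d0 by (auto simp: d_def)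
    \<comment> \<open>On the half-size disc about the maximum point the squared distance factor is
      at least (d / 2)^2, a quarter of its value at \<open>q\<close>.\<close>
    have bd: "\<bar>g z\<bar> \<le> 4 * \<bar>g q\<bar>" if z: "z \<in> cball q (d / 2)" for z
    proof -
      have "\<bar>g z\<bar> * (d / 2)\<^sup>2 \<le> \<bar>g z\<bar> * (r - dist p z)\<^sup>2"
        using near[OF z] d0 by (intro mult_left_mono power_mono) auto
      also have "\<dots> \<le> \<bar>g q\<bar> * d\<^sup>2"
        using q(2)[OF near(1)[OF z]] by (simp add: f_def d_def)
      finally show ?thesis using d0 by (simp add: field_simps power2_eq_square)
    qed
    have "cball q (d / 2) \<subseteq> D - {w}" using near(1) sub by blast
    from mean_value_estimate[OF _ this bd] d0
    have "\<bar>avg G q (d / 2) - g q * kernel_mass\<bar> \<le> C1 * (d / 2)\<^sup>2 * (4 * \<bar>g q\<bar>)" by simp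
    also have "\<dots> = (C1 * d\<^sup>2) * \<bar>g q\<bar>" by (simp add: power2_eq_square)
    also have "\<dots> \<le> (kernel_mass / 2) * \<bar>g q\<bar>"
    proof (rule mult_right_mono)
      have "C1 * d\<^sup>2 \<le> C1 * r0\<^sup>2"
        using d r C1_nonneg by (intro mult_left_mono power_mono) auto
      then show "C1 * d\<^sup>2 \<le> kernel_mass / 2" using r0 by simp
    qed simp
    finally have 1: "\<bar>avg G q (d / 2) - g q * kernel_mass\<bar> \<le> (kernel_mass / 2) * \<bar>g q\<bar>" .
    have "\<bar>g q\<bar> * kernel_mass = \<bar>g q * kernel_mass\<bar>" using kernel_mass_pos by (simp add: abs_mult)
    also have "\<dots> \<le> \<bar>avg G q (d / 2)\<bar> + (kernel_mass / 2) * \<bar>g q\<bar>" using 1 by linarith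
    finally have "\<bar>g q\<bar> * (kernel_mass / 2) \<le> \<bar>avg G q (d / 2)\<bar>" by (simp add: field_simps)
    also have "\<dots> \<le> N / (d / 2)\<^sup>2" using d0 by (intro avg_le) simp
    finally have "\<bar>g q\<bar> * d\<^sup>2 \<le> C2"
      using d0 kernel_mass_pos by (simp add: C2_def field_simps power2_eq_square)
    then show ?thesis by (simp add: f_def d_def)
  qed
  then show "\<bar>g p\<bar> * r\<^sup>2 \<le> C2" using q(2)[of p] r by (simp add: f_def)
qed

lemma integral_near_pole:
  "(\<lambda>j. LINT z|lborel. \<bar>G z\<bar> * indicator (ball w (R / 2 ^ j)) z) \<longlonglongrightarrow> 0"
proof -
  define q where "q j z = \<bar>G z\<bar> * indicator (ball w (R / 2 ^ j)) z" for j z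
  have "(\<lambda>j. integral\<^sup>L lborel (q j)) \<longlonglongrightarrow> integral\<^sup>L lborel (\<lambda>z::complex. 0::real)"
  proof (rule integral_dominated_convergence[where w = "\<lambda>z. \<bar>G z\<bar>"])
    show "integrable lborel (\<lambda>z. \<bar>G z\<bar>)" using G_integrable by simp
    show "AE z in lborel. (\<lambda>j. q j z) \<longlonglongrightarrow> 0"
      using AE_lborel_singleton[of w]
    proof eventually_elim
      case (elim z)
      have "(\<lambda>j. R / 2 ^ j) \<longlonglongrightarrow> 0" using LIMSEQ_divide_realpow_zero[of 2 R] by simp
      moreover have "dist w z > 0" using elim by simp
      ultimately have "\<forall>\<^sub>F j in sequentially. R / 2 ^ j < dist w z" by (rule order_tendstoD)
      then have "\<forall>\<^sub>F j in sequentially. q j z = 0"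
        by eventually_elim (simp add: q_def)
      then show ?case by (rule tendsto_eventually)
    qed
    show "AE z in lborel. norm (q j z) \<le> \<bar>G z\<bar>" for j
      by (intro AE_I2) (simp add: q_def indicator_def)
    show "q j \<in> borel_measurable lborel" for j 
      unfolding q_def using G_borel
      by (intro borel_measurable_times borel_measurable_abs borel_measurable_indicator) auto
  qed simp
  then show ?thesis by (simp add: q_def[abs_def])
qed

text \<open>No bound for |g| holds on a disc containing \<open>w\<close>, so the integral of |g|
  replaces the supremum. By absolute continuity this integral tends to 0 as the disc shrinks to the
  pole.\<close>

lemma pot_near_pole:
  assumes r: "r > 0" and sub: "ball p r \<subseteq> B" and B: "B \<in> sets borel"
  shows "\<bar>pot p r\<bar> \<le> M * profile 0 * (LINT z|lborel. \<bar>G z\<bar> * indicator B z)"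
proof -
  have i: "integrable lborel (\<lambda>z. \<bar>G z\<bar> * indicator B z)"
    using B G_integrable by (intro integrable_mult_bounded[of _ _ _ 1]) (auto simp: indicator_def)
  have "\<bar>pot p r\<bar> \<le> (LINT z|lborel. M * profile 0 * (\<bar>G z\<bar> * indicator B z))"
    unfolding pot_def
  proof (rule integral_abs_bound_integral[OF integrable_pot])
    show "integrable lborel (\<lambda>z. M * profile 0 * (\<bar>G z\<bar> * indicator B z))" using i by simp
    show "\<bar>G z * (U z * radial_test p r z)\<bar> \<le> M * profile 0 * (\<bar>G z\<bar> * indicator B z)" for z
    proof (cases "z \<in> ball p r")
      case True
      have "U z * radial_test p r z \<le> M * profile 0"
        using U_nonneg[of z] U_le[of z] radial_test_nonneg[of p r z] radial_test_le[of p r z] M_nonneg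
        by (intro mult_mono) auto
      then have "\<bar>G z\<bar> * (U z * radial_test p r z) \<le> \<bar>G z\<bar> * (M * profile 0)"
        by (intro mult_left_mono) auto
      then show ?thesis
        using True sub U_nonneg[of z] radial_test_nonneg[of p r z]
        by (auto simp: abs_mult mult_ac)
    next
      case False
      then show ?thesis
        using M_nonneg profile_0_pos by (simp add: radial_test_outside[OF r])
    qed
  qed
  then show ?thesis using i by simp
qed

text \<open>Passing from scale \<open>R / 2 ^ j\<close> to \<open>R / 2 ^ (j + 1)\<close> lowers the average around \<open>p\<close> by at least
  \<open>profile 0 / 2\<close> as long as the scale is small but large compared to \<open>\<bar>p - w\<bar>\<close>, because the
  contribution of \<open>\<delta>\<^sub>w\<close> beats that of the potential. Hence \<open>g\<close> tends to \<open>-\<infinity>\<close> at \<open>w\<close>.\<close>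

lemma negative_near_pole:
  obtains R n0 where "R > 0" "\<And>n p. n \<ge> n0 \<Longrightarrow> dist p w = R / 2 ^ n \<Longrightarrow> p \<in> D \<and> g p < 0"
proof -
  obtain r0 C2 where r0: "r0 > 0" "C2 \<ge> 0"
    and growth: "\<And>p r. 0 < r \<Longrightarrow> r \<le> r0 \<Longrightarrow> cball p r \<subseteq> D - {w} \<Longrightarrow> \<bar>g p\<bar> * r\<^sup>2 \<le> C2"
    using growth_bound by blast
  obtain e where e: "e > 0" "cball w e \<subseteq> D"
    using open_D w open_contains_cball by blast
  \<comment> \<open>If |p - w| \<le> R, all discs of radius at most \<open>R\<close> about
    \<open>p\<close> stay in the disc of radius \<open>e\<close> inside \<open>D\<close>; the bound
    by \<open>r0\<close> makes the growth estimate applicable.\<close>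
  define R where "R = min (e / 2) r0"
  have R: "R > 0" "R \<le> r0" "2 * R \<le> e" using e r0 by (auto simp: R_def)
  define I where "I j = (LINT z|lborel. \<bar>G z\<bar> * indicator (ball w (2 * R / 2 ^ j)) z)" for j
  have "(\<lambda>j. M * profile 0 * I j) \<longlonglongrightarrow> M * profile 0 * 0"
    unfolding I_def by (intro tendsto_intros integral_near_pole)
  moreover have "profile 0 / 2 > 0" using profile_0_pos by simp
  ultimately have "\<forall>\<^sub>F j in sequentially. M * profile 0 * I j < profile 0 / 2"
    by (intro order_tendstoD(2)[of _ "M * profile 0 * 0"]) auto
  then obtain j0 where j0: "\<And>j. j \<ge> j0 \<Longrightarrow> M * profile 0 * I j < profile 0 / 2"
    unfolding eventually_sequentially by blast
  \<comment> \<open>\<open>K\<close> collects the losses: the average at the largest scale, the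
    first \<open>j0\<close> scales where the potential is not yet small, the error between the last
    average and the value of \<open>g\<close>, and the two scales comparable to |p - w|.\<close>
  define K where "K = N / R\<^sup>2 + j0 * (M * profile 0 * N) + 4 * C1 * C2 + 2 * profile 0"
  obtain n0 :: nat where n0: "n0 > max 2 (2 * K / profile 0)"
    using reals_Archimedean2 by blast
  have "p \<in> D \<and> g p < 0" if n: "n \<ge> n0" and pw: "dist p w = R / 2 ^ n" for n p
  proof -
    define r where "r = R / 2 ^ n"
    have r: "0 < r" "r \<le> R" using R by (auto simp: r_def field_simps)
    have scale: "r \<le> R / 2 ^ j" if "j \<le> n" for j
      unfolding r_def using that R by (intro divide_left_mono power_increasing) auto
    have Rj: "R / 2 ^ j > 0" "R / 2 ^ j \<le> R" for j using R by (auto simp: field_simps)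
    have subD: "cball p (R / 2 ^ j) \<subseteq> D" for j
    proof -
      have "cball p (R / 2 ^ j) \<subseteq> cball w e"
      proof
        fix z assume "z \<in> cball p (R / 2 ^ j)"
        then have "dist w z \<le> r + R / 2 ^ j"
          using dist_triangle[of w z p] pw by (simp add: dist_commute r_def)
        also have "\<dots> \<le> e" using r Rj(2)[of j] R by linarith
        finally show "z \<in> cball w e" by simp
      qed
      then show ?thesis using e by blast
    qed
    then have pD: "p \<in> D" using Rj(1)[of 0] by (meson centre_in_cball less_imp_le subsetD)
    have pw0: "p \<noteq> w" using pw r by (auto simp: r_def[symmetric])
    have pot_all: "\<bar>pot p (R / 2 ^ j)\<bar> \<le> M * profile 0 * N" for j
      using pot_near_pole[OF Rj(1)[of j], of p UNIV] by (simp add: N_def)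
    have pot_small: "\<bar>pot p (R / 2 ^ j)\<bar> \<le> profile 0 / 2" if "j \<ge> j0" "j \<le> n" for j
    proof -
      have "ball p (R / 2 ^ j) \<subseteq> ball w (2 * R / 2 ^ j)"
      proof
        fix z assume "z \<in> ball p (R / 2 ^ j)"
        then have "dist w z < r + R / 2 ^ j"
          using dist_triangle[of w z p] pw by (simp add: dist_commute r_def)
        also have "\<dots> \<le> 2 * R / 2 ^ j" using scale[OF that(2)] by simp
        finally show "z \<in> ball w (2 * R / 2 ^ j)" by simp
      qed
      from pot_near_pole[OF Rj(1) this] have "\<bar>pot p (R / 2 ^ j)\<bar> \<le> M * profile 0 * I j"
        by (simp add: I_def)
      also have "\<dots> \<le> profile 0 / 2" using j0[OF that(1)] by simp
      finally show ?thesis .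
    qed
    \<comment> \<open>Here \<open>w\<close> lies in the inner quarter of the disc, where the test
      function has its full value. Only the scales with index \<open>n - 1\<close> and
      \<open>n\<close> are lost.\<close>
    have test: "radial_test p (R / 2 ^ j) w = profile 0" if "j + 2 \<le> n" for j
    proof (rule radial_test_inside[OF Rj(1)])
      have "R / 2 ^ n \<le> R / 2 ^ (j + 2)"
        using that R by (intro divide_left_mono power_increasing) auto
      then show "dist p w \<le> R / 2 ^ j / 4" using pw by simp
    qed
    define t where "t j = pot p (R / 2 ^ j) + radial_test p (R / 2 ^ j) w" for j
    have t1: "t j \<ge> profile 0 / 2 - (if j < j0 then M * profile 0 * N else 0) -
        (if n \<le> j + 1 then profile 0 else 0)" if "j \<le> n" for j
    proof -
      have "pot p (R / 2 ^ j) \<ge> - (profile 0 / 2) - (if j < j0 then M * profile 0 * N else 0)"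
        using pot_all[of j] pot_small[OF _ that] profile_0_pos by (cases "j < j0") auto
      moreover have "radial_test p (R / 2 ^ j) w \<ge> profile 0 - (if n \<le> j + 1 then profile 0 else 0)"
        using test[of j] radial_test_nonneg[of p "R / 2 ^ j" w] by (cases "n \<le> j + 1") auto
      ultimately show ?thesis unfolding t_def by linarith
    qed
    have sum_if: "(\<Sum>j\<in>A. if P j then c else 0) = card (A \<inter> Collect P) * c"
      if "finite A" for A :: "nat set" and P and c :: real
      using that by (simp add: sum.If_cases)
    have "n \<ge> 2" using n n0 by linarith
    have "(\<Sum>j<Suc n. if j < j0 then M * profile 0 * N else 0) \<le> j0 * (M * profile 0 * N)"
    proof -
      have "(\<Sum>j<Suc n. if j < j0 then M * profile 0 * N else 0)
          = card ({..<Suc n} \<inter> {j. j < j0}) * (M * profile 0 * N)"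
        by (rule sum_if) simp
      also have "\<dots> \<le> j0 * (M * profile 0 * N)"
      proof (rule mult_right_mono)
        have "card ({..<Suc n} \<inter> {j. j < j0}) \<le> card {..<j0}" by (rule card_mono) auto
        then show "real (card ({..<Suc n} \<inter> {j. j < j0})) \<le> real j0" by simp
        show "0 \<le> M * profile 0 * N" using M_nonneg N_nonneg profile_0_pos by simp
      qed
      finally show ?thesis .
    qed
    moreover have "(\<Sum>j<Suc n. if n \<le> j + 1 then profile 0 else 0) = 2 * profile 0"
    proof -
      have "{..<Suc n} \<inter> {j. n \<le> j + 1} = {n - 1, n}" using \<open>n \<ge> 2\<close> by auto
      moreover have "card {n - 1, n} = 2" using \<open>n \<ge> 2\<close> by simp
      ultimately show ?thesis using sum_if[of "{..<Suc n}" "\<lambda>j. n \<le> j + 1"] by simp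
    qed
    moreover have "(\<Sum>j<Suc n. t j) \<ge> (\<Sum>j<Suc n. profile 0 / 2 -
        (if j < j0 then M * profile 0 * N else 0) - (if n \<le> j + 1 then profile 0 else 0))"
      by (intro sum_mono t1) simp
    moreover have "(\<Sum>j<Suc n. profile 0 / 2 -
        (if j < j0 then M * profile 0 * N else 0) - (if n \<le> j + 1 then profile 0 else 0))
      = Suc n * (profile 0 / 2) - (\<Sum>j<Suc n. if j < j0 then M * profile 0 * N else 0)
        - (\<Sum>j<Suc n. if n \<le> j + 1 then profile 0 else 0)"
      by (simp only: sum_subtractf sum_constant card_lessThan of_nat_id)
    ultimately have "(\<Sum>j<Suc n. t j) \<ge> Suc n * (profile 0 / 2) - j0 * (M * profile 0 * N) - 2 * profile 0"
      by linarith
    moreover have "avg G p R - avg G p (R / 2 ^ Suc n) = (\<Sum>j<Suc n. t j)"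
      unfolding t_def by (rule avg_telescope[OF R(1)]) (use subD[of 0] in simp)
    moreover have "avg G p R \<le> N / R\<^sup>2" using avg_le[OF R(1), of p] by linarith
    ultimately have "avg G p (R / 2 ^ Suc n) \<le> N / R\<^sup>2 + j0 * (M * profile 0 * N) + 2 * profile 0
        - Suc n * (profile 0 / 2)"
      by linarith
    moreover have "R / 2 ^ Suc n = r / 2" by (simp add: r_def)
    ultimately have avg1: "avg G p (r / 2) \<le> N / R\<^sup>2 + j0 * (M * profile 0 * N) + 2 * profile 0
        - Suc n * (profile 0 / 2)"
      by (simp only:)
    \<comment> \<open>Every point within r / 2 of \<open>p\<close> is the centre of a disc of radius
      r / 4 avoiding \<open>w\<close>, so |g| \<le> 16 C2 / r^2 there. The factor r^2 of the mean
      value estimate cancels this blow-up and leaves an error independent of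
      \<open>n\<close>.\<close>
    have avg2: "\<bar>avg G p (r / 2) - g p * kernel_mass\<bar> \<le> C1 * (r / 2)\<^sup>2 * (16 * C2 / r\<^sup>2)"
    proof (rule mean_value_estimate)
      show "r / 2 > 0" using r by simp
      have far: "cball z (r / 4) \<subseteq> D - {w}" if z: "z \<in> cball p (r / 2)" for z
      proof
        fix y assume y: "y \<in> cball z (r / 4)"
        have "dist p y \<le> 3 / 4 * r" using y z dist_triangle[of p y z] by simp
        then have "dist p y < r" using r by simp
        moreover have "dist p w = r" using pw by (simp add: r_def)
        moreover have "y \<in> cball p (R / 2 ^ n)" using \<open>dist p y < r\<close> by (simp add: r_def)
        ultimately show "y \<in> D - {w}" using subD[of n] by auto
      qed
      then show "cball p (r / 2) \<subseteq> D - {w}"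
        using r by (meson centre_in_cball less_eq_real_def subset_iff zero_less_divide_iff zero_less_numeral)
      show "\<bar>g z\<bar> \<le> 16 * C2 / r\<^sup>2" if z: "z \<in> cball p (r / 2)" for z
      proof -
        have "\<bar>g z\<bar> * (r / 4)\<^sup>2 \<le> C2" using r R far[OF z] by (intro growth) auto
        then show ?thesis using r by (simp add: field_simps power2_eq_square)
      qed
    qed
    also have "C1 * (r / 2)\<^sup>2 * (16 * C2 / r\<^sup>2) = 4 * C1 * C2"
      using r by (simp add: field_simps power2_eq_square)
    finally have "g p * kernel_mass \<le> avg G p (r / 2) + 4 * C1 * C2" by linarith
    also have "\<dots> \<le> K - Suc n * (profile 0 / 2)" using avg1 by (simp add: K_def)
    also have "\<dots> < 0"
    proof -
      have "2 * K / profile 0 < Suc n" using n n0 by linarith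
      then show ?thesis using profile_0_pos by (simp add: field_simps)
    qed
    finally have "g p < 0" using kernel_mass_pos by (simp add: mult_less_0_iff)
    then show ?thesis using pD by simp
  qed
  then show thesis using that R(1) by blast
qed

subsection \<open>The sign of the Green function\<close>

lemma compact_closure_D: "compact (closure D)"
  using bounded_D by (simp add: compact_closure)

text \<open>Cut out a disc about \<open>w\<close> on whose boundary circle g < 0. If
  \<open>g\<close> were positive somewhere, F - g for a small positive paraboloid F would have a
  negative minimum at a point off the circle and off the boundary. There g > 0, so u g \<ge> 0
  exceeds the negative Laplacian of F, which excludes a local minimum.\<close>

lemma g_nonpos:
  assumes z1: "z1 \<in> D" "z1 \<noteq> w" shows "g z1 \<le> 0"
proof (rule ccontr)
  assume "\<not> g z1 \<le> 0"
  then have pos: "g z1 > 0" by simp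
  obtain R n0 where R: "R > 0" and neg: "\<And>n p. n \<ge> n0 \<Longrightarrow> dist p w = R / 2 ^ n \<Longrightarrow> p \<in> D \<and> g p < 0"
    using negative_near_pole by blast
  have "(\<lambda>n. R / 2 ^ n) \<longlonglongrightarrow> 0" using LIMSEQ_divide_realpow_zero[of 2 R] by simp
  then have "\<forall>\<^sub>F n in sequentially. R / 2 ^ n < dist z1 w"
    by (rule order_tendstoD) (use z1 in simp)
  then have "\<forall>\<^sub>F n in sequentially. R / 2 ^ n < dist z1 w \<and> n \<ge> n0"
    using eventually_ge_at_top by (rule eventually_conj)
  then obtain n where n: "R / 2 ^ n < dist z1 w" "n \<ge> n0"
    using eventually_happens'[OF sequentially_bot] by blast
  define r where "r = R / 2 ^ n"
  have r: "r > 0" using R by (simp add: r_def)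
  obtain B where B: "\<And>z. z \<in> closure D \<Longrightarrow> norm z \<le> B"
    using compact_imp_bounded[OF compact_closure_D] unfolding bounded_iff by blast
  define C where "C = B\<^sup>2 + 1"
  \<comment> \<open>The paraboloid is positive on the closure and at most half of
    \<open>g z1\<close> at \<open>z1\<close>, so the minimum of F - g is negative.\<close>
  define \<eta> where "\<eta> = g z1 / (2 * C)"
  have C: "C > 0" unfolding C_def by (simp add: add_nonneg_pos)
  have \<eta>: "\<eta> > 0" using C pos by (simp add: \<eta>_def)
  define F :: "complex \<Rightarrow> real" where "F z = \<eta> * (C - (norm (z - 0))\<^sup>2 / 1)" for z
  have F_smooth: "smooth_alg F"
    unfolding F_def[abs_def] by (intro smooth_alg.mult smooth_alg_diff smooth_alg.const
        smooth_alg_radial[where F = "\<lambda>s. s"] smooth_real_ident)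
  have F_lap: "laplacian F z = - 4 * \<eta>" for z
  proof -
    have "laplacian F z = 4 / 1 * (- \<eta> + (norm (z - 0))\<^sup>2 / 1 * 0)"
      unfolding F_def[abs_def]
      by (rule laplacian_radial[of "\<lambda>s. \<eta> * (C - s)" "\<lambda>s. - \<eta>" "\<lambda>s. 0"])
        (auto intro!: derivative_eq_intros)
    then show ?thesis by simp
  qed
  have F_pos: "F z > 0" if "z \<in> closure D" for z
  proof -
    have "(norm z)\<^sup>2 \<le> B\<^sup>2" using B[OF that] by (intro power_mono) auto
    then show ?thesis using \<eta> by (simp add: F_def C_def)
  qed
  define K where "K = closure D - ball w r"
  have K: "compact K" unfolding K_def using compact_closure_D by (rule compact_diff) simp
  have wK: "w \<notin> K" using r by (simp add: K_def)
  have z1K: "z1 \<in> K"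
    using z1 n(1) closure_subset by (auto simp: K_def r_def dist_commute)
  have "continuous_on K (\<lambda>z. F z - g z)"
    by (intro continuous_intros smooth_alg_continuous[OF F_smooth] continuous_on_subset[OF g_cont])
      (use wK in \<open>auto simp: K_def\<close>)
  then obtain p where p: "p \<in> K" "\<And>z. z \<in> K \<Longrightarrow> F p - g p \<le> F z - g z"
    using continuous_attains_inf[OF K] z1K by blast
  have "F z1 \<le> g z1 / 2"
  proof -
    have "F z1 \<le> \<eta> * C" using \<eta> by (simp add: F_def)
    then show ?thesis using C by (simp add: \<eta>_def)
  qed
  then have "F p - g p < 0" using p(2)[OF z1K] pos by simp
  moreover have "F p > 0" using p(1) by (intro F_pos) (simp add: K_def)
  ultimately have gp: "g p > 0" by simp
  have "p \<notin> frontier D" using g_frontier gp by auto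
  then have pD: "p \<in> D" using p(1) open_D by (auto simp: K_def frontier_def interior_open)
  have "dist p w \<noteq> r" using neg[OF n(2), of p] gp by (auto simp: r_def)
  then have pr: "p \<notin> cball w r" using p(1) by (auto simp: K_def dist_commute)
  define O' where "O' = {z \<in> D - cball w r. g z > 0}"
  have "open (D - cball w r)" using open_D by auto
  moreover have "continuous_on (D - cball w r) g"
    by (rule continuous_on_subset[OF g_cont]) (use closure_subset r in auto)
  ultimately have "open ((D - cball w r) \<inter> g -` {0<..})"
    by (intro continuous_open_preimage) auto
  moreover have "(D - cball w r) \<inter> g -` {0<..} = O'" by (auto simp: O'_def)
  ultimately have "open O'" by simp
  moreover have "p \<in> O'" using pD pr gp by (simp add: O'_def)
  ultimately obtain s where s: "s > 0" "cball p s \<subseteq> O'"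
    using open_contains_cball by blast
  show False
  proof (rule no_local_min[OF F_smooth s(1)])
    show "cball p s \<subseteq> D - {w}" using s(2) r by (auto simp: O'_def)
    show "4 * \<eta> > 0" using \<eta> by simp
    fix z assume "z \<in> cball p s"
    then have z: "z \<in> D" "z \<notin> cball w r" "g z > 0" using s(2) by (auto simp: O'_def)
    then show "F p - g p \<le> F z - g z"
      using closure_subset by (intro p(2)) (auto simp: K_def)
    show "laplacian F z + 4 * \<eta> \<le> u z * g z"
      using z u_nonneg[OF z(1)] by (simp add: F_lap)
  qed
qed

end

section \<open>Hopf's boundary point lemma\<close>

text \<open>A polynomial substitute for the usual exponential barrier: with t = R^2 - |z - c|^2 it
  is t + 2 t^2 / R^2. It vanishes on the circle with nonzero slope, and its Laplacian is at least 4
  where |z - c|^2 \<ge> (3/4) R^2.\<close>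

definition barrier :: "complex \<Rightarrow> real \<Rightarrow> complex \<Rightarrow> real" where
  "barrier c R z = (R\<^sup>2 - (norm (z - c))\<^sup>2) * (1 + 2 * (R\<^sup>2 - (norm (z - c))\<^sup>2) / R\<^sup>2)"

lemma smooth_alg_barrier: "smooth_alg (barrier c R)"
proof -
  have "smooth_alg (\<lambda>z. (R\<^sup>2 - (norm (z - c))\<^sup>2) * (1 + 2 * inverse (R\<^sup>2) * (R\<^sup>2 - (norm (z - c))\<^sup>2)))"
    by (intro smooth_alg.mult smooth_alg.add smooth_alg_diff smooth_alg.const
        smooth_alg_norm_diff_squared)
  moreover have "(\<lambda>z. (R\<^sup>2 - (norm (z - c))\<^sup>2) * (1 + 2 * inverse (R\<^sup>2) * (R\<^sup>2 - (norm (z - c))\<^sup>2)))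
      = barrier c R"
    by (intro ext) (simp add: barrier_def divide_inverse algebra_simps)
  ultimately show ?thesis by simp
qed

lemma laplacian_barrier:
  assumes "R > 0"
  shows "laplacian (\<lambda>z. - e * barrier c R z) z = - 4 * e * (8 * (norm (z - c))\<^sup>2 / R\<^sup>2 - 5)"
proof -
  define F where "F s = - e * ((R\<^sup>2 - s) * (1 + 2 * (R\<^sup>2 - s) / R\<^sup>2))" for s
  have "(F has_real_derivative e * (5 - 4 * s / R\<^sup>2)) (at s)" for s
    unfolding F_def using assms by (auto intro!: derivative_eq_intros simp: field_simps)
  moreover have "((\<lambda>s. e * (5 - 4 * s / R\<^sup>2)) has_real_derivative - 4 * e / R\<^sup>2) (at s)" for s
    using assms by (auto intro!: derivative_eq_intros simp: field_simps power2_eq_square power4_eq_xxxx)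
  ultimately have "laplacian (\<lambda>z. F ((norm (z - c))\<^sup>2 / 1)) z
      = 4 / 1 * (e * (5 - 4 * ((norm (z - c))\<^sup>2 / 1) / R\<^sup>2) + (norm (z - c))\<^sup>2 / 1 * (- 4 * e / R\<^sup>2))"
    by (rule laplacian_radial) simp
  moreover have "(\<lambda>z. F ((norm (z - c))\<^sup>2 / 1)) = (\<lambda>z. - e * barrier c R z)"
    by (simp add: F_def barrier_def)
  ultimately show ?thesis by (simp add: algebra_simps)
qed

lemma barrier_le:
  assumes "R > 0" "3 / 4 * R\<^sup>2 \<le> (norm (z - c))\<^sup>2" "norm (z - c) \<le> R"
  shows "barrier c R z \<le> 3 / 8 * R\<^sup>2"
proof -
  define t where "t = R\<^sup>2 - (norm (z - c))\<^sup>2"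
  have t: "0 \<le> t" "t \<le> R\<^sup>2 / 4" using assms power_mono[OF assms(3), of 2] by (auto simp: t_def)
  have "2 * t / R\<^sup>2 \<le> 1 / 2" using t assms(1) by (simp add: field_simps)
  then have "t * (1 + 2 * t / R\<^sup>2) \<le> (R\<^sup>2 / 4) * (3 / 2)"
    using t assms(1) by (intro mult_mono) auto
  then show ?thesis by (simp add: barrier_def t_def)
qed

text \<open>Just outside the disc the first factor is at most 0 and the second is still nonnegative.
  This allows comparison on a full neighbourhood of a point of the circle.\<close>

lemma barrier_nonpos:
  assumes "R > 0" "R\<^sup>2 \<le> (norm (z - c))\<^sup>2" "(norm (z - c))\<^sup>2 \<le> 3 / 2 * R\<^sup>2"
  shows "barrier c R z \<le> 0"
proof -
  have "2 * (R\<^sup>2 - (norm (z - c))\<^sup>2) / R\<^sup>2 \<ge> - 1" using assms by (simp add: field_simps)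
  then show ?thesis unfolding barrier_def using assms by (intro mult_nonpos_nonneg) auto
qed

context green begin

lemma g_nonpos_closure:
  assumes "z \<in> closure D" "z \<noteq> w" shows "g z \<le> 0"
proof (cases "z \<in> D")
  case False
  then show ?thesis using assms g_frontier open_D by (simp add: frontier_def interior_open)
qed (use assms g_nonpos in blast)

text \<open>In the outer region \<open>e * barrier\<close> has Laplacian at least 4 e, which exceeds
  M (- g) \<ge> u (- g) at \<open>p\<close> and, by continuity, with a margin on a small disc. There
  \<open>- e * barrier - g\<close> is a strict supersolution.\<close>

lemma no_local_min_barrier:
  assumes R: "R > 0" and e: "e > 0" and p: "p \<in> D" "p \<noteq> w"
    and s: "3 / 4 * R\<^sup>2 < (norm (p - c))\<^sup>2"
    and small: "M * (- g p) < 4 * e"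
    and V: "open V" "p \<in> V"
    and min: "\<And>z. z \<in> V \<Longrightarrow> z \<in> D \<Longrightarrow> z \<noteq> w \<Longrightarrow> 3 / 4 * R\<^sup>2 < (norm (z - c))\<^sup>2 \<Longrightarrow>
      - g p - e * barrier c R p \<le> - g z - e * barrier c R z"
  shows False
proof -
  define m where "m = (4 * e - M * (- g p)) / 2"
  have m: "m > 0" using small by (simp add: m_def)
  define W where "W = V \<inter> (D - {w}) \<inter> {z. 3 / 4 * R\<^sup>2 < (norm (z - c))\<^sup>2}"
  have W: "open W"
    unfolding W_def using V(1) open_D
    by (intro open_Int open_Diff open_Collect_less continuous_intros) auto
  have "continuous_on W (\<lambda>z. M * (- g z))"
    by (intro continuous_intros continuous_on_subset[OF g_cont])
      (use closure_subset in \<open>auto simp: W_def\<close>)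
  then have "open (W \<inter> (\<lambda>z. M * (- g z)) -` {..<4 * e - m})"
    by (rule continuous_open_preimage[OF _ W]) simp
  moreover have "p \<in> W \<inter> (\<lambda>z. M * (- g z)) -` {..<4 * e - m}"
    using p s V(2) small by (simp add: W_def m_def field_simps)
  ultimately obtain r where r: "r > 0" "cball p r \<subseteq> W \<inter> (\<lambda>z. M * (- g z)) -` {..<4 * e - m}"
    using open_contains_cball by blast
  show False
  proof (rule no_local_min[of "\<lambda>z. - e * barrier c R z" r p m])
    show "smooth_alg (\<lambda>z. - e * barrier c R z)"
      by (intro smooth_alg.mult smooth_alg.const smooth_alg_barrier)
    show "cball p r \<subseteq> D - {w}" using r(2) by (auto simp: W_def)
    fix z assume "z \<in> cball p r"
    then have z: "z \<in> V" "z \<in> D" "z \<noteq> w" "3 / 4 * R\<^sup>2 < (norm (z - c))\<^sup>2" "M * (- g z) < 4 * e - m"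
      using r(2) by (auto simp: W_def)
    show "- e * barrier c R p - g p \<le> - e * barrier c R z - g z"
      using min[OF z(1-4)] by simp
    have "8 * (norm (z - c))\<^sup>2 / R\<^sup>2 - 5 \<ge> 1" using z(4) R by (simp add: field_simps)
    then have "4 * e * (8 * (norm (z - c))\<^sup>2 / R\<^sup>2 - 5) \<ge> 4 * e * 1"
      using e by (intro mult_left_mono) auto
    moreover have "u z * (- g z) \<le> M * (- g z)"
      using g_nonpos[OF z(2,3)] u_le[OF z(2)] by (intro mult_right_mono) auto
    ultimately show "laplacian (\<lambda>z. - e * barrier c R z) z + m \<le> u z * g z"
      using z(5) unfolding laplacian_barrier[OF R] by simp
  qed (use r m in auto)
qed

lemma barrier_comparison:
  assumes R: "R > 0" "M * R\<^sup>2 \<le> 8" and ball: "ball c R \<subseteq> D" and wb: "w \<notin> cball c R"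
    and neg: "\<And>z. z \<in> ball c R \<Longrightarrow> g z < 0"
  obtains e where "e > 0"
    "\<And>z. z \<in> cball c R \<Longrightarrow> 3 / 4 * R\<^sup>2 \<le> (norm (z - c))\<^sup>2 \<Longrightarrow> e * barrier c R z \<le> - g z"
proof -
  have cl: "cball c R \<subseteq> closure D"
    using closure_mono[OF ball] R(1) by simp
  have g_cont': "continuous_on (cball c R) g"
    by (rule continuous_on_subset[OF g_cont]) (use cl wb in auto)
  define S where "S = {z \<in> cball c R. (norm (z - c))\<^sup>2 = 3 / 4 * R\<^sup>2}"
  have "closed ({z. (norm (z - c))\<^sup>2 = 3 / 4 * R\<^sup>2})"
    by (intro closed_Collect_eq continuous_intros)
  then have "compact (cball c R \<inter> {z. (norm (z - c))\<^sup>2 = 3 / 4 * R\<^sup>2})"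
    by (intro compact_Int_closed compact_cball)
  also have "cball c R \<inter> {z. (norm (z - c))\<^sup>2 = 3 / 4 * R\<^sup>2} = S" by (auto simp: S_def)
  finally have S: "compact S" .
  have S_ball: "z \<in> ball c R" if "z \<in> S" for z
  proof -
    have "(norm (z - c))\<^sup>2 = 3 / 4 * R\<^sup>2" using that by (simp add: S_def)
    moreover have "R\<^sup>2 > 0" using R by simp
    ultimately have "(norm (z - c))\<^sup>2 < R\<^sup>2" by linarith
    then have "norm (z - c) < R" by (rule power2_less_imp_less) (use R(1) in simp)
    then show ?thesis by (simp add: dist_norm norm_minus_commute)
  qed
  have "S \<noteq> {}"
  proof -
    define y where "y = c + of_real (sqrt (3/4) * R)"
    have y: "norm (y - c) = sqrt (3/4) * R" using R by (simp add: y_def norm_mult)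
    have "sqrt (3/4) * R \<le> 1 * R"
      using R by (intro mult_right_mono) (auto intro!: real_le_lsqrt)
    then have "dist c y \<le> R" using y by (simp add: dist_norm norm_minus_commute)
    moreover have "(norm (y - c))\<^sup>2 = 3 / 4 * R\<^sup>2" unfolding y by (simp add: power_mult_distrib)
    ultimately have "y \<in> S" by (simp add: S_def)
    then show ?thesis by blast
  qed
  moreover have "continuous_on S (\<lambda>z. - g z)"
    by (intro continuous_intros continuous_on_subset[OF g_cont']) (auto simp: S_def)
  ultimately obtain s0 where s0: "s0 \<in> S" "\<And>z. z \<in> S \<Longrightarrow> - g s0 \<le> - g z"
    using continuous_attains_inf[OF S] by blast
  \<comment> \<open>On the inner circle the barrier equals \<open>3 / 8 * R\<^sup>2\<close>, so
    \<open>e * barrier\<close> there is the minimum of \<open>- g\<close> over that circle.\<close>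
  define e where "e = - g s0 / (3 / 8 * R\<^sup>2)"
  have e: "e > 0" using neg[OF S_ball[OF s0(1)]] R by (simp add: e_def field_simps)
  have eR: "e * (3 / 8 * R\<^sup>2) = - g s0" using R by (simp add: e_def)
  define q where "q z = - g z - e * barrier c R z" for z
  define K where "K = {z \<in> cball c R. 3 / 4 * R\<^sup>2 \<le> (norm (z - c))\<^sup>2}"
  have "closed ({z. 3 / 4 * R\<^sup>2 \<le> (norm (z - c))\<^sup>2})"
    by (intro closed_Collect_le continuous_intros)
  then have "compact (cball c R \<inter> {z. 3 / 4 * R\<^sup>2 \<le> (norm (z - c))\<^sup>2})"
    by (intro compact_Int_closed compact_cball)
  also have "cball c R \<inter> {z. 3 / 4 * R\<^sup>2 \<le> (norm (z - c))\<^sup>2} = K" by (auto simp: K_def)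
  finally have K: "compact K" .
  have q_cont: "continuous_on K q"
    unfolding q_def
    by (intro continuous_intros continuous_on_subset[OF g_cont'] smooth_alg_continuous
        smooth_alg_barrier) (auto simp: K_def)
  have q_nonneg: "q z \<ge> 0" if zK: "z \<in> K" for z
  proof (rule ccontr)
    assume "\<not> q z \<ge> 0"
    obtain p where p: "p \<in> K" "\<And>z. z \<in> K \<Longrightarrow> q p \<le> q z"
      using continuous_attains_inf[OF K _ q_cont] zK by blast
    have qp: "q p < 0" using p(2)[OF zK] \<open>\<not> q z \<ge> 0\<close> by simp
    have p': "norm (p - c) \<le> R" "3 / 4 * R\<^sup>2 \<le> (norm (p - c))\<^sup>2"
      using p(1) by (auto simp: K_def dist_norm norm_minus_commute)
    have bp: "e * barrier c R p \<le> - g s0"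
      unfolding eR[symmetric] using e by (intro mult_left_mono barrier_le[OF R(1) p'(2,1)]) simp
    have "p \<notin> S" using s0(2)[of p] bp qp by (auto simp: q_def)
    then have s: "3 / 4 * R\<^sup>2 < (norm (p - c))\<^sup>2" using p p' by (auto simp: S_def K_def)
    have "norm (p - c) \<noteq> R"
    proof
      assume "norm (p - c) = R"
      then have "barrier c R p = 0" by (simp add: barrier_def)
      moreover have "g p \<le> 0"
        using p(1) cl wb by (intro g_nonpos_closure) (auto simp: K_def)
      ultimately show False using qp by (simp add: q_def)
    qed
    then have pb: "p \<in> ball c R" using p' by (simp add: dist_norm norm_minus_commute)
    show False
    proof (rule no_local_min_barrier[OF R(1) e _ _ s _ open_ball pb])
      show "p \<in> D" using pb ball by blast
      show "p \<noteq> w" using p(1) wb by (auto simp: K_def)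
      \<comment> \<open>At a negative minimum - g p < e * barrier \<le> (3/8) e R^2, and
        \<open>M * R\<^sup>2 \<le> 8\<close> bounds the potential term by 3 e, below the 4 e
        supplied by the barrier.\<close>
      have "M * (- g p) \<le> M * (e * (3 / 8 * R\<^sup>2))"
        using qp bp eR M_nonneg by (intro mult_left_mono) (auto simp: q_def)
      also have "\<dots> = e * (3 / 8 * (M * R\<^sup>2))" by simp
      also have "\<dots> \<le> e * (3 / 8 * 8)" using e R(2) by (intro mult_left_mono) auto
      also have "\<dots> < 4 * e" using e by simp
      finally show "M * (- g p) < 4 * e" .
      fix z assume "z \<in> ball c R" "3 / 4 * R\<^sup>2 < (norm (z - c))\<^sup>2"
      then have "z \<in> K" by (simp add: K_def)
      from p(2)[OF this] show "- g p - e * barrier c R p \<le> - g z - e * barrier c R z"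
        by (simp add: q_def)
    qed
  qed
  show thesis
  proof (rule that[OF e])
    fix z assume "z \<in> cball c R" "3 / 4 * R\<^sup>2 \<le> (norm (z - c))\<^sup>2"
    then have "z \<in> K" by (simp add: K_def)
    from q_nonneg[OF this] show "e * barrier c R z \<le> - g z" by (simp add: q_def)
  qed
qed

section \<open>Strong maximum principle and the boundary derivative\<close>

lemma small_radius: obtains \<rho> where "\<rho> > 0" "\<And>R. 0 < R \<Longrightarrow> R \<le> \<rho> \<Longrightarrow> M * R\<^sup>2 \<le> 8"
proof
  show "min 1 (8 / (M + 1)) > 0" using M_nonneg by simp
  fix R :: real assume R: "0 < R" "R \<le> min 1 (8 / (M + 1))"
  have "M * R\<^sup>2 \<le> M * R" using R M_nonneg by (intro mult_left_mono) (auto simp: power2_eq_square mult_left_le)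
  also have "\<dots> \<le> (M + 1) * (8 / (M + 1))" using R M_nonneg by (intro mult_mono) auto
  also have "\<dots> = 8"
    using M_nonneg nonzero_mult_div_cancel_left[of "M + 1" 8] by (simp only: times_divide_eq_right)
  finally show "M * R\<^sup>2 \<le> 8" .
qed

text \<open>The set D - {w} is connected and g < 0 near the pole, so a nonempty zero set is not open
  and some disc free of zeros touches it at an interior point \<open>x0\<close>. The barrier bound
  on the disc extends across the circle, since beyond it the barrier is at most 0 and
  \<open>- g\<close> at least 0. Hence \<open>- g - e * barrier\<close> has a local minimum at
  \<open>x0\<close>, which is impossible; no gradient of \<open>g\<close> enters.\<close>

lemma g_neg:
  assumes "z1 \<in> D" "z1 \<noteq> w" shows "g z1 < 0"
proof (rule ccontr)
  assume "\<not> g z1 < 0"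
  then have z1: "g z1 = 0" using g_nonpos[OF assms] by simp
  define X where "X = D - {w}"
  define P where "P = X \<inter> g -` {..<0}"
  define Z where "Z = X \<inter> g -` {0}"
  have X: "open X" using open_D by (simp add: X_def open_Diff)
  have gX: "continuous_on X g"
    by (rule continuous_on_subset[OF g_cont]) (use closure_subset in \<open>auto simp: X_def\<close>)
  have P: "open P" unfolding P_def by (rule continuous_open_preimage[OF gX X]) simp
  have XPZ: "X = P \<union> Z" "P \<inter> Z = {}"
    using g_nonpos by (auto simp: X_def P_def Z_def order.order_iff_strict)
  have "connected X"
    unfolding X_def by (rule connected_open_delete[OF open_D connected_D]) simp
  have "P \<noteq> {}"
  proof -
    obtain R n0 where "R > 0" "\<And>n p. n \<ge> n0 \<Longrightarrow> dist p w = R / 2 ^ n \<Longrightarrow> p \<in> D \<and> g p < 0"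
      using negative_near_pole by blast
    from this(2)[of n0 "w + of_real (R / 2 ^ n0)"] this(1)
    have "w + of_real (R / 2 ^ n0) \<in> P"
      by (auto simp: P_def X_def dist_norm norm_divide norm_power)
    then show ?thesis by blast
  qed
  moreover have "Z \<noteq> {}" using z1 assms by (auto simp: Z_def X_def)
  ultimately have "\<not> open Z"
    using connectedD[OF \<open>connected X\<close> P] XPZ by auto
  then obtain x where x: "x \<in> Z" "\<And>d. d > 0 \<Longrightarrow> \<not> ball x d \<subseteq> Z"
    unfolding open_contains_ball by blast
  have "x \<in> X" using x(1) by (simp add: Z_def)
  then obtain d where d: "d > 0" "cball x d \<subseteq> X" using X open_contains_cball by blast
  obtain \<rho> where \<rho>: "\<rho> > 0" "\<And>R. 0 < R \<Longrightarrow> R \<le> \<rho> \<Longrightarrow> M * R\<^sup>2 \<le> 8"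
    using small_radius by blast
  \<comment> \<open>With half of \<open>d\<close>, the touching disc about a centre closer than
    \<delta> to \<open>x\<close> stays inside the disc of radius \<open>d\<close> about
    \<open>x\<close>.\<close>
  define \<delta> where "\<delta> = min \<rho> (d / 2)"
  have \<delta>: "\<delta> > 0" "\<delta> \<le> \<rho>" "2 * \<delta> \<le> d" using \<rho> d by (auto simp: \<delta>_def)
  obtain c where c: "c \<in> ball x \<delta>" "c \<notin> Z" using x(2)[OF \<delta>(1)] by blast
  have near: "dist x z < d" if "dist c z < \<delta>" for z
    using dist_triangle[of x z c] that c(1) \<delta>(3) by simp
  have "closed (cball x d \<inter> g -` {0})"
    by (rule continuous_closed_preimage) (use continuous_on_subset[OF gX d(2)] in auto)
  then have "compact (cball x d \<inter> (cball x d \<inter> g -` {0}))"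
    by (intro compact_Int_closed compact_cball)
  then have Z': "compact (cball x d \<inter> g -` {0})" (is "compact ?Z") by (simp add: Int_assoc[symmetric])
  have xZ: "x \<in> ?Z" using x(1) d by (simp add: Z_def)
  obtain x0 where x0: "x0 \<in> ?Z" "\<And>z. z \<in> ?Z \<Longrightarrow> dist c x0 \<le> dist c z"
    using distance_attains_inf[OF compact_imp_closed[OF Z']] xZ by (metis empty_iff)
  define R where "R = dist c x0"
  have "c \<in> X" using near[of c] \<delta>(1) d(2) by auto
  then have "g c \<noteq> 0" using c(2) by (auto simp: Z_def)
  then have R0: "R > 0" using x0(1) by (auto simp: R_def)
  have R1: "R < \<delta>" using x0(2)[OF xZ] c(1) by (simp add: R_def dist_commute)
  have cbX: "cball c R \<subseteq> X"
  proof
    fix z assume "z \<in> cball c R"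
    then have "dist x z < d" using R1 by (intro near) simp
    then show "z \<in> X" using d(2) by (auto simp: subset_iff)
  qed
  have ball_neg: "g z < 0" if z: "z \<in> ball c R" for z
  proof -
    have "z \<in> X" using z cbX ball_subset_cball by blast
    moreover have "g z \<noteq> 0"
    proof
      assume "g z = 0"
      then have "z \<in> ?Z" using near[of z] z R1 by simp
      from x0(2)[OF this] z show False by (simp add: R_def)
    qed
    ultimately show ?thesis using g_nonpos[of z] by (simp add: X_def)
  qed
  have "M * R\<^sup>2 \<le> 8" using \<rho>(2)[OF R0] R1 \<delta>(2) by simp
  moreover have "ball c R \<subseteq> D" "w \<notin> cball c R"
    using cbX ball_subset_cball[of c R] unfolding X_def by blast+
  ultimately obtain e where e: "e > 0"
    "\<And>z. z \<in> cball c R \<Longrightarrow> 3 / 4 * R\<^sup>2 \<le> (norm (z - c))\<^sup>2 \<Longrightarrow> e * barrier c R z \<le> - g z"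
    using barrier_comparison[OF R0 _ _ _ ball_neg] by blast
  have gx0: "g x0 = 0" using x0(1) by simp
  have nx0: "norm (x0 - c) = R" by (simp add: R_def dist_norm norm_minus_commute)
  have "x0 \<in> cball c R" by (simp add: R_def)
  then have "x0 \<in> X" using cbX by blast
  define V where "V = {z. (norm (z - c))\<^sup>2 < 3 / 2 * R\<^sup>2}"
  show False
  proof (rule no_local_min_barrier[of R e x0 c V])
    show "x0 \<in> D" "x0 \<noteq> w" using \<open>x0 \<in> X\<close> by (auto simp: X_def)
    show "open V" unfolding V_def by (intro open_Collect_less continuous_intros)
    show "x0 \<in> V" "3 / 4 * R\<^sup>2 < (norm (x0 - c))\<^sup>2" using nx0 R0 by (auto simp: V_def)
    show "M * - g x0 < 4 * e" using e gx0 by simp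
    fix z assume z: "z \<in> V" "z \<in> D" "z \<noteq> w" "3 / 4 * R\<^sup>2 < (norm (z - c))\<^sup>2"
    have "e * barrier c R z \<le> - g z"
    proof (cases "z \<in> cball c R")
      case True
      then show ?thesis using e(2) z(4) by simp
    next
      case False
      then have "R\<^sup>2 \<le> (norm (z - c))\<^sup>2"
        using R0 by (intro power_mono) (auto simp: dist_norm norm_minus_commute)
      then have "barrier c R z \<le> 0" using z(1) R0 by (intro barrier_nonpos) (auto simp: V_def)
      then have "e * barrier c R z \<le> 0" using e(1) by (simp add: mult_nonneg_nonpos)
      then show ?thesis using g_nonpos[OF z(2,3)] by linarith
    qed
    moreover have "barrier c R x0 = 0" by (simp add: barrier_def nx0)
    ultimately show "- g x0 - e * barrier c R x0 \<le> - g z - e * barrier c R z"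
      using gx0 by simp
  qed (use R0 e in auto)
qed

text \<open>Along the inward normal the barrier grows at least like \<open>r\<close> times the
  distance to \<open>z0\<close>, hence so does \<open>- g\<close> up to the factor \<open>e\<close>.
  For negative s the quotient g / s is therefore at least \<open>e * r\<close>.\<close>

lemma normal_derivative_pos:
  assumes z0: "z0 \<in> frontier D" and \<nu>: "outward_unit_normal D z0 \<nu>"
    and R: "R > 0" "ball (z0 - R *\<^sub>R \<nu>) R \<subseteq> D"
    and v: "has_outward_normal_derivative g D z0 v"
  shows "v > 0"
proof -
  have n1: "norm \<nu> = 1" using \<nu> by (simp add: outward_unit_normal_def)
  have "z0 \<noteq> w" using z0 w open_D by (auto simp: frontier_def interior_open)
  obtain \<rho> where \<rho>: "\<rho> > 0" "\<And>R. 0 < R \<Longrightarrow> R \<le> \<rho> \<Longrightarrow> M * R\<^sup>2 \<le> 8"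
    using small_radius by blast
  \<comment> \<open>A third of the distance to \<open>w\<close> suffices, as the closed disc of
    radius \<open>r\<close> through \<open>z0\<close> reaches at most 2 r away from
    \<open>z0\<close>.\<close>
  define r where "r = min (min R \<rho>) (dist z0 w / 3)"
  have r: "r > 0" "r \<le> R" "r \<le> \<rho>" "r \<le> dist z0 w / 3"
    using R \<rho> \<open>z0 \<noteq> w\<close> by (auto simp: r_def)
  define c where "c = z0 - r *\<^sub>R \<nu>"
  have cz0: "dist c z0 = r" using r n1 by (simp add: c_def dist_norm)
  have sub: "ball c r \<subseteq> D"
  proof -
    have "dist c (z0 - R *\<^sub>R \<nu>) = R - r"
    proof -
      have "c - (z0 - R *\<^sub>R \<nu>) = (R - r) *\<^sub>R \<nu>" by (simp add: c_def algebra_simps)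
      then show ?thesis using n1 r by (simp add: dist_norm)
    qed
    have "ball c r \<subseteq> ball (z0 - R *\<^sub>R \<nu>) R"
    proof
      fix z assume "z \<in> ball c r"
      then show "z \<in> ball (z0 - R *\<^sub>R \<nu>) R"
        using dist_triangle[of "z0 - R *\<^sub>R \<nu>" z c] \<open>dist c (z0 - R *\<^sub>R \<nu>) = R - r\<close>
        by (simp add: dist_commute)
    qed
    then show ?thesis using R(2) by blast
  qed
  have wc: "w \<notin> cball c r"
    using dist_triangle[of z0 w c] cz0 r by (auto simp: dist_commute)
  have neg: "g z < 0" if "z \<in> ball c r" for z
    using that sub wc by (intro g_neg) auto
  obtain e where e: "e > 0"
    "\<And>z. z \<in> cball c r \<Longrightarrow> 3 / 4 * r\<^sup>2 \<le> (norm (z - c))\<^sup>2 \<Longrightarrow> e * barrier c r z \<le> - g z"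
    using barrier_comparison[OF r(1) \<rho>(2)[OF r(1,3)] sub wc neg] by blast
  have D: "((\<lambda>s. g (z0 + s *\<^sub>R \<nu>)) has_real_derivative v) (at_left 0)"
    using v \<nu> by (simp add: has_outward_normal_derivative_def)
  have "((\<lambda>s. (g (z0 + s *\<^sub>R \<nu>) - g (z0 + 0 *\<^sub>R \<nu>)) / (s - 0)) \<longlongrightarrow> v) (at_left 0)"
    using D unfolding has_field_derivative_iff .
  then have lim: "((\<lambda>s. g (z0 + s *\<^sub>R \<nu>) / s) \<longlongrightarrow> v) (at_left 0)"
    using g_frontier[OF z0] by simp
  have "\<forall>\<^sub>F s in at_left 0. e * r \<le> g (z0 + s *\<^sub>R \<nu>) / s"
  proof -
    \<comment> \<open>Since (7/8)^2 \<ge> 3/4, the points stay in the outer region where the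
      comparison holds.\<close>
    have "\<forall>\<^sub>F s in at_left 0. - r / 8 < s \<and> s < 0"
      using eventually_at_left_real[of "- r / 8" 0] r(1) by simp
    then show ?thesis
    proof eventually_elim
      case (elim s)
      define z where "z = z0 + s *\<^sub>R \<nu>"
      have "z - c = (r + s) *\<^sub>R \<nu>" by (simp add: z_def c_def algebra_simps)
      then have nz: "norm (z - c) = r + s" using n1 elim r by simp
      have "z \<in> cball c r" using nz elim by (simp add: dist_norm norm_minus_commute)
      moreover have "3 / 4 * r\<^sup>2 \<le> (norm (z - c))\<^sup>2"
      proof -
        have "3 / 4 * r\<^sup>2 \<le> (7 / 8 * r)\<^sup>2" by (simp add: power2_eq_square)
        also have "\<dots> \<le> (r + s)\<^sup>2" using elim r by (intro power_mono) auto
        finally show ?thesis unfolding nz .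
      qed
      ultimately have "e * barrier c r z \<le> - g z" by (rule e(2))
      moreover have "barrier c r z \<ge> r * (- s)"
      proof -
        define t where "t = r\<^sup>2 - (norm (z - c))\<^sup>2"
        have t: "t = (- s) * (2 * r + s)" by (simp add: t_def nz power2_eq_square algebra_simps)
        have "(- s) * r \<le> (- s) * (2 * r + s)" using elim r by (intro mult_left_mono) auto
        then have "r * (- s) \<le> t" by (simp add: t mult.commute)
        moreover have "0 \<le> t" unfolding t using elim r by (intro mult_nonneg_nonneg) auto
        moreover from this have "t * 1 \<le> t * (1 + 2 * t / r\<^sup>2)" by (intro mult_left_mono) auto
        ultimately show ?thesis by (simp add: barrier_def t_def)
      qed
      ultimately have "e * (r * (- s)) \<le> - g z"
        using mult_left_mono[of "r * (- s)" "barrier c r z" e] e(1) by linarith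
      then show ?case using elim by (simp add: z_def field_simps)
    qed
  qed
  then have "e * r \<le> v" by (rule tendsto_lowerbound[OF lim]) simp
  then show ?thesis using e r by (meson less_le_trans mult_pos_pos)
qed

end

section \<open>Boundary charts\<close>

locale boundary_chart =
  fixes D :: "complex set" and z0 :: complex and U :: "complex set" and f :: "complex \<Rightarrow> complex"
  assumes open_D: "open D" and z0: "z0 \<in> frontier D"
    and U: "open U" "z0 \<in> U" and hol: "f holomorphic_on U" and inj: "inj_on f U"
    and side: "\<And>p. p \<in> U \<Longrightarrow> p \<in> D \<longleftrightarrow> Im (f p) > 0"
begin

definition a :: complex where "a = deriv f z0"

text \<open>The direction of steepest increase of \<open>Im f\<close> at \<open>z0\<close>, that is
  the inner unit normal; \<open>T\<close> is the unit tangent, with n = i T.\<close>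

definition n :: complex where "n = \<i> * cnj a / of_real (norm a)"

definition T :: complex where "T = cnj a / of_real (norm a)"

lemma a_nonzero: "a \<noteq> 0"
  unfolding a_def by (rule holomorphic_injective_imp_regular[OF hol U(1) inj U(2)])

lemma a_pos: "norm a > 0" using a_nonzero by simp

lemma norm_n: "norm n = 1" and norm_T: "norm T = 1" and n_inner_T: "n \<bullet> T = 0"
  and n_inner_n: "n \<bullet> n = 1" and T_inner_T: "T \<bullet> T = 1"
proof -
  show 1: "norm n = 1" "norm T = 1"
    using a_nonzero by (simp_all add: n_def T_def norm_mult norm_divide)
  show "n \<bullet> n = 1" "T \<bullet> T = 1" using 1 by (simp_all add: dot_square_norm)
  have "n = \<i> * T" by (simp add: n_def T_def)
  then show "n \<bullet> T = 0" by (simp add: inner_complex_def)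
qed

lemma Im_mult_a: "Im (a * z) = norm a * (z \<bullet> n)"
  using a_nonzero by (simp add: n_def inner_complex_def field_simps)

lemma deriv_f: "p \<in> U \<Longrightarrow> (f has_field_derivative deriv f p) (at p)"
  using holomorphic_derivI[OF hol U(1)] .

lemma Im_neg_not_closure:
  assumes p: "p \<in> U" "Im (f p) < 0" shows "p \<notin> closure D"
proof -
  have "continuous_on U (\<lambda>z. Im (f z))"
    by (intro continuous_intros holomorphic_on_imp_continuous_on hol)
  then have "open (U \<inter> (\<lambda>z. Im (f z)) -` {..<0})"
    by (rule continuous_open_preimage[OF _ U(1)]) simp
  moreover have "(U \<inter> (\<lambda>z. Im (f z)) -` {..<0}) \<inter> D = {}" using side by fastforce
  ultimately have "(U \<inter> (\<lambda>z. Im (f z)) -` {..<0}) \<inter> closure D = {}"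
    using open_Int_closure_eq_empty by blast
  then show ?thesis using p by blast
qed

lemma frontier_Im:
  assumes "p \<in> frontier D" "p \<in> U" shows "Im (f p) = 0"
proof -
  have "p \<notin> D" using assms(1) open_D by (simp add: frontier_def interior_open)
  then have "Im (f p) \<le> 0" using side[OF assms(2)] by simp
  moreover have "\<not> Im (f p) < 0"
    using assms Im_neg_not_closure by (auto simp: frontier_def)
  ultimately show ?thesis by simp
qed

lemma linear_approx_on_convex:
  assumes S: "convex S" "S \<subseteq> U" and B: "\<And>z. z \<in> S \<Longrightarrow> norm (deriv f z - a) \<le> B"
    and xy: "x \<in> S" "y \<in> S"
  shows "norm (f x - f y - a * (x - y)) \<le> B * norm (x - y)"
proof -
  have "norm ((f x - a * x) - (f y - a * y)) \<le> B * norm (x - y)"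
  proof (rule field_differentiable_bound[OF S(1) _ B xy])
    fix z assume "z \<in> S"
    then have "(f has_field_derivative deriv f z) (at z within S)"
      using deriv_f S(2) by (blast intro: has_field_derivative_at_within)
    then show "((\<lambda>z. f z - a * z) has_field_derivative deriv f z - a) (at z within S)"
      by (auto intro!: derivative_eq_intros)
  qed
  then show ?thesis by (simp add: algebra_simps)
qed

lemma deriv_f_has_derivative: "(deriv f has_field_derivative deriv (deriv f) z0) (at z0)"
  by (rule holomorphic_derivI[OF holomorphic_deriv[OF hol U(1)] U])

text \<open>Two arbitrary points are compared, as is needed for discs about boundary points other
  than \<open>z0\<close>.\<close>

lemma linear_approx:
  assumes "\<eta> > 0"
  obtains \<rho> where "\<rho> > 0" "ball z0 \<rho> \<subseteq> U"
    "\<And>x y. x \<in> ball z0 \<rho> \<Longrightarrow> y \<in> ball z0 \<rho> \<Longrightarrow> norm (f x - f y - a * (x - y)) \<le> \<eta> * norm (x - y)"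
proof -
  have "isCont (deriv f) z0" by (rule DERIV_isCont[OF deriv_f_has_derivative])
  then obtain d where d: "d > 0" "\<And>z. dist z z0 < d \<Longrightarrow> dist (deriv f z) a < \<eta>"
    using assms unfolding continuous_at_eps_delta a_def by blast
  obtain e where e: "e > 0" "ball z0 e \<subseteq> U" using U open_contains_ball by blast
  have sub: "ball z0 (min d e) \<subseteq> U" using e(2) by auto
  have bd: "norm (deriv f z - a) \<le> \<eta>" if "z \<in> ball z0 (min d e)" for z
    using d(2)[of z] that by (simp add: dist_norm norm_minus_commute)
  show thesis
    by (rule that[of "min d e"]) (use d(1) e(1) sub in \<open>auto intro!: linear_approx_on_convex[OF convex_ball sub bd]\<close>)
qed

text \<open>A local Lipschitz bound for \<open>deriv f\<close> gives a quadratic error, which is the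
  precision needed to fit a tangent disc into \<open>D\<close>.\<close>

lemma quadratic_approx:
  obtains \<rho> K where "\<rho> > 0" "K > 0" "ball z0 \<rho> \<subseteq> U"
    "\<And>z. z \<in> ball z0 \<rho> \<Longrightarrow> \<bar>Im (f z) - norm a * ((z - z0) \<bullet> n)\<bar> \<le> K * (norm (z - z0))\<^sup>2"
proof -
  define K where "K = norm (deriv (deriv f) z0) + 1"
  have K: "K > 0" by (simp add: K_def add_nonneg_pos)
  have "((\<lambda>z. (deriv f z - deriv f z0) / (z - z0)) \<longlongrightarrow> deriv (deriv f) z0) (at z0)"
    using deriv_f_has_derivative by (simp add: has_field_derivative_iff)
  then have "((\<lambda>z. norm ((deriv f z - a) / (z - z0))) \<longlongrightarrow> norm (deriv (deriv f) z0)) (at z0)"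
    unfolding a_def by (rule tendsto_norm)
  then have "\<forall>\<^sub>F z in at z0. norm ((deriv f z - a) / (z - z0)) < K"
    by (rule order_tendstoD) (simp add: K_def)
  then obtain d where d: "d > 0"
    "\<And>z. z \<noteq> z0 \<Longrightarrow> dist z z0 < d \<Longrightarrow> norm ((deriv f z - a) / (z - z0)) < K"
    unfolding eventually_at by blast
  have lip: "norm (deriv f z - a) \<le> K * norm (z - z0)" if "dist z z0 < d" for z
  proof (cases "z = z0")
    case False
    then show ?thesis using d(2)[OF False that] by (simp add: norm_divide field_simps)
  qed (simp add: a_def)
  obtain e where e: "e > 0" "ball z0 e \<subseteq> U" using U open_contains_ball by blast
  have "\<bar>Im (f z) - norm a * ((z - z0) \<bullet> n)\<bar> \<le> K * (norm (z - z0))\<^sup>2" if z: "z \<in> ball z0 (min d e)" for z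
  proof -
    have sub: "cball z0 (norm (z - z0)) \<subseteq> ball z0 (min d e)"
      using z by (auto simp: dist_norm norm_minus_commute)
    have "norm (f z - f z0 - a * (z - z0)) \<le> (K * norm (z - z0)) * norm (z - z0)"
    proof (rule linear_approx_on_convex[of "cball z0 (norm (z - z0))"])
      show "cball z0 (norm (z - z0)) \<subseteq> U" using sub e(2) by fastforce
      fix y assume y: "y \<in> cball z0 (norm (z - z0))"
      then have "y \<in> ball z0 (min d e)" using sub by blast
      then have "dist y z0 < d" by (simp add: dist_commute)
      then have "norm (deriv f y - a) \<le> K * norm (y - z0)" by (rule lip)
      also have "\<dots> \<le> K * norm (z - z0)"
        using y K by (intro mult_left_mono) (auto simp: dist_norm norm_minus_commute)
      finally show "norm (deriv f y - a) \<le> K * norm (z - z0)" .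
    qed (auto simp: dist_norm norm_minus_commute)
    moreover have "\<bar>Im (f z - f z0 - a * (z - z0))\<bar> \<le> norm (f z - f z0 - a * (z - z0))"
      by (rule abs_Im_le_cmod)
    moreover have "Im (f z - f z0 - a * (z - z0)) = Im (f z) - norm a * ((z - z0) \<bullet> n)"
      using frontier_Im[OF z0 U(2)] Im_mult_a[of "z - z0"] by simp
    ultimately show ?thesis by (simp add: power2_eq_square mult.assoc)
  qed
  moreover have "ball z0 (min d e) \<subseteq> U" using e(2) by auto
  ultimately show thesis using that[of "min d e" K] d(1) e(1) K by fastforce
qed

text \<open>\<open>has_outward_normal_derivative\<close> quantifies over all outward unit normals,
  so a derivative can be read off only after one is exhibited. The quadratic estimate bounds the
  deviation of the boundary from its tangent, and along the normal the linear term of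
  \<open>Im f\<close> decides the side.\<close>

lemma outward_normal: "outward_unit_normal D z0 (- n)"
proof -
  obtain \<rho> K where \<rho>: "\<rho> > 0" "K > 0" "ball z0 \<rho> \<subseteq> U"
    and approx: "\<And>z. z \<in> ball z0 \<rho> \<Longrightarrow> \<bar>Im (f z) - norm a * ((z - z0) \<bullet> n)\<bar> \<le> K * (norm (z - z0))\<^sup>2"
    using quadratic_approx by blast
  have "((\<lambda>p. ((p - z0) \<bullet> - n) / norm (p - z0)) \<longlongrightarrow> 0) (at z0 within frontier D)"
  proof (rule Lim_null_comparison)
    show "((\<lambda>p. K / norm a * norm (p - z0)) \<longlongrightarrow> 0) (at z0 within frontier D)"
      using tendsto_mult_right_zero[OF tendsto_norm_zero[OF LIM_zero[OF tendsto_ident_at]]] .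
    have "\<bar>((p - z0) \<bullet> - n) / norm (p - z0)\<bar> \<le> K / norm a * norm (p - z0)"
      if p: "p \<in> frontier D" "p \<noteq> z0" "dist p z0 < \<rho>" for p
    proof -
      have pb: "p \<in> ball z0 \<rho>" using p by (simp add: dist_commute)
      then have "Im (f p) = 0" using p(1) \<rho>(3) by (intro frontier_Im) auto
      then have "norm a * \<bar>(p - z0) \<bullet> n\<bar> \<le> K * (norm (p - z0))\<^sup>2"
        using approx[OF pb] by (simp add: abs_mult)
      then show ?thesis using p(2) a_pos by (simp add: field_simps power2_eq_square)
    qed
    then show "\<forall>\<^sub>F p in at z0 within frontier D.
        norm (((p - z0) \<bullet> - n) / norm (p - z0)) \<le> K / norm a * norm (p - z0)"
      unfolding eventually_at using \<rho>(1) by auto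
  qed
  moreover have "\<forall>\<^sub>F s in at_right 0. z0 - s *\<^sub>R (- n) \<in> D \<and> z0 + s *\<^sub>R (- n) \<notin> closure D"
  proof -
    define r where "r = min \<rho> (norm a / K)"
    have r: "r > 0" using \<rho> a_pos by (simp add: r_def)
    then have "\<forall>\<^sub>F s in at_right 0. 0 < s \<and> s < r"
      using eventually_at_right_real[of 0 r] by simp
    then show ?thesis
    proof eventually_elim
      case (elim s)
      then have s: "0 < s" "s < \<rho>" "s < norm a / K" by (auto simp: r_def)
      have "K * s\<^sup>2 < norm a * s" using s \<rho>(2) by (simp add: field_simps power2_eq_square)
      moreover have "z0 + s *\<^sub>R n \<in> ball z0 \<rho>" "z0 - s *\<^sub>R n \<in> ball z0 \<rho>"
        using s norm_n by (auto simp: dist_norm)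
      moreover from this have "z0 + s *\<^sub>R n \<in> U" "z0 - s *\<^sub>R n \<in> U" using \<rho>(3) by blast+
      ultimately have "Im (f (z0 + s *\<^sub>R n)) > 0" "Im (f (z0 - s *\<^sub>R n)) < 0"
        using approx[of "z0 + s *\<^sub>R n"] approx[of "z0 - s *\<^sub>R n"] s norm_n n_inner_n
        by (auto simp: abs_le_iff)
      then show ?case
        using side[OF \<open>z0 + s *\<^sub>R n \<in> U\<close>] Im_neg_not_closure[OF \<open>z0 - s *\<^sub>R n \<in> U\<close>] by simp
    qed
  qed
  ultimately show ?thesis by (simp add: outward_unit_normal_def norm_n)
qed

lemma interior_ball:
  obtains R where "R > 0" "ball (z0 - R *\<^sub>R (- n)) R \<subseteq> D"
proof -
  obtain \<rho> K where \<rho>: "\<rho> > 0" "K > 0" "ball z0 \<rho> \<subseteq> U"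
    and approx: "\<And>z. z \<in> ball z0 \<rho> \<Longrightarrow> \<bar>Im (f z) - norm a * ((z - z0) \<bullet> n)\<bar> \<le> K * (norm (z - z0))\<^sup>2"
    using quadratic_approx by blast
  \<comment> \<open>With x = z - z0, membership in the tangent disc means |x|^2 < 2 R (x \<bullet>
    n). As 2 R K \<le> |a|, the quadratic error stays below the linear term.\<close>
  define R where "R = min (\<rho> / 2) (norm a / (2 * K))"
  have R: "R > 0" "2 * R \<le> \<rho>" "2 * R * K \<le> norm a"
    using \<rho> a_pos by (auto simp: R_def min_def field_simps)
  have "z \<in> D" if z: "z \<in> ball (z0 + R *\<^sub>R n) R" for z
  proof -
    define x where "x = z - z0"
    have "norm (x - R *\<^sub>R n) < R" using z by (simp add: x_def dist_norm norm_minus_commute algebra_simps)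
    then have "(norm (x - R *\<^sub>R n))\<^sup>2 < R\<^sup>2" by (intro power_strict_mono) auto
    moreover have "(norm (x - R *\<^sub>R n))\<^sup>2 = (norm x)\<^sup>2 - 2 * R * (x \<bullet> n) + R\<^sup>2"
      using n_inner_n
      by (simp only: power2_norm_eq_inner)
        (simp add: inner_diff_left inner_diff_right inner_commute power2_eq_square algebra_simps)
    ultimately have q: "(norm x)\<^sup>2 < 2 * R * (x \<bullet> n)" by simp
    have "norm x \<le> norm (x - R *\<^sub>R n) + norm (R *\<^sub>R n)" using norm_triangle_ineq[of "x - R *\<^sub>R n" "R *\<^sub>R n"] by simp
    then have "norm x < \<rho>" using \<open>norm (x - R *\<^sub>R n) < R\<close> R norm_n by simp
    then have zb: "z \<in> ball z0 \<rho>" by (simp add: x_def dist_norm norm_minus_commute)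
    have "K * (norm x)\<^sup>2 < K * (2 * R * (x \<bullet> n))" using q \<rho>(2) by (intro mult_strict_left_mono)
    also have "\<dots> = (2 * R * K) * (x \<bullet> n)" by simp
    also have "\<dots> \<le> norm a * (x \<bullet> n)"
    proof (rule mult_right_mono[OF R(3)])
      have "0 < R * (x \<bullet> n)" using q zero_le_power2[of "norm x"] by linarith
      then show "0 \<le> x \<bullet> n" using R(1) by (simp add: zero_less_mult_iff)
    qed
    finally have "Im (f z) > 0" using approx[OF zb] by (simp add: x_def[symmetric] abs_le_iff)
    then show ?thesis using side \<rho>(3) zb by blast
  qed
  then have "ball (z0 - R *\<^sub>R (- n)) R \<subseteq> D" by auto
  with R(1) show thesis by (rule that)
qed

text \<open>Moving every boundary point near \<open>z0\<close> outwards by \<open>h\<close> adds area of order \<open>h\<close>: about \<open>1 / h\<close>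
  boundary points, separated by \<open>h\<close> in the tangential direction, each have a disc of radius \<open>h / 8\<close>
  outside \<open>D\<close> and within distance \<open>h\<close>.\<close>

lemma area_growth:
  assumes "\<rho>0 > 0" and bounded_D: "bounded D"
  obtains h0 c where "h0 > 0" "c > 0"
    "\<And>h E. 0 < h \<Longrightarrow> h < h0 \<Longrightarrow> open E \<Longrightarrow> bounded E \<Longrightarrow> D \<subseteq> E \<Longrightarrow>
      (\<And>z. z \<in> frontier D \<inter> ball z0 \<rho>0 \<Longrightarrow> ball z h \<subseteq> E) \<Longrightarrow>
      measure lebesgue E \<ge> measure lebesgue D + c * h"
proof -
  \<comment> \<open>A quarter of the slope serves both uses: over length 2 \<tau> the error is half
    of |a| \<tau>, and for the discs (5/8) \<eta> < (3/8) |a|.\<close>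
  define \<eta> where "\<eta> = norm a / 4"
  have \<eta>: "\<eta> > 0" using a_pos by (simp add: \<eta>_def)
  obtain \<rho>1 where \<rho>1: "\<rho>1 > 0" "ball z0 \<rho>1 \<subseteq> U"
    and approx: "\<And>x y. x \<in> ball z0 \<rho>1 \<Longrightarrow> y \<in> ball z0 \<rho>1 \<Longrightarrow> norm (f x - f y - a * (x - y)) \<le> \<eta> * norm (x - y)"
    using linear_approx[OF \<eta>] by blast
  define \<rho> where "\<rho> = min \<rho>0 \<rho>1"
  have \<rho>: "\<rho> > 0" "\<rho> \<le> \<rho>0" "\<rho> \<le> \<rho>1" using assms \<rho>1 by (auto simp: \<rho>_def)
  have Im_approx: "\<bar>Im (f x) - Im (f y) - norm a * ((x - y) \<bullet> n)\<bar> \<le> \<eta> * norm (x - y)"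
    if "x \<in> ball z0 \<rho>" "y \<in> ball z0 \<rho>" for x y
  proof -
    have "\<bar>Im (f x - f y - a * (x - y))\<bar> \<le> \<eta> * norm (x - y)"
      using approx[of x y] that \<rho>(3) abs_Im_le_cmod order_trans by fastforce
    moreover have "Im (f x - f y - a * (x - y)) = Im (f x) - Im (f y) - norm a * ((x - y) \<bullet> n)"
      using Im_mult_a[of "x - y"] by simp
    ultimately show ?thesis by simp
  qed
  have in_U: "x \<in> U" if "x \<in> ball z0 \<rho>" for x using that \<rho>(3) \<rho>1(2) by fastforce
  \<comment> \<open>A segment in the normal direction at tangential coordinate \<tau> starts outside
    \<open>D\<close> and ends inside, so it meets the boundary.\<close>
  have "\<exists>z. z \<in> frontier D \<and> (z - z0) \<bullet> T = \<tau> \<and> norm (z - z0) \<le> 2 * \<tau>"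
    if \<tau>: "0 < \<tau>" "2 * \<tau> < \<rho>" for \<tau>
  proof -
    define p where "p s = z0 + \<tau> *\<^sub>R T + s *\<^sub>R n" for s
    have p_T: "(p s - z0) \<bullet> T = \<tau>" for s
      using T_inner_T n_inner_T by (simp add: p_def inner_add_left)
    have p_n: "(p s - z0) \<bullet> n = s" for s
      using n_inner_n n_inner_T by (simp add: p_def inner_add_left inner_commute[of T n])
    have p_norm: "norm (p s - z0) \<le> 2 * \<tau>" if "\<bar>s\<bar> \<le> \<tau>" for s
    proof -
      have "norm (p s - z0) \<le> norm (\<tau> *\<^sub>R T) + norm (s *\<^sub>R n)"
        unfolding p_def using norm_triangle_ineq[of "\<tau> *\<^sub>R T" "s *\<^sub>R n"] by (simp add: add.assoc)
      then show ?thesis using that \<tau> norm_T norm_n by simp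
    qed
    have pb: "p s \<in> ball z0 \<rho>" if "\<bar>s\<bar> \<le> \<tau>" for s
      using p_norm[OF that] \<tau> by (simp add: dist_norm norm_minus_commute)
    have near: "\<bar>Im (f (p s)) - norm a * s\<bar> \<le> norm a * \<tau> / 2" if "\<bar>s\<bar> \<le> \<tau>" for s
    proof -
      have "\<bar>Im (f (p s)) - Im (f z0) - norm a * ((p s - z0) \<bullet> n)\<bar> \<le> \<eta> * norm (p s - z0)"
        by (rule Im_approx[OF pb[OF that]]) (use \<rho> in simp)
      also have "\<dots> \<le> \<eta> * (2 * \<tau>)" using \<eta> by (intro mult_left_mono p_norm that) simp
      finally show ?thesis using frontier_Im[OF z0 U(2)] p_n by (simp add: \<eta>_def mult.commute)
    qed
    define S where "S = p ` {-\<tau>..\<tau>}"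
    have "continuous_on {-\<tau>..\<tau>} p" unfolding p_def by (intro continuous_intros)
    then have "connected S" unfolding S_def by (rule connected_continuous_image) simp
    have a\<tau>: "norm a * \<tau> > 0" using a_pos \<tau> by simp
    have \<tau>_abs: "\<bar>\<tau>\<bar> \<le> \<tau>" "\<bar>- \<tau>\<bar> \<le> \<tau>" using \<tau> by auto
    have "Im (f (p \<tau>)) > 0" using near[OF \<tau>_abs(1)] a\<tau> by linarith
    then have "p \<tau> \<in> D" using side[OF in_U[OF pb[OF \<tau>_abs(1)]]] by simp
    moreover have "Im (f (p (- \<tau>))) < 0"
      using near[OF \<tau>_abs(2), unfolded mult_minus_right] a\<tau> by linarith
    then have "p (- \<tau>) \<notin> D" using side[OF in_U[OF pb[OF \<tau>_abs(2)]]] by simp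
    moreover have "p \<tau> \<in> S" "p (- \<tau>) \<in> S" unfolding S_def using \<tau> by (intro imageI; simp)+
    ultimately have "S \<inter> D \<noteq> {}" "S - D \<noteq> {}" by blast+
    then have "S \<inter> frontier D \<noteq> {}" by (rule connected_Int_frontier[OF \<open>connected S\<close>])
    then obtain s where "s \<in> {-\<tau>..\<tau>}" "p s \<in> frontier D" unfolding S_def by blast
    moreover from this have "\<bar>s\<bar> \<le> \<tau>" by simp linarith
    ultimately show ?thesis using p_T p_norm by blast
  qed
  then obtain pt where pt: "\<And>\<tau>. 0 < \<tau> \<Longrightarrow> 2 * \<tau> < \<rho> \<Longrightarrow> pt \<tau> \<in> frontier D"
    "\<And>\<tau>. 0 < \<tau> \<Longrightarrow> 2 * \<tau> < \<rho> \<Longrightarrow> (pt \<tau> - z0) \<bullet> T = \<tau>"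
    "\<And>\<tau>. 0 < \<tau> \<Longrightarrow> 2 * \<tau> < \<rho> \<Longrightarrow> norm (pt \<tau> - z0) \<le> 2 * \<tau>"
    by metis
  \<comment> \<open>At least \<rho> / (16 h) discs of area pi h^2 / 64 will fit, where h < \<rho> /
    16 compensates for rounding down \<rho> / (8 h).\<close>
  define h0 where "h0 = \<rho> / 16"
  define c where "c = (\<rho> / 16) * (pi / 64)"
  have "measure lebesgue E \<ge> measure lebesgue D + c * h"
    if h: "0 < h" "h < h0" and E: "open E" "bounded E" "D \<subseteq> E"
      and balls: "\<And>z. z \<in> frontier D \<inter> ball z0 \<rho>0 \<Longrightarrow> ball z h \<subseteq> E" for h E
  proof -
    define m where "m = nat \<lfloor>\<rho> / (8 * h)\<rfloor>"
    have m_real: "real m = of_int \<lfloor>\<rho> / (8 * h)\<rfloor>"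
      using \<rho> h by (simp add: m_def)
    have "real m \<le> \<rho> / (8 * h)" unfolding m_real by linarith
    then have m1: "real m * h \<le> \<rho> / 8" using h by (simp add: field_simps)
    have "real m \<ge> \<rho> / (8 * h) - 1" unfolding m_real by linarith
    then have "real m * h \<ge> (\<rho> / (8 * h) - 1) * h" using h by (intro mult_right_mono) auto
    also have "(\<rho> / (8 * h) - 1) * h = \<rho> / 8 - h" using h by (simp add: field_simps)
    finally have m2: "real m * h \<ge> \<rho> / 16" using h by (simp add: h0_def)
    \<comment> \<open>The tangential positions start at h, since \<open>pt\<close> is specified for
      positive parameters only.\<close>
    define \<tau> where "\<tau> j = real (Suc j) * h" for j
    have \<tau>: "0 < \<tau> j" "2 * \<tau> j \<le> \<rho> / 4" if "j < m" for j
    proof -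
      show "0 < \<tau> j" using h by (simp add: \<tau>_def)
      have "\<tau> j \<le> real m * h" unfolding \<tau>_def using that h by (intro mult_right_mono) auto
      then show "2 * \<tau> j \<le> \<rho> / 4" using m1 by simp
    qed
    have \<tau>': "2 * \<tau> j < \<rho>" if "j < m" for j using \<tau>(2)[OF that] \<rho> by simp
    \<comment> \<open>A point of such a disc lies less than h from \<open>pt (\<tau> j)\<close>,
      more than 3 h / 8 outwards and less than h / 8 sideways. These three bounds give inclusion in
      E, disjointness from \<open>D\<close> and mutual disjointness.\<close>
    define B where "B j = ball (pt (\<tau> j) - (h / 2) *\<^sub>R n) (h / 8)" for j
    have B_shape: "\<exists>x. z = pt (\<tau> j) + x \<and> norm x \<le> 5 / 8 * h \<and> x \<bullet> n < - 3 / 8 * h \<and> \<bar>x \<bullet> T\<bar> < h / 8"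
      if z: "z \<in> B j" for z j
    proof -
      define y where "y = z - pt (\<tau> j) + (h / 2) *\<^sub>R n"
      define x where "x = y - (h / 2) *\<^sub>R n"
      have y: "norm y < h / 8"
        using z by (simp add: B_def y_def dist_norm norm_minus_commute algebra_simps)
      have "norm x \<le> norm y + norm ((h / 2) *\<^sub>R n)" unfolding x_def by (rule norm_triangle_ineq4)
      then have "norm x \<le> 5 / 8 * h" using y h norm_n by simp
      moreover have "\<bar>y \<bullet> n\<bar> \<le> norm y" "\<bar>y \<bullet> T\<bar> \<le> norm y"
        using Cauchy_Schwarz_ineq2[of y n] Cauchy_Schwarz_ineq2[of y T] norm_n norm_T by auto
      moreover have "x \<bullet> n = y \<bullet> n - h / 2" "x \<bullet> T = y \<bullet> T"
        using n_inner_n n_inner_T by (simp_all add: x_def inner_diff_left)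
      moreover have "z = pt (\<tau> j) + x" by (simp add: x_def y_def)
      ultimately show ?thesis using y by (intro exI[of _ x]) auto
    qed
    have pt_ball: "pt (\<tau> j) \<in> frontier D \<inter> ball z0 \<rho>" if "j < m" for j
      using pt(1,3)[OF \<tau>(1)[OF that] \<tau>'[OF that]] \<tau>'[OF that]
      by (simp add: dist_norm norm_minus_commute)
    have B_E: "B j \<subseteq> E" if "j < m" for j
    proof
      fix z assume "z \<in> B j"
      then obtain x where x: "z = pt (\<tau> j) + x" "norm x \<le> 5 / 8 * h" using B_shape by blast
      then have "z \<in> ball (pt (\<tau> j)) h" using h by (simp add: dist_norm)
      moreover have "pt (\<tau> j) \<in> frontier D \<inter> ball z0 \<rho>0" using pt_ball[OF that] \<rho>(2) by auto
      ultimately show "z \<in> E" using balls by blast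
    qed
    have B_D: "B j \<inter> D = {}" if j: "j < m" for j
    proof -
      have "z \<notin> D" if zB: "z \<in> B j" for z
      proof -
        obtain x where x: "z = pt (\<tau> j) + x" "norm x \<le> 5 / 8 * h" "x \<bullet> n < - 3 / 8 * h"
          using B_shape[OF zB] by blast
        have "norm (z - z0) \<le> norm (pt (\<tau> j) - z0) + norm x"
          unfolding x(1) using norm_triangle_ineq[of "pt (\<tau> j) - z0" x] by (simp add: algebra_simps)
        also have "\<dots> < \<rho>"
          using pt(3)[OF \<tau>(1)[OF j] \<tau>'[OF j]] \<tau>(2)[OF j] x(2) h \<rho> by (simp add: h0_def)
        finally have zb: "z \<in> ball z0 \<rho>" by (simp add: dist_norm norm_minus_commute)
        have pb: "pt (\<tau> j) \<in> ball z0 \<rho>" "pt (\<tau> j) \<in> frontier D" using pt_ball[OF j] by auto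
        have "Im (f z) \<le> norm a * (x \<bullet> n) + \<eta> * norm x"
          using Im_approx[OF zb pb(1)] frontier_Im[OF pb(2) in_U[OF pb(1)]]
          by (simp add: x(1) abs_le_iff)
        also have "\<dots> \<le> norm a * (- 3 / 8 * h) + \<eta> * (5 / 8 * h)"
          using x \<eta> a_pos by (intro add_mono mult_left_mono) auto
        also have "\<dots> = - (7 / 32) * (norm a * h)" by (simp add: \<eta>_def)
        also have "\<dots> < 0" using a_pos h by simp
        finally show "z \<notin> D" using side[OF in_U[OF zb]] by simp
      qed
      then show ?thesis by blast
    qed
    have B_disj: "B i \<inter> B j = {}" if ij: "i < m" "j < m" "i \<noteq> j" for i j
    proof -
      have False if z: "z \<in> B i" "z \<in> B j" for z
      proof -
        obtain x where x: "z = pt (\<tau> i) + x" "\<bar>x \<bullet> T\<bar> < h / 8" using B_shape[OF z(1)] by blast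
        obtain y where y: "z = pt (\<tau> j) + y" "\<bar>y \<bullet> T\<bar> < h / 8" using B_shape[OF z(2)] by blast
        have "(z - z0) \<bullet> T = \<tau> i + x \<bullet> T"
          using pt(2)[OF \<tau>(1)[OF ij(1)] \<tau>'[OF ij(1)]] by (simp add: x(1) inner_add_left inner_diff_left)
        moreover have "(z - z0) \<bullet> T = \<tau> j + y \<bullet> T"
          using pt(2)[OF \<tau>(1)[OF ij(2)] \<tau>'[OF ij(2)]] by (simp add: y(1) inner_add_left inner_diff_left)
        ultimately have "\<bar>\<tau> i - \<tau> j\<bar> < h" using x(2) y(2) h by linarith
        moreover have "\<tau> i - \<tau> j = (real i - real j) * h" by (simp add: \<tau>_def algebra_simps)
        ultimately have "\<bar>real i - real j\<bar> * h < 1 * h" using h by (simp add: abs_mult)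
        then have "\<bar>real i - real j\<bar> < 1" using h mult_less_cancel_right_pos by blast
        then show False using ij(3) by linarith
      qed
      then show ?thesis by blast
    qed
    have mB: "measure lebesgue (B j) = pi * (h / 8)\<^sup>2" for j
      unfolding B_def using measure_ball_complex[of "h / 8"] h by simp
    have "measure lebesgue (\<Union>j\<in>{..<m}. B j) = (\<Sum>j\<in>{..<m}. measure lebesgue (B j))"
      by (rule measure_UNION')
        (auto simp: B_def[symmetric] pairwise_def disjnt_def B_disj, auto simp: B_def)
    then have mU: "measure lebesgue (\<Union>j\<in>{..<m}. B j) = real m * (pi * (h / 8)\<^sup>2)"
      by (simp add: mB)
    have lm: "D \<in> lmeasurable" "E \<in> lmeasurable" "(\<Union>j\<in>{..<m}. B j) \<in> lmeasurable"
      using open_D bounded_D E by (auto simp: B_def intro!: lmeasurable_open fmeasurable.finite_UN)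
    have "measure lebesgue D + measure lebesgue (\<Union>j\<in>{..<m}. B j) = measure lebesgue (D \<union> (\<Union>j\<in>{..<m}. B j))"
    proof (rule measure_Union[symmetric, unfolded infinity_ennreal_def])
      show "D \<inter> (\<Union>j\<in>{..<m}. B j) = {}" using B_D by blast
    qed (intro fmeasurableD2 fmeasurableD lm)+
    also have "\<dots> \<le> measure lebesgue E"
      by (rule measure_mono_fmeasurable) (use lm E B_E in auto)
    finally have "measure lebesgue D + real m * (pi * (h / 8)\<^sup>2) \<le> measure lebesgue E" using mU by simp
    moreover have "c * h \<le> real m * (pi * (h / 8)\<^sup>2)"
    proof -
      have "c * h = (\<rho> / 16) * (pi / 64 * h)" by (simp add: c_def)
      also have "\<dots> \<le> (real m * h) * (pi / 64 * h)" using m2 h by (intro mult_right_mono) auto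
      also have "\<dots> = real m * (pi * (h / 8)\<^sup>2)" by (simp add: power2_eq_square)
      finally show ?thesis .
    qed
    ultimately show ?thesis by linarith
  qed
  moreover have "h0 > 0" "c > 0" using \<rho> by (auto simp: h0_def c_def)
  ultimately show thesis using that by blast
qed

end

section \<open>The moving boundary\<close>

text \<open>The signed distance is 0 at time \<open>t\<close> and falls at rate v, so shortly
  afterwards it is below - (v / 2) (s - t), and the distance to the complement is at least (v / 2)
  (s - t). A single natural number controls both rate and time window, which makes the family of
  conditions countable.\<close>

lemma velocity_gives_growth:
  assumes vel: "has_normal_velocity D t z v" and v: "v > 0" and t: "t \<ge> 0"
    and z: "z \<in> frontier (D t)" and op: "open (D t)"
  obtains k :: nat where
    "\<And>s. t < s \<Longrightarrow> s < t + 1 / real (Suc k) \<Longrightarrow> (s - t) / real (Suc k) \<le> infdist z (- D s)"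
proof -
  have zD: "z \<in> closure (D t)" "z \<in> - D t"
    using z op by (auto simp: frontier_def interior_open)
  moreover have "D t \<noteq> {}" using zD(1) by auto
  ultimately have "infdist z (D t) = 0" "infdist z (- D t) = 0"
    using in_closure_iff_infdist_zero[of "D t" z] by auto
  then have sd0: "signed_dist (D t) z = 0" by (simp add: signed_dist_def)
  have "((\<lambda>s. (signed_dist (D s) z - signed_dist (D t) z) / (s - t)) \<longlongrightarrow> - v) (at t within {0..})"
    using vel unfolding has_normal_velocity_def has_field_derivative_iff .
  then have "\<forall>\<^sub>F s in at t within {0..}. signed_dist (D s) z / (s - t) < - (v / 2)"
    unfolding sd0 by (intro order_tendstoD(2)[of _ "- v"]) (use v in auto)
  then obtain d where d: "d > 0"
    "\<And>s. s \<in> {0..} \<Longrightarrow> s \<noteq> t \<Longrightarrow> dist s t < d \<Longrightarrow> signed_dist (D s) z / (s - t) < - (v / 2)"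
    unfolding eventually_at by blast
  obtain k where k: "inverse (real (Suc k)) < min d (v / 2)"
    using reals_Archimedean[of "min d (v / 2)"] d(1) v by auto
  show thesis
  proof (rule that[of k])
    fix s assume s: "t < s" "s < t + 1 / real (Suc k)"
    have "dist s t < d" using s k by (simp add: dist_real_def inverse_eq_divide)
    then have "signed_dist (D s) z / (s - t) < - (v / 2)" using s t by (intro d) auto
    then have "signed_dist (D s) z < - (v / 2) * (s - t)" using s by (simp add: pos_divide_less_eq)
    moreover have "infdist z (D s) \<ge> 0" by (rule infdist_nonneg)
    ultimately have "v / 2 * (s - t) \<le> infdist z (- D s)" by (simp add: signed_dist_def)
    moreover have "inverse (real (Suc k)) * (s - t) \<le> v / 2 * (s - t)"
      using k s by (intro mult_right_mono) auto
    moreover have "(s - t) / real (Suc k) = inverse (real (Suc k)) * (s - t)"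
      by (subst mult.commute) (rule divide_inverse)
    ultimately show "(s - t) / real (Suc k) \<le> infdist z (- D s)" by linarith
  qed
qed

lemma ball_subset_if_infdist:
  assumes "h \<le> infdist z (- S)" shows "ball z h \<subseteq> S"
proof
  fix x assume "x \<in> ball z h"
  then show "x \<in> S" using assms infdist_le[of x "- S" z] by (cases "x \<in> S") auto
qed

text \<open>Otherwise every \<open>S - A n\<close> would be dense and relatively open in the closed
  set \<open>S\<close>, and Baire's theorem would make their intersection dense. The cover makes
  that intersection empty.\<close>

lemma Baire_uniform:
  fixes S :: "'a::{real_normed_vector,heine_borel} set"
  assumes S: "closed S" "S \<noteq> {}" and cl: "\<And>n::nat. closed (A n)" and cov: "S \<subseteq> (\<Union>n. A n)"
  obtains n x \<rho> where "x \<in> S" "\<rho> > 0" "S \<inter> ball x \<rho> \<subseteq> A n"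
proof -
  have "\<exists>n x \<rho>. x \<in> S \<and> \<rho> > 0 \<and> S \<inter> ball x \<rho> \<subseteq> A n"
  proof (rule ccontr)
    assume neg: "\<not> ?thesis"
    have "S \<subseteq> closure (\<Inter>(range (\<lambda>n. S - A n)))"
    proof (rule Baire[OF S(1)])
      fix X assume "X \<in> range (\<lambda>n. S - A n)"
      then obtain n where X: "X = S - A n" by blast
      have "openin (top_of_set S) (S \<inter> (- A n))" by (intro openin_open_Int open_Compl cl)
      moreover have "S \<subseteq> closure X"
      proof
        fix x assume "x \<in> S"
        show "x \<in> closure X"
          unfolding closure_approachable
        proof (intro allI impI)
          fix e :: real assume "e > 0"
          with neg \<open>x \<in> S\<close> have "\<not> S \<inter> ball x e \<subseteq> A n" by blast
          then show "\<exists>y\<in>X. dist y x < e" unfolding X by (auto simp: dist_commute)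
        qed
      qed
      ultimately show "openin (top_of_set S) X \<and> S \<subseteq> closure X" by (simp add: X Diff_eq)
    qed simp
    moreover have "\<Inter>(range (\<lambda>n. S - A n)) = {}" using cov by auto
    ultimately have "S \<subseteq> closure {}" by (simp only:)
    then show False using S(2) by simp
  qed
  then show thesis using that by blast
qed

lemma analytic_boundary_chart:
  assumes "bounded_domain D" "analytic_boundary D" "z \<in> frontier D"
  obtains U f where "boundary_chart D z U f"
proof -
  obtain U f where "open U" "z \<in> U" "f holomorphic_on U" "inj_on f U" "\<forall>p\<in>U. p \<in> D \<longleftrightarrow> Im (f p) > 0"
    using assms(2,3) unfolding analytic_boundary_def by blast
  then show thesis
    using assms(1,3) by (intro that[of U f]) (simp add: boundary_chart_def bounded_domain_def)
qed

lemma growth_velocity_pos: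
  assumes dom: "bounded_domain (D t)" and an: "analytic_boundary (D t)" and t: "t \<ge> 0"
    and eg: "elliptic_growth D u w" and z: "z \<in> frontier (D t)"
  obtains v where "v > 0" "has_normal_velocity D t z v"
proof -
  note eg' = eg[unfolded elliptic_growth_def]
  obtain \<Omega> where \<Omega>: "open \<Omega>" "\<forall>t\<ge>0. closure (D t) \<subseteq> \<Omega>" "smooth_on \<Omega> u" "\<forall>z\<in>\<Omega>. 0 \<le> u z"
    using conjunct1[OF eg'] by (elim exE conjE)
  have sub: "closure (D t) \<subseteq> \<Omega>" using \<Omega>(2) t by simp
  have w: "w \<in> D t" using conjunct1[OF conjunct2[OF eg']] t by simp
  obtain g where g: "green_function (D t) u w g"
    and g_vel: "\<forall>z\<in>frontier (D t). \<exists>v. has_normal_velocity D t z v \<and>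
      has_outward_normal_derivative g (D t) z v"
    using conjunct2[OF conjunct2[OF eg'], rule_format, OF t] by (elim exE conjE)
  obtain v where v: "has_normal_velocity D t z v" "has_outward_normal_derivative g (D t) z v"
    using g_vel[rule_format, OF z] by (elim exE conjE)
  have "Ck_on 0 \<Omega> u" using \<Omega>(3) unfolding smooth_on_def by blast
  then have uc: "continuous_on (closure (D t)) u"
    using continuous_on_subset[OF _ sub] by simp
  have "bounded (D t)" using dom by (simp add: bounded_domain_def)
  then have "bounded (u ` closure (D t))"
    by (intro compact_imp_bounded compact_continuous_image uc) (simp add: compact_closure)
  \<comment> \<open>The closure of \<open>D t\<close> is compact and contained in \<Omega>, so the
    continuous potential is bounded on it.\<close>
  then obtain M where M: "\<forall>x\<in>u ` closure (D t). norm x \<le> M" unfolding bounded_iff by blast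
  have "green (D t) u w g M"
  proof
    show "continuous_on (D t) u" by (rule continuous_on_subset[OF uc closure_subset])
    fix x assume "x \<in> D t"
    then have x: "x \<in> closure (D t)" using closure_subset by blast
    then show "0 \<le> u x" using \<Omega>(4) sub by blast
    show "u x \<le> M" using M x by fastforce
  qed (use dom w g in auto)
  then interpret green "D t" u w g M .
  obtain U f where "boundary_chart (D t) z U f" using analytic_boundary_chart[OF dom an z] .
  then interpret boundary_chart "D t" z U f .
  obtain R where R: "R > 0" "ball (z - R *\<^sub>R (- n)) R \<subseteq> D t" using interior_ball by blast
  have "v > 0" by (rule normal_derivative_pos[OF z outward_normal R v(2)])
  then show thesis using that v(1) by blast
qed

theorem theorem4p5:
  fixes D :: "real \<Rightarrow> complex set" and t0 :: real
  assumes domains: "\<And>t. 0 \<le> t \<Longrightarrow> bounded_domain (D t)"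
    and analytic: "\<And>t. 0 \<le> t \<Longrightarrow> analytic_boundary (D t)"
    and growing: "\<And>s t. 0 \<le> s \<Longrightarrow> s \<le> t \<Longrightarrow> D s \<subseteq> D t"
    and t0: "0 \<le> t0"
    and area: "((\<lambda>t. measure lebesgue (D t)) has_real_derivative 0) (at t0 within {0..})"
  shows "\<not> (\<exists>u w. elliptic_growth D u w)"
proof
  assume "\<exists>u w. elliptic_growth D u w"
  then obtain u w where eg: "elliptic_growth D u w" by blast
  have D0: "open (D t0)" "bounded (D t0)" "D t0 \<noteq> {}"
    using domains[OF t0] by (auto simp: bounded_domain_def)
  define S where "S = frontier (D t0)"
  have S: "closed S" by (simp add: S_def frontier_closed)
  have "S \<noteq> {}"
  proof -
    have "D t0 \<noteq> UNIV" using D0(2) not_bounded_UNIV by metis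
    then show ?thesis unfolding S_def using D0(3) by (rule frontier_not_empty[rotated])
  qed
  \<comment> \<open>Distance functions are continuous in \<open>z\<close>, so each set is an
    intersection of closed sets; the positive speed at every boundary point makes them cover the
    boundary.\<close>
  define A where "A k = {z. \<forall>s. t0 < s \<and> s < t0 + 1 / real (Suc k) \<longrightarrow>
      (s - t0) / real (Suc k) \<le> infdist z (- D s)}" for k :: nat
  have "closed (A k)" for k
  proof -
    have "closed (\<Inter>s\<in>{t0<..<t0 + 1 / real (Suc k)}. {z. (s - t0) / real (Suc k) \<le> infdist z (- D s)})"
      by (intro closed_INT ballI closed_Collect_le continuous_intros)
    also have "(\<Inter>s\<in>{t0<..<t0 + 1 / real (Suc k)}. {z. (s - t0) / real (Suc k) \<le> infdist z (- D s)}) = A k"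
      by (auto simp: A_def)
    finally show ?thesis .
  qed
  moreover have "S \<subseteq> (\<Union>k. A k)"
  proof
    fix z assume "z \<in> S"
    then have z: "z \<in> frontier (D t0)" by (simp add: S_def)
    obtain v where v: "v > 0" "has_normal_velocity D t0 z v"
      using growth_velocity_pos[where D = D, OF domains[OF t0] analytic[OF t0] t0 eg z] by blast
    obtain k where "\<And>s. t0 < s \<Longrightarrow> s < t0 + 1 / real (Suc k) \<Longrightarrow>
        (s - t0) / real (Suc k) \<le> infdist z (- D s)"
      using velocity_gives_growth[OF v(2,1) t0 z D0(1)] by blast
    then have "z \<in> A k" by (simp add: A_def)
    then show "z \<in> (\<Union>k. A k)" by blast
  qed
  ultimately obtain k z0 \<rho> where sub: "z0 \<in> S" "\<rho> > 0" "S \<inter> ball z0 \<rho> \<subseteq> A k"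
    using Baire_uniform[OF S \<open>S \<noteq> {}\<close>, of A] by blast
  obtain U f where "boundary_chart (D t0) z0 U f"
    using analytic_boundary_chart[OF domains[OF t0] analytic[OF t0]] sub(1) unfolding S_def by blast
  then interpret boundary_chart "D t0" z0 U f .
  obtain h0 c where h0: "h0 > 0" "c > 0"
    and grow: "\<And>h E. 0 < h \<Longrightarrow> h < h0 \<Longrightarrow> open E \<Longrightarrow> bounded E \<Longrightarrow> D t0 \<subseteq> E \<Longrightarrow>
      (\<And>z. z \<in> frontier (D t0) \<inter> ball z0 \<rho> \<Longrightarrow> ball z h \<subseteq> E) \<Longrightarrow>
      measure lebesgue E \<ge> measure lebesgue (D t0) + c * h"
    using area_growth[OF sub(2) D0(2)] by blast
  define K where "K = real (Suc k)"
  have K: "K \<ge> 1" by (simp add: K_def)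
  have "((\<lambda>s. (measure lebesgue (D s) - measure lebesgue (D t0)) / (s - t0)) \<longlongrightarrow> 0) (at t0 within {0..})"
    using area unfolding has_field_derivative_iff .
  moreover have "0 < c / K" using h0 K by simp
  ultimately have "\<forall>\<^sub>F s in at t0 within {0..}.
      (measure lebesgue (D s) - measure lebesgue (D t0)) / (s - t0) < c / K"
    by (rule order_tendstoD)
  then obtain d where d: "d > 0" "\<And>s. s \<in> {0..} \<Longrightarrow> s \<noteq> t0 \<Longrightarrow> dist s t0 < d \<Longrightarrow>
      (measure lebesgue (D s) - measure lebesgue (D t0)) / (s - t0) < c / K"
    unfolding eventually_at by blast
  \<comment> \<open>The time step is below three limits: \<open>d\<close> for the area quotient,
    \<open>1 / K\<close> for the window of \<open>A k\<close>, and \<open>h0\<close> for the disc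
    count at radius \<open>\<delta> / K\<close>.\<close>
  define \<delta> where "\<delta> = min (min d (1 / K)) h0 / 2"
  have \<delta>: "0 < \<delta>" "\<delta> < d" "\<delta> < 1 / K" "\<delta> < h0"
  proof -
    have "min (min d (1 / K)) h0 > 0" using d(1) h0(1) K by simp
    then show "0 < \<delta>" "\<delta> < d" "\<delta> < 1 / K" "\<delta> < h0" by (simp_all add: \<delta>_def, linarith+)
  qed
  define s where "s = t0 + \<delta>"
  have s: "0 \<le> s" "t0 \<le> s" using t0 \<delta> by (auto simp: s_def)
  have "measure lebesgue (D s) \<ge> measure lebesgue (D t0) + c * (\<delta> / K)"
  proof (rule grow)
    show "0 < \<delta> / K" using \<delta> K by simp
    have "\<delta> / K \<le> \<delta>" using \<delta> K by (simp add: divide_le_eq mult_le_cancel_left1)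
    then show "\<delta> / K < h0" using \<delta> by linarith
    show "open (D s)" "bounded (D s)" using domains[OF s(1)] by (auto simp: bounded_domain_def)
    show "D t0 \<subseteq> D s" by (rule growing[OF t0 s(2)])
    fix z assume "z \<in> frontier (D t0) \<inter> ball z0 \<rho>"
    then have "z \<in> A k" using sub(3) by (auto simp: S_def)
    then have "\<forall>s. t0 < s \<and> s < t0 + 1 / K \<longrightarrow> (s - t0) / K \<le> infdist z (- D s)"
      unfolding A_def K_def by (rule CollectD)
    moreover have "t0 < s" "s < t0 + 1 / K" using \<delta>(1,3) unfolding s_def by linarith+
    ultimately have "(s - t0) / K \<le> infdist z (- D s)" by blast
    moreover have "s - t0 = \<delta>" by (simp add: s_def)
    ultimately show "ball z (\<delta> / K) \<subseteq> D s" by (intro ball_subset_if_infdist) (simp only:)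
  qed
  moreover have "(measure lebesgue (D s) - measure lebesgue (D t0)) / (s - t0) < c / K"
    by (rule d(2)) (use s \<delta> in \<open>auto simp: s_def dist_real_def\<close>)
  moreover have "s - t0 = \<delta>" by (simp add: s_def)
  ultimately have "c * (\<delta> / K) / \<delta> < c / K"
    using \<delta>(1) by (smt (verit) divide_right_mono)
  then show False using \<delta>(1) by simp
qed

end
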